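(* Let $\mathcal{U}_{i,n}=UT_n(\mathcal{R}_i)$ for $i\in\{1,2\}$, with $\mathcal{R}_1,\mathcal{R}_2$ the commutative rings described in the context. Then (1) in $\mathrm{ZFC}+\mathrm{CH}$, for each integer $n\geq 3$, $\mathcal{U}_{1,n}$ is isomorphic to $\mathcal{U}_{2,n}$; (2) in $\mathrm{ZFC}+\mathrm{OCA}$, for each integer $n\geq 3$, $\mathcal{U}_{1,n}$ is not isomorphic to $\mathcal{U}_{2,n}$.
   Context: $\mathcal{R}_1=(\mathcal{P}(\mathbb{N})/Fin,\Delta,\cap,\mathbf{1})$, where $\mathcal{P}(\mathbb{N})/Fin$ is the quotient of $\mathcal{P}(\mathbb{N})$ by $A\approx B$ iff the symmetric difference $A\Delta B$ is finite. $\mathcal{R}_2=(\mathcal{P}(\mathbb{T})/I,\Delta,\cap,\mathbf{1})$, where $\mathbb{T}=\{l,r\}^\star$ ordered by prefix, $I=\{B\subseteq\mathbb{T}:B$ has no infinite antichain (infinite set of pairwise prefix-incomparable words)$\}$, and the quotient is by $A\approx_I B$ iff $A\Delta B\in I$. Operations $\Delta$ (ring addition) and $\cap$ (ring multiplication) are defined on representatives, $\mathbf{1}$ (class of the whole set) is the unity. For a unitary ring $R$, $UT_n(R)$ is the group, under matrix multiplication, of upper triangular $n\times n$ matrices over $R$ with all diagonal entries equal to the unity $1$ of $R$. CH is the Continuum Hypothesis; OCA is the Open Coloring Axiom: if $X\subseteq\mathbb{R}$ and $[X]^2=K_0\cup K_1$ with $K_0$ open in $X\times X$, then either some uncountable $Y\subseteq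 X$ has $[Y]^2\subseteq K_0$, or $X$ is a countable union of sets $H_n$ with $[H_n]^2\subseteq K_1$. *)

theory Defs
  imports
    "HOL-Analysis.Abstract_Topology"
    "HOL-Library.Equipollence"
    "HOL-Library.Ramsey"
    "HOL-Library.Sublist"
    "Jordan_Normal_Form.Matrix"
begin

section \<open>The ring of subsets of the natural numbers modulo finite sets\<close>

definition eq_fin :: "nat set \<Rightarrow> nat set \<Rightarrow> bool"
  where "eq_fin A B \<longleftrightarrow> finite (sym_diff A B)"

lemma equivp_eq_fin: "equivp eq_fin"
proof (rule equivpI)
  show "reflp eq_fin" by (rule reflpI) (simp add: eq_fin_def)
  show "symp eq_fin" by (rule sympI) (simp add: eq_fin_def Un_commute)
  show "transp eq_fin"
  proof (rule transpI)
    fix A B C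
    assume "eq_fin A B" "eq_fin B C"
    then have "finite (sym_diff A B \<union> sym_diff B C)" by (simp add: eq_fin_def)
    then show "eq_fin A C" unfolding eq_fin_def by (rule rev_finite_subset) auto
  qed
qed

quotient_type pow_mod_fin = "nat set" / eq_fin
  by (rule equivp_eq_fin)

instantiation pow_mod_fin :: comm_ring_1
begin

lift_definition zero_pow_mod_fin :: pow_mod_fin is "{}" .

lift_definition one_pow_mod_fin :: pow_mod_fin is "UNIV" .

lift_definition plus_pow_mod_fin :: "pow_mod_fin \<Rightarrow> pow_mod_fin \<Rightarrow> pow_mod_fin" is sym_diff
  unfolding eq_fin_def by (erule (1) rev_finite_subset[OF finite_UnI]) auto

lift_definition times_pow_mod_fin :: "pow_mod_fin \<Rightarrow> pow_mod_fin \<Rightarrow> pow_mod_fin" is "(\<inter>)"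
  unfolding eq_fin_def by (erule (1) rev_finite_subset[OF finite_UnI]) auto

text \<open>The additive group has exponent 2, so negation is the identity and
  subtraction coincides with addition.\<close>

lift_definition uminus_pow_mod_fin :: "pow_mod_fin \<Rightarrow> pow_mod_fin" is "\<lambda>A. A" .

lift_definition minus_pow_mod_fin :: "pow_mod_fin \<Rightarrow> pow_mod_fin \<Rightarrow> pow_mod_fin" is sym_diff
  unfolding eq_fin_def by (erule (1) rev_finite_subset[OF finite_UnI]) auto

instance
proof
  have eqI: "A = B \<Longrightarrow> eq_fin A B" for A B by (simp add: eq_fin_def)
  fix a b c :: pow_mod_fin
  show "a * b * c = a * (b * c)" by transfer (rule eqI, auto)
  show "a * b = b * a" by transfer (rule eqI, auto)
  show "1 * a = a" by transfer (rule eqI, auto)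
  show "a + b + c = a + (b + c)" by transfer (rule eqI, auto)
  show "a + b = b + a" by transfer (rule eqI, auto)
  show "0 + a = a" by transfer (rule eqI, auto)
  show "- a + a = 0" by transfer (rule eqI, auto)
  show "a - b = a + - b" by transfer (rule eqI, auto)
  show "(a + b) * c = a * c + b * c" by transfer (rule eqI, auto)
  show "(0::pow_mod_fin) \<noteq> 1" by transfer (simp add: eq_fin_def)
qed

end


section \<open>The ring of subsets of the binary tree modulo sets without infinite antichains\<close>

datatype letter = Lt | Rt

type_synonym binary_tree = "letter list"

definition antichain :: "binary_tree set \<Rightarrow> bool"
  where "antichain S \<longleftrightarrow> pairwise parallel S"

definition no_inf_antichain :: "binary_tree set set"
  where "no_inf_antichain = {B. \<not> (\<exists>S\<subseteq>B. infinite S \<and> antichain S)}"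

lemma no_inf_antichain_subset:
  "A \<in> no_inf_antichain \<Longrightarrow> B \<subseteq> A \<Longrightarrow> B \<in> no_inf_antichain"
  unfolding no_inf_antichain_def by blast

lemma no_inf_antichain_Un:
  assumes "A \<in> no_inf_antichain" "B \<in> no_inf_antichain"
  shows "A \<union> B \<in> no_inf_antichain"
proof -
  have "finite S" if S: "S \<subseteq> A \<union> B" "antichain S" for S
  proof -
    have "antichain (S \<inter> A)" "antichain (S \<inter> B)"
      using S(2) by (auto simp: antichain_def elim: pairwise_subset)
    then have "finite (S \<inter> A)" "finite (S \<inter> B)"
      using assms by (auto simp: no_inf_antichain_def)
    moreover have "S = S \<inter> A \<union> S \<inter> B" using S(1) by auto
    ultimately show ?thesis by (metis finite_UnI)
  qed
  then show ?thesis by (auto simp: no_inf_antichain_def)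
qed

lemma empty_in_no_inf_antichain: "{} \<in> no_inf_antichain"
  by (auto simp: no_inf_antichain_def)

lemma UNIV_notin_no_inf_antichain: "UNIV \<notin> no_inf_antichain"
proof -
  let ?w = "\<lambda>n. replicate n Lt @ [Rt]"
  have inj: "inj ?w" by (rule injI) (metis add_right_cancel length_append length_replicate)
  have *: "\<not> prefix (?w m) (?w n)" if "m \<noteq> n" for m n
  proof
    assume p: "prefix (?w m) (?w n)"
    then have "m < n" using prefix_length_le[OF p] that by simp
    moreover obtain zs where "?w n = ?w m @ zs" using p by (auto simp: prefix_def)
    then have "?w n ! m = (?w m @ zs) ! m" by simp
    ultimately show False by (simp add: nth_append)
  qed
  have "antichain (range ?w)"
    unfolding antichain_def pairwise_def parallel_def using * by fastforce
  moreover have "infinite (range ?w)" using inj by (simp add: finite_image_iff)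
  ultimately show ?thesis by (auto simp: no_inf_antichain_def)
qed

definition eq_antichain :: "binary_tree set \<Rightarrow> binary_tree set \<Rightarrow> bool"
  where "eq_antichain A B \<longleftrightarrow> sym_diff A B \<in> no_inf_antichain"

lemma equivp_eq_antichain: "equivp eq_antichain"
proof (rule equivpI)
  show "reflp eq_antichain"
    by (rule reflpI) (simp add: eq_antichain_def empty_in_no_inf_antichain)
  show "symp eq_antichain" by (rule sympI) (simp add: eq_antichain_def Un_commute)
  show "transp eq_antichain"
  proof (rule transpI)
    fix A B C
    assume "eq_antichain A B" "eq_antichain B C"
    then have "sym_diff A B \<union> sym_diff B C \<in> no_inf_antichain"
      by (simp add: eq_antichain_def no_inf_antichain_Un)
    then show "eq_antichain A C"
      unfolding eq_antichain_def by (rule no_inf_antichain_subset) auto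
  qed
qed

quotient_type pow_mod_antichain = "binary_tree set" / eq_antichain
  by (rule equivp_eq_antichain)

instantiation pow_mod_antichain :: comm_ring_1
begin

lift_definition zero_pow_mod_antichain :: pow_mod_antichain is "{}" .

lift_definition one_pow_mod_antichain :: pow_mod_antichain is "UNIV" .

lift_definition plus_pow_mod_antichain ::
  "pow_mod_antichain \<Rightarrow> pow_mod_antichain \<Rightarrow> pow_mod_antichain" is sym_diff
  unfolding eq_antichain_def
  by (erule (1) no_inf_antichain_subset[OF no_inf_antichain_Un]) auto

lift_definition times_pow_mod_antichain ::
  "pow_mod_antichain \<Rightarrow> pow_mod_antichain \<Rightarrow> pow_mod_antichain" is "(\<inter>)"
  unfolding eq_antichain_def
  by (erule (1) no_inf_antichain_subset[OF no_inf_antichain_Un]) auto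

lift_definition uminus_pow_mod_antichain ::
  "pow_mod_antichain \<Rightarrow> pow_mod_antichain" is "\<lambda>A. A" .

lift_definition minus_pow_mod_antichain ::
  "pow_mod_antichain \<Rightarrow> pow_mod_antichain \<Rightarrow> pow_mod_antichain" is sym_diff
  unfolding eq_antichain_def
  by (erule (1) no_inf_antichain_subset[OF no_inf_antichain_Un]) auto

instance
proof
  have eqI: "A = B \<Longrightarrow> eq_antichain A B" for A B
    by (simp add: eq_antichain_def empty_in_no_inf_antichain)
  fix a b c :: pow_mod_antichain
  show "a * b * c = a * (b * c)" by transfer (rule eqI, auto)
  show "a * b = b * a" by transfer (rule eqI, auto)
  show "1 * a = a" by transfer (rule eqI, auto)
  show "a + b + c = a + (b + c)" by transfer (rule eqI, auto)
  show "a + b = b + a" by transfer (rule eqI, auto)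
  show "0 + a = a" by transfer (rule eqI, auto)
  show "- a + a = 0" by transfer (rule eqI, auto)
  show "a - b = a + - b" by transfer (rule eqI, auto)
  show "(a + b) * c = a * c + b * c" by transfer (rule eqI, auto)
  show "(0::pow_mod_antichain) \<noteq> 1"
    by transfer (simp add: eq_antichain_def UNIV_notin_no_inf_antichain)
qed

end


section \<open>Unitriangular matrix groups\<close>

definition UT :: "nat \<Rightarrow> 'a :: ring_1 mat monoid"
  where "UT n =
    \<lparr>carrier = {A \<in> carrier_mat n n. upper_triangular A \<and> (\<forall>i<n. A $$ (i, i) = 1)},
     mult = (*),
     one = 1\<^sub>m n\<rparr>"

lemma UT_mult_closed:
  fixes A B :: "'a :: ring_1 mat"
  assumes A: "A \<in> carrier (UT n)" and B: "B \<in> carrier (UT n)"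
  shows "A * B \<in> carrier (UT n)"
proof -
  have AB: "A \<in> carrier_mat n n" "B \<in> carrier_mat n n"
    using A B by (auto simp: UT_def)
  have A0: "A $$ (i, k) = 0" if "k < i" "i < n" for i k
    using A that by (auto simp: UT_def)
  have B0: "B $$ (k, j) = 0" if "j < k" "k < n" for j k
    using B that by (auto simp: UT_def)
  have e: "(A * B) $$ (i, j) = (\<Sum>k = 0..<n. A $$ (i, k) * B $$ (k, j))"
    if "i < n" "j < n" for i j
    using AB that by (auto simp: scalar_prod_def)
  have lower: "(A * B) $$ (i, j) = 0" if "j < i" "i < n" for i j
  proof -
    have "A $$ (i, k) * B $$ (k, j) = 0" if "k < n" for k
      using A0[of k i] B0[of j k] that \<open>j < i\<close> \<open>i < n\<close> by (cases "k < i") auto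
    then show ?thesis using e[of i j] that by simp
  qed
  have diag: "(A * B) $$ (i, i) = 1" if i: "i < n" for i
  proof -
    have "A $$ (i, k) * B $$ (k, i) = (if k = i then 1 else 0)" if "k < n" for k
      using A0[of k i] B0[of i k] A B that i
      by (cases k i rule: linorder_cases) (auto simp: UT_def)
    then have "(A * B) $$ (i, i) = (\<Sum>k = 0..<n. if k = i then 1 else 0)"
      using e[OF i i] by simp
    then show ?thesis using i by simp
  qed
  show ?thesis
    using AB lower diag by (auto simp: UT_def)
qed

lemma UT_left_inverse:
  fixes A :: "'a :: ring_1 mat"
  assumes "A \<in> carrier (UT n)"
  shows "\<exists>B \<in> carrier (UT n). B * A = 1\<^sub>m n"
  using assms
proof (induction n arbitrary: A)
  case 0
  then have "A * A = 1\<^sub>m 0" by (auto simp: UT_def)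
  with 0 show ?case by blast
next
  case (Suc n)
  define v where "v = mat 1 n (\<lambda>(i, j). A $$ (0, Suc j))"
  define A' where "A' = mat n n (\<lambda>(i, j). A $$ (Suc i, Suc j))"
  have v: "v \<in> carrier_mat 1 n" by (simp add: v_def)
  have A'c: "A' \<in> carrier_mat n n" by (simp add: A'_def)
  have A'U: "A' \<in> carrier (UT n)" using Suc.prems by (auto simp: UT_def A'_def upper_triangular_def)
  have A: "A = four_block_mat (1\<^sub>m 1) v (0\<^sub>m n 1) A'"
    using Suc.prems by (intro eq_matI) (auto simp: UT_def v_def A'_def)
  obtain B' where B'U: "B' \<in> carrier (UT n)" and inv: "B' * A' = 1\<^sub>m n"
    using Suc.IH[OF A'U] by blast
  have B'c: "B' \<in> carrier_mat n n" using B'U by (simp add: UT_def)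
  define B where "B = four_block_mat (1\<^sub>m 1) (- (v * B')) (0\<^sub>m n 1) B'"
  have w: "- (v * B') \<in> carrier_mat 1 n" using v B'c by auto
  have BU: "B \<in> carrier (UT (Suc n))"
  proof -
    have Bc: "B \<in> carrier_mat (Suc n) (Suc n)"
      using four_block_carrier_mat[OF one_carrier_mat B'c, of 1 "- (v * B')" "0\<^sub>m n 1"]
      by (simp add: B_def)
    have "B $$ (i, j) = 0" if "j < i" "i < Suc n" for i j
    proof (cases j)
      case 0
      then show ?thesis using that B'c by (simp add: B_def)
    next
      case (Suc k)
      have "B' $$ (i - 1, k) = 0" using that Suc B'U by (auto simp: UT_def)
      then show ?thesis using that Suc B'c by (simp add: B_def)
    qed
    moreover have "B $$ (i, i) = 1" if "i < Suc n" for i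
    proof (cases i)
      case 0
      then show ?thesis using B'c by (simp add: B_def)
    next
      case (Suc k)
      then have "B' $$ (k, k) = 1" using that B'U by (simp add: UT_def)
      then show ?thesis using that Suc B'c by (simp add: B_def)
    qed
    ultimately show ?thesis using Bc by (auto simp: UT_def)
  qed
  have "(- (v * B')) * A' = - v"
    using v B'c A'c inv by (simp add: assoc_mult_mat[of v 1 n B' n A' n])
  moreover have "v + - v = 0\<^sub>m 1 n"
    using v by (intro eq_matI) auto
  ultimately have "B * A = four_block_mat (1\<^sub>m 1) (0\<^sub>m 1 n) (0\<^sub>m n 1) (1\<^sub>m n)"
    unfolding A B_def
    using mult_four_block_mat[OF _ w zero_carrier_mat B'c _ v zero_carrier_mat A'c, of "1\<^sub>m 1" "1\<^sub>m 1"]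
      v B'c A'c w inv by simp
  also have "\<dots> = 1\<^sub>m (Suc n)" by (intro eq_matI) auto
  finally show ?case using BU by blast
qed

lemma group_UT: "group (UT n :: 'a :: ring_1 mat monoid)"
proof (rule groupI)
  fix A B C :: "'a mat"
  assume "A \<in> carrier (UT n)" "B \<in> carrier (UT n)" "C \<in> carrier (UT n)"
  then show "A \<otimes>\<^bsub>UT n\<^esub> B \<otimes>\<^bsub>UT n\<^esub> C = A \<otimes>\<^bsub>UT n\<^esub> (B \<otimes>\<^bsub>UT n\<^esub> C)"
    by (auto simp: UT_def)
next
  fix A :: "'a mat"
  assume "A \<in> carrier (UT n)"
  then show "\<exists>B\<in>carrier (UT n). B \<otimes>\<^bsub>UT n\<^esub> A = \<one>\<^bsub>UT n\<^esub>"
    using UT_left_inverse[of A n] by (simp add: UT_def)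
next
  fix A B :: "'a mat"
  assume "A \<in> carrier (UT n)" "B \<in> carrier (UT n)"
  then show "A \<otimes>\<^bsub>UT n\<^esub> B \<in> carrier (UT n)"
    using UT_mult_closed[of A n B] by (simp add: UT_def)
qed (auto simp: UT_def)


definition U1 :: "nat \<Rightarrow> pow_mod_fin mat monoid"
  where "U1 n = UT n"

definition U2 :: "nat \<Rightarrow> pow_mod_antichain mat monoid"
  where "U2 n = UT n"


section \<open>Set-theoretic hypotheses\<close>

definition continuum_hypothesis :: bool
  where "continuum_hypothesis \<longleftrightarrow>
    (\<forall>X :: real set. countable X \<or> X \<approx> (UNIV :: real set))"

text \<open>A colour class \<open>K \<subseteq> [X]\<^sup>2\<close> is identified with the symmetric set of ordered pairs
  \<open>(x, y)\<close> such that \<open>{x, y} \<in> K\<close>; openness of \<open>K\<close> in \<open>X \<times> X\<close> refers to that set.\<close>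

definition open_coloring_axiom :: bool
  where "open_coloring_axiom \<longleftrightarrow>
    (\<forall>(X :: real set) K0 K1.
       [X]\<^bsup>2\<^esup> = K0 \<union> K1 \<and>
       openin (top_of_set (X \<times> X)) {(x, y). {x, y} \<in> K0} \<longrightarrow>
       (\<exists>Y\<subseteq>X. uncountable Y \<and> [Y]\<^bsup>2\<^esup> \<subseteq> K0) \<or>
       (\<exists>H :: nat \<Rightarrow> real set. X = (\<Union>n. H n) \<and> (\<forall>n. [H n]\<^bsup>2\<^esup> \<subseteq> K1)))"

end

(*
  Part (1). Both ideals are F_sigma: a set lies in the ideal iff it lies in one of countably many
  closed hereditary families (sets of at most n elements; sets all of whose antichains have at most
  n elements). For such ideals a diagonal construction realises every consistent countable set of
  requirements on a new element, so that under CH a back-and-forth argument of length omega_1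
  matches the two quotients.

  Part (2). In UT_n(R) the sets of commutators of the elements of the second centre are exactly the
  principal ideals of R, placed in the upper right corner; for a Boolean ring R their inclusion
  order is the Boolean algebra R. So it suffices to refute, under OCA, a multiplicative injection
  theta from P(T)/I into P(N)/Fin. For a branch x of the binary tree, the subsets of N x N embed
  into P(T) by copying x into infinitely many disjoint subtrees; two sets become equal modulo I iff
  they differ in finitely many columns. Different x give almost disjoint copies, so consistent
  choices on different copies can be glued to one subset of T. OCA, applied for every n to the
  colouring that ignores the first n columns, shows that for some x the lifting of theta on the
  copy of x is, on each of countably many pieces, continuous as a function of the columns from n
  on. A fusion argument then yields two sets that differ in infinitely many columns and have the
  same image: the equivalence relation E_1 is not reducible to E_0.
*)
theory Submission
  imports Defs "HOL-Analysis.Elementary_Metric_Spaces"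
begin

section \<open>Coding sets of natural numbers by reals\<close>

text \<open>The pieces that OCA delivers are arbitrary sets, in general without the Baire property,
  so the usual proof that E_1 is not reducible to E_0, by restricting the reduction to a comeagre
  set on which it is continuous, does not apply to them. What survives is an open relation between a
  set and the finite parts of a possible value, which is correct on its own piece and carries no
  guarantee outside it. The colouring is considered for every n because the collision is reached by
  changing one column at a time: while column r changes, the value must be carried by a piece for n
  = r + 1, which cannot see that column. In the gluing this blindness is free, since finitely many
  columns are negligible modulo the antichain ideal. A map that is merely multiplicative suffices
  since a glued set is compared with a single copy only through the intersection with the full copy
  of the branch.\<close>

definition ternary :: "nat set \<Rightarrow> real"
  where "ternary A = (\<Sum>i. if i \<in> A then (1 / 3) ^ i else 0)"

lemma summable_ternary: "summable (\<lambda>i. if i \<in> A then (1 / 3 :: real) ^ i else 0)"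
  by (rule summable_comparison_test'[of "\<lambda>i. (1 / 3) ^ i" 0]) (auto simp: summable_geometric)

text \<open>At the least point n of difference the sums differ by 3^-n, and all later terms together
  contribute at most half of that; in base 2 they could cancel it. So close codes force equal
  initial segments, which is the continuity needed to make colourings open on a set of
  reals.\<close>

lemma ternary_diff_ge:
  assumes "A \<inter> {..<N} \<noteq> B \<inter> {..<N}"
  shows "(1 / 3) ^ N / 2 \<le> \<bar>ternary A - ternary B\<bar>"
proof -
  define f where "f i = (if i \<in> A then (1 / 3 :: real) ^ i else 0) - (if i \<in> B then (1 / 3) ^ i else 0)" for i
  define n where "n = (LEAST i. i \<in> sym_diff A B)"
  obtain i where "i \<in> sym_diff (A \<inter> {..<N}) (B \<inter> {..<N})" using assms by blast
  then have i: "i < N" "i \<in> sym_diff A B" by auto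
  have n: "n \<in> sym_diff A B" unfolding n_def using i(2) by (rule LeastI)
  have nN: "n < N" using Least_le[of "\<lambda>i. i \<in> sym_diff A B", OF i(2)] i(1) by (simp add: n_def)
  have f0: "f i = 0" if "i < n" for i
  proof -
    have "i \<notin> sym_diff A B" using that unfolding n_def by (rule not_less_Least)
    then show ?thesis by (auto simp: f_def)
  qed
  have fb: "\<bar>f i\<bar> \<le> (1 / 3) ^ i" for i by (auto simp: f_def)
  have sf: "summable f" unfolding f_def by (intro summable_diff summable_ternary)
  have geo: "summable (\<lambda>i. (1 / 3 :: real) ^ (i + Suc n))"
    using summable_ignore_initial_segment[of "\<lambda>i. (1 / 3 :: real) ^ i" "Suc n"] by (simp add: summable_geometric)
  have "\<bar>\<Sum>i. f (i + Suc n)\<bar> \<le> (\<Sum>i. (1 / 3) ^ (i + Suc n))"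
  proof -
    have sa: "summable (\<lambda>i. \<bar>f (i + Suc n)\<bar>)"
      by (rule summable_comparison_test'[OF geo, of 0]) (use fb in \<open>simp del: power_Suc\<close>)
    have "\<bar>\<Sum>i. f (i + Suc n)\<bar> \<le> (\<Sum>i. \<bar>f (i + Suc n)\<bar>)" using sa by (rule summable_rabs)
    also have "\<dots> \<le> (\<Sum>i. (1 / 3) ^ (i + Suc n))" by (rule suminf_le[OF fb sa geo])
    finally show ?thesis .
  qed
  also have "(\<Sum>i. (1 / 3 :: real) ^ (i + Suc n)) = (1 / 3) ^ n / 2"
  proof -
    have "(\<lambda>i. (1 / 3 :: real) ^ Suc n * (1 / 3) ^ i) sums ((1 / 3) ^ Suc n * (1 / (1 - 1 / 3)))"
      by (intro sums_mult geometric_sums) simp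
    then show ?thesis by (simp add: power_add mult.commute sums_iff)
  qed
  finally have tail: "\<bar>\<Sum>i. f (i + Suc n)\<bar> \<le> (1 / 3) ^ n / 2" .
  have "ternary A - ternary B = suminf f"
    unfolding ternary_def f_def by (intro suminf_diff summable_ternary)
  also have "\<dots> = (\<Sum>i. f (i + Suc n)) + (\<Sum>i<Suc n. f i)"
    by (rule suminf_split_initial_segment[OF sf])
  also have "(\<Sum>i<Suc n. f i) = f n" using f0 by simp
  finally have "\<bar>ternary A - ternary B\<bar> \<ge> \<bar>f n\<bar> - \<bar>\<Sum>i. f (i + Suc n)\<bar>" by linarith
  moreover have "\<bar>f n\<bar> = (1 / 3) ^ n" using n by (auto simp: f_def)
  moreover have "(1 / 3 :: real) ^ N \<le> (1 / 3) ^ n" using nN by (intro power_decreasing) auto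
  ultimately show ?thesis using tail by linarith
qed

lemma inj_ternary: "inj ternary"
proof (rule injI, rule ccontr)
  fix A B assume eq: "ternary A = ternary B" and "A \<noteq> B"
  then obtain i where "i \<in> sym_diff A B" by blast
  then have "A \<inter> {..<Suc i} \<noteq> B \<inter> {..<Suc i}" by auto
  from ternary_diff_ge[OF this] eq have "(1 / 3 :: real) ^ Suc i / 2 \<le> 0" by simp
  moreover have "(1 / 3 :: real) ^ Suc i > 0" by (rule zero_less_power) simp
  ultimately show False by linarith
qed

section \<open>Ideals that are countable unions of closed families\<close>

text \<open>For hereditary families \<open>K_closed\<close> is closedness in the product topology on
  the power set: a set outside \<open>K n\<close> has a finite subset outside.\<close>

locale fsigma_ideal =
  fixes J :: "'a set set" and K :: "nat \<Rightarrow> 'a set set"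
  assumes finite_in: "finite A \<Longrightarrow> A \<in> J"
    and Un_in: "A \<in> J \<Longrightarrow> B \<in> J \<Longrightarrow> A \<union> B \<in> J"
    and subset_in: "A \<in> J \<Longrightarrow> B \<subseteq> A \<Longrightarrow> B \<in> J"
    and in_iff: "A \<in> J \<longleftrightarrow> (\<exists>n. A \<in> K n)"
    and K_subset: "A \<in> K n \<Longrightarrow> B \<subseteq> A \<Longrightarrow> B \<in> K n"
    and K_closed: "(\<And>F. finite F \<Longrightarrow> F \<subseteq> A \<Longrightarrow> F \<in> K n) \<Longrightarrow> A \<in> K n"
begin

lemma Un_in_iff: "A \<union> B \<in> J \<longleftrightarrow> A \<in> J \<and> B \<in> J"
  using subset_in[of "A \<union> B" A] subset_in[of "A \<union> B" B] Un_in[of A B] by blast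

lemma UN_in: "finite I \<Longrightarrow> (\<And>i. i \<in> I \<Longrightarrow> A i \<in> J) \<Longrightarrow> (\<Union>i\<in>I. A i) \<in> J"
  by (induction I rule: finite_induct) (auto intro: finite_in Un_in)

text \<open>The use of the F_sigma form: being outside \<open>K n\<close> is witnessed by a finite
  part, and since finite sets are in \<open>J\<close> this part can avoid all points committed
  earlier.\<close>

lemma large_finite_part:
  assumes "A \<notin> J" "finite W"
  shows "\<exists>s. finite s \<and> s \<subseteq> A - W \<and> s \<notin> K n"
proof (rule ccontr)
  assume neg: "\<not> ?thesis"
  have "A - W \<in> K n" by (rule K_closed) (use neg in blast)
  then have "A - W \<in> J" using in_iff by blast
  then have "(A - W) \<union> W \<in> J" by (rule Un_in[OF _ finite_in[OF assms(2)]])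
  then show False using assms(1) subset_in[of "(A - W) \<union> W" A] by blast
qed

text \<open>Countable saturation of the quotient for one unknown \<open>Y\<close>. Finite pieces
  \<open>s n\<close> of the \<open>c i\<close> are put into \<open>Y\<close> and pieces
  \<open>t n\<close> kept out of it, one for each \<open>i\<close> and each level of
  \<open>K\<close>. Since \<open>s n\<close> avoids \<open>u j\<close> and \<open>t n\<close> avoids
  \<open>l j\<close> for all j up to n, every \<open>u i\<close> and \<open>l i\<close> is disturbed
  by finitely many finite pieces only.\<close>

lemma interpolation:
  fixes l u c :: "nat \<Rightarrow> 'a set"
  assumes lu: "\<And>i j. l i \<inter> u j \<in> J"
    and P: "\<And>i n. P i \<Longrightarrow> c i - (\<Union>j\<le>n. u j) \<notin> J"
    and Q: "\<And>i n. Q i \<Longrightarrow> c i - (\<Union>j\<le>n. l j) \<notin> J"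
  obtains Y where "\<And>i. l i - Y \<in> J" "\<And>i. u i \<inter> Y \<in> J"
    "\<And>i. P i \<Longrightarrow> c i \<inter> Y \<notin> J" "\<And>i. Q i \<Longrightarrow> c i - Y \<notin> J"
proof -
  \<comment> \<open>Stage \<open>n\<close> codes a pair (i, m): the piece of \<open>c i\<close> must
    leave \<open>K m\<close>. Nothing has to be chosen if requirement \<open>i\<close> is absent.
    \<open>W\<close> collects the points committed before.\<close>
  define ok where "ok R e n W s \<longleftrightarrow> finite s \<and> s \<inter> W = {} \<and> s \<inter> (\<Union>j\<le>n. e j) = {} \<and>
      (R (fst (prod_decode n)) \<longrightarrow> s \<subseteq> c (fst (prod_decode n)) \<and> s \<notin> K (snd (prod_decode n)))"
    for R and e :: "nat \<Rightarrow> 'a set" and n W s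
  have ok_ex: "\<exists>s. ok R e n W s"
    if R: "\<And>i. R i \<Longrightarrow> c i - (\<Union>j\<le>n. e j) \<notin> J" and W: "finite W" for R e n W
  proof (cases "R (fst (prod_decode n))")
    case True
    obtain s where s: "finite s" "s \<subseteq> c (fst (prod_decode n)) - (\<Union>j\<le>n. e j) - W" "s \<notin> K (snd (prod_decode n))"
      using large_finite_part[OF R[OF True] W, of "snd (prod_decode n)"] by blast
    have "s \<inter> W = {}" "s \<inter> (\<Union>j\<le>n. e j) = {}" "s \<subseteq> c (fst (prod_decode n))" using s(2) by blast+
    then have "ok R e n W s" using s(1,3) by (simp add: ok_def)
    then show ?thesis ..
  next
    case False
    then show ?thesis unfolding ok_def by (intro exI[of _ "{}"]) simp
  qed
  define sel where "sel R e n W = (SOME s. ok R e n W s)" for R and e :: "nat \<Rightarrow> 'a set" and n W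
  define W where "W = rec_nat {} (\<lambda>n w. w \<union> sel P u n w \<union> sel Q l n (w \<union> sel P u n w))"
  define s where "s n = sel P u n (W n)" for n
  define t where "t n = sel Q l n (W n \<union> s n)" for n
  have W0: "W 0 = {}" and WS: "W (Suc n) = W n \<union> s n \<union> t n" for n
    by (simp_all add: W_def s_def t_def)
  have st: "finite (W n) \<and> ok P u n (W n) (s n) \<and> ok Q l n (W n \<union> s n) (t n)" for n
  proof (induction n)
    have *: "ok P u n (W n) (s n) \<and> ok Q l n (W n \<union> s n) (t n)" if fin: "finite (W n)" for n
    proof -
      have s: "ok P u n (W n) (s n)"
        unfolding s_def sel_def by (rule someI_ex) (rule ok_ex[OF P fin])
      then have "finite (W n \<union> s n)" using fin by (simp add: ok_def)
      then have "ok Q l n (W n \<union> s n) (t n)"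
        unfolding t_def sel_def by (intro someI_ex[of "ok Q l n (W n \<union> s n)"] ok_ex Q)
      then show ?thesis using s by blast
    qed
    {
      case 0
      have "finite (W 0)" by (simp add: W0)
      then show ?case using *[of 0] by blast
    next
      case (Suc n)
      then have "finite (W (Suc n))" by (simp add: WS ok_def)
      then show ?case using *[of "Suc n"] by blast
    }
  qed
  then have s: "ok P u n (W n) (s n)" and t: "ok Q l n (W n \<union> s n) (t n)" for n by blast+
  have fs: "finite (s n)" and ft: "finite (t n)" for n using s[of n] t[of n] by (auto simp: ok_def)
  have W_sub: "s m \<union> t m \<subseteq> W n" if "m < n" for m n
    using that by (induction n) (auto simp: WS less_Suc_eq)
  have st_disj: "s m \<inter> t n = {}" for m n
  proof (cases m n rule: linorder_cases)
    case less
    then show ?thesis using W_sub[OF less] t[of n] unfolding ok_def by blast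
  next
    case equal
    then show ?thesis using t[of n] unfolding ok_def by blast
  next
    case greater
    then show ?thesis using W_sub[OF greater] s[of m] unfolding ok_def by blast
  qed
  have su: "s n \<inter> u j = {}" and tl: "t n \<inter> l j = {}" if "j \<le> n" for j n
    using s[of n] t[of n] that unfolding ok_def by blast+
  \<comment> \<open>Removing \<open>u j\<close> for j up to n costs \<open>l n\<close> only a member
    of \<open>J\<close> and lets \<open>u i\<close> meet the n-th summand only for n below
    i.\<close>
  define Y where "Y = (\<Union>n. (l n - (\<Union>j\<le>n. u j)) \<union> s n) - (\<Union>n. t n)"
  show thesis
  proof (rule that[of Y])
    fix i
    have "l i - Y \<subseteq> (\<Union>j\<in>{..i}. l i \<inter> u j) \<union> (\<Union>k\<in>{..<i}. t k)"
    proof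
      fix x assume x: "x \<in> l i - Y"
      show "x \<in> (\<Union>j\<in>{..i}. l i \<inter> u j) \<union> (\<Union>k\<in>{..<i}. t k)"
      proof (cases "x \<in> (\<Union>j\<le>i. u j)")
        case False
        then obtain k where "x \<in> t k" using x unfolding Y_def by blast
        moreover have "k < i" using tl[of i k] x \<open>x \<in> t k\<close> by (meson DiffD1 disjoint_iff not_le)
        ultimately show ?thesis by blast
      qed (use x in blast)
    qed
    moreover have "(\<Union>j\<in>{..i}. l i \<inter> u j) \<union> (\<Union>k\<in>{..<i}. t k) \<in> J"
      by (rule Un_in[OF UN_in[OF finite_atMost lu] UN_in[OF finite_lessThan finite_in[OF ft]]])
    ultimately show "l i - Y \<in> J" by (rule subset_in[rotated])
    have "u i \<inter> Y \<subseteq> (\<Union>n\<in>{..<i}. l n \<inter> u i) \<union> (\<Union>n\<in>{..<i}. s n)"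
    proof
      fix x assume x: "x \<in> u i \<inter> Y"
      then obtain n where n: "x \<in> (l n - (\<Union>j\<le>n. u j)) \<union> s n" unfolding Y_def by blast
      then have "n < i" using su[of i n] x by (cases "i \<le> n") (auto simp: not_le)
      then show "x \<in> (\<Union>n\<in>{..<i}. l n \<inter> u i) \<union> (\<Union>n\<in>{..<i}. s n)" using x n by blast
    qed
    moreover have "(\<Union>n\<in>{..<i}. l n \<inter> u i) \<union> (\<Union>n\<in>{..<i}. s n) \<in> J"
      by (rule Un_in[OF UN_in[OF finite_lessThan lu] UN_in[OF finite_lessThan finite_in[OF fs]]])
    ultimately show "u i \<inter> Y \<in> J" by (rule subset_in[rotated])
  next
    fix i assume "P i"
    have "c i \<inter> Y \<notin> K m" for m
    proof
      assume K: "c i \<inter> Y \<in> K m"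
      define n where "n = prod_encode (i, m)"
      have "s n \<subseteq> Y" using st_disj unfolding Y_def by blast
      moreover have "s n \<subseteq> c i" "s n \<notin> K m" using s[of n] \<open>P i\<close> by (simp_all add: ok_def n_def)
      ultimately show False using K_subset[OF K, of "s n"] by blast
    qed
    then show "c i \<inter> Y \<notin> J" using in_iff by blast
  next
    fix i assume "Q i"
    have "c i - Y \<notin> K m" for m
    proof
      assume K: "c i - Y \<in> K m"
      define n where "n = prod_encode (i, m)"
      have "t n \<inter> Y = {}" unfolding Y_def by blast
      moreover have "t n \<subseteq> c i" "t n \<notin> K m" using t[of n] \<open>Q i\<close> by (simp_all add: ok_def n_def)
      ultimately show False using K_subset[OF K, of "t n"] by blast
    qed
    then show "c i - Y \<notin> J" using in_iff by blast
  qed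
qed

end

text \<open>A partial isomorphism is a Boolean subalgebra of the product of the two power sets, not a
  partial function: passing to the quotients turns it into a bijection.\<close>

definition partial_iso :: "'a set set \<Rightarrow> 'b set set \<Rightarrow> ('a set \<times> 'b set) set \<Rightarrow> bool"
  where "partial_iso I J p \<longleftrightarrow> (UNIV, UNIV) \<in> p \<and>
    (\<forall>A B. (A, B) \<in> p \<longrightarrow> (- A, - B) \<in> p \<and> (A \<in> I \<longleftrightarrow> B \<in> J)) \<and>
    (\<forall>A B A' B'. (A, B) \<in> p \<longrightarrow> (A', B') \<in> p \<longrightarrow> (A \<inter> A', B \<inter> B') \<in> p)"

lemma partial_isoD:
  assumes "partial_iso I J p"
  shows "(UNIV, UNIV) \<in> p" "(A, B) \<in> p \<Longrightarrow> (- A, - B) \<in> p"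
    "(A, B) \<in> p \<Longrightarrow> A \<in> I \<longleftrightarrow> B \<in> J"
    "(A, B) \<in> p \<Longrightarrow> (A', B') \<in> p \<Longrightarrow> (A \<inter> A', B \<inter> B') \<in> p"
  using assms unfolding partial_iso_def by blast+

lemma partial_iso_Un:
  assumes p: "partial_iso I J p" and "(A, B) \<in> p" "(A', B') \<in> p"
  shows "(A \<union> A', B \<union> B') \<in> p"
proof -
  have "(- (- A \<inter> - A'), - (- B \<inter> - B')) \<in> p"
    by (intro partial_isoD[OF p] assms)
  then show ?thesis by simp
qed

lemma partial_iso_UN:
  assumes p: "partial_iso I J p" and "finite N" "\<And>j. j \<in> N \<Longrightarrow> (A j, B j) \<in> p"
  shows "((\<Union>j\<in>N. A j), (\<Union>j\<in>N. B j)) \<in> p"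
  using assms(2,3)
proof (induction N rule: finite_induct)
  case empty
  then show ?case using partial_isoD(1,2)[OF p] by force
next
  case (insert x F)
  then show ?case using partial_iso_Un[OF p, of "A x" "B x"] by simp
qed

lemma partial_iso_converse: "partial_iso I J p \<Longrightarrow> partial_iso J I (p\<inverse>)"
  unfolding partial_iso_def by simp

text \<open>\<open>Y\<close> must split the partner \<open>B\<close> of each \<open>A\<close> as
  \<open>X\<close> splits \<open>A\<close>: \<open>B \<inter> Y\<close> and \<open>B - Y\<close> are
  small exactly if \<open>A \<inter> X\<close> and \<open>A - X\<close> are. The four implications
  are the four kinds of requirements in \<open>interpolation\<close>, and \<open>p\<close> carries
  their consistency over from the side of \<open>X\<close>.\<close>

lemma partial_iso_extend:
  assumes "fsigma_ideal I K" "fsigma_ideal J K'" and p: "partial_iso I J p" and p': "countable p"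
  shows "\<exists>q. partial_iso I J q \<and> countable q \<and> p \<subseteq> q \<and> X \<in> Domain q"
proof -
  interpret I: fsigma_ideal I K by fact
  interpret J: fsigma_ideal J K' by fact
  define e where "e = from_nat_into p"
  have e: "range e = p"
    unfolding e_def using partial_isoD(1)[OF p] p' by (intro range_from_nat_into) blast+
  define a where "a i = fst (e i)" for i :: nat
  define b where "b i = snd (e i)" for i :: nat
  have ab: "(a i, b i) \<in> p" for i using e by (auto simp: a_def b_def)
  have p_ab: "\<exists>i. A = a i \<and> B = b i" if "(A, B) \<in> p" for A B
  proof -
    have "(A, B) \<in> range e" using e that by simp
    then obtain i where "(A, B) = e i" by blast
    then show ?thesis unfolding a_def b_def by (intro exI[of _ i]) (simp flip: \<open>(A, B) = e i\<close>)
  qed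
  define l where "l i = (if a i - X \<in> I then b i else {})" for i
  define u where "u i = (if a i \<inter> X \<in> I then b i else {})" for i
  \<comment> \<open>The partners of \<open>l\<close> and \<open>u\<close> on the side of
    \<open>X\<close>, where \<open>X\<close> itself separates them.\<close>
  define l' where "l' i = (if a i - X \<in> I then a i else {})" for i
  define u' where "u' i = (if a i \<inter> X \<in> I then a i else {})" for i
  have "({}, {}) \<in> p" using partial_isoD(1,2)[OF p] by force
  then have ll: "(l' i, l i) \<in> p" and uu: "(u' i, u i) \<in> p" for i
    using ab by (auto simp: l'_def l_def u'_def u_def)
  have l'X: "l' i - X \<in> I" and u'X: "u' i \<inter> X \<in> I" for i
    by (auto simp: l'_def u'_def intro: I.finite_in)
  have lu: "l i \<inter> u j \<in> J" for i j
  proof -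
    have "l' i \<inter> u' j \<in> I"
      by (rule I.subset_in[OF I.Un_in[OF l'X[of i] u'X[of j]]]) blast
    then show ?thesis using partial_isoD(3)[OF p partial_isoD(4)[OF p ll[of i] uu[of j]]] by simp
  qed
  have u_large: "b i - (\<Union>j\<le>n. u j) \<notin> J" if ni: "a i \<inter> X \<notin> I" for i n
  proof -
    have "(a i \<inter> - (\<Union>j\<in>{..n}. u' j), b i \<inter> - (\<Union>j\<in>{..n}. u j)) \<in> p"
      by (intro partial_isoD[OF p] partial_iso_UN[OF p] ab uu) auto
    moreover have "a i \<inter> - (\<Union>j\<in>{..n}. u' j) \<notin> I"
    proof
      assume *: "a i \<inter> - (\<Union>j\<in>{..n}. u' j) \<in> I"
      have "(\<Union>j\<in>{..n}. u' j \<inter> X) \<in> I" by (intro I.UN_in u'X) auto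
      from I.subset_in[OF I.Un_in[OF * this], of "a i \<inter> X"] ni show False by blast
    qed
    ultimately show ?thesis using partial_isoD(3)[OF p] by (simp add: Diff_eq)
  qed
  have l_large: "b i - (\<Union>j\<le>n. l j) \<notin> J" if ni: "a i - X \<notin> I" for i n
  proof -
    have "(a i \<inter> - (\<Union>j\<in>{..n}. l' j), b i \<inter> - (\<Union>j\<in>{..n}. l j)) \<in> p"
      by (intro partial_isoD[OF p] partial_iso_UN[OF p] ab ll) auto
    moreover have "a i \<inter> - (\<Union>j\<in>{..n}. l' j) \<notin> I"
    proof
      assume *: "a i \<inter> - (\<Union>j\<in>{..n}. l' j) \<in> I"
      have "(\<Union>j\<in>{..n}. l' j - X) \<in> I" by (intro I.UN_in l'X) auto
      from I.subset_in[OF I.Un_in[OF * this], of "a i - X"] ni show False by blast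
    qed
    ultimately show ?thesis using partial_isoD(3)[OF p] by (simp add: Diff_eq)
  qed
  obtain Y where Y: "\<And>i. l i - Y \<in> J" "\<And>i. u i \<inter> Y \<in> J"
    "\<And>i. a i \<inter> X \<notin> I \<Longrightarrow> b i \<inter> Y \<notin> J" "\<And>i. a i - X \<notin> I \<Longrightarrow> b i - Y \<notin> J"
    by (rule J.interpolation[of l u "\<lambda>i. a i \<inter> X \<notin> I" b "\<lambda>i. a i - X \<notin> I", OF lu u_large l_large])
      (assumption | rule that; assumption)+
  have inX: "A \<inter> X \<in> I \<longleftrightarrow> B \<inter> Y \<in> J" and outX: "A - X \<in> I \<longleftrightarrow> B - Y \<in> J" if AB: "(A, B) \<in> p" for A B
  proof -
    obtain i where i: "A = a i" "B = b i" using p_ab[OF AB] by blast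
    show "A \<inter> X \<in> I \<longleftrightarrow> B \<inter> Y \<in> J" using Y(2)[of i] Y(3)[of i] unfolding i u_def by (auto split: if_splits)
    show "A - X \<in> I \<longleftrightarrow> B - Y \<in> J" using Y(1)[of i] Y(4)[of i] unfolding i l_def by (auto split: if_splits)
  qed
  \<comment> \<open>Every element of the algebra generated by \<open>p\<close> and
    \<open>(X, Y)\<close> has this normal form, from which closure under complement and intersection
    can be read off.\<close>
  define m where "m = (\<lambda>((A, B), (A', B')). ((A \<inter> X) \<union> (A' - X), (B \<inter> Y) \<union> (B' - Y)))"
  define q where "q = m ` (p \<times> p)"
  have qI: "(A, B) \<in> p \<Longrightarrow> (A', B') \<in> p \<Longrightarrow> ((A \<inter> X) \<union> (A' - X), (B \<inter> Y) \<union> (B' - Y)) \<in> q" for A B A' B'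
    unfolding q_def m_def by force
  have qE: "\<exists>A B A' B'. (A, B) \<in> p \<and> (A', B') \<in> p \<and> C = (A \<inter> X) \<union> (A' - X) \<and> D = (B \<inter> Y) \<union> (B' - Y)"
    if "(C, D) \<in> q" for C D
    using that unfolding q_def m_def by auto
  have pq: "p \<subseteq> q"
  proof
    fix z assume "z \<in> p"
    then show "z \<in> q" using qI[of "fst z" "snd z" "fst z" "snd z"] by (simp add: Int_Diff_Un)
  qed
  have "partial_iso I J q"
    unfolding partial_iso_def
  proof (intro conjI allI impI)
    show "(UNIV, UNIV) \<in> q" using partial_isoD(1)[OF p] pq by blast
  next
    fix C D assume C: "(C, D) \<in> q"
    obtain A B A' B' where AB: "(A, B) \<in> p" "(A', B') \<in> p"
      and CD: "C = (A \<inter> X) \<union> (A' - X)" "D = (B \<inter> Y) \<union> (B' - Y)" using qE[OF C] by blast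
    have "- C = (- A \<inter> X) \<union> (- A' - X)" "- D = (- B \<inter> Y) \<union> (- B' - Y)" unfolding CD by blast+
    then show "(- C, - D) \<in> q" using qI[OF partial_isoD(2)[OF p AB(1)] partial_isoD(2)[OF p AB(2)]] by simp
    have "C \<in> I \<longleftrightarrow> A \<inter> X \<in> I \<and> A' - X \<in> I" unfolding CD by (rule I.Un_in_iff)
    also have "\<dots> \<longleftrightarrow> B \<inter> Y \<in> J \<and> B' - Y \<in> J" using inX[OF AB(1)] outX[OF AB(2)] by simp
    also have "\<dots> \<longleftrightarrow> D \<in> J" unfolding CD by (rule J.Un_in_iff[symmetric])
    finally show "C \<in> I \<longleftrightarrow> D \<in> J" .
  next
    fix C D C' D' assume C: "(C, D) \<in> q" and C': "(C', D') \<in> q"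
    obtain A B A' B' where AB: "(A, B) \<in> p" "(A', B') \<in> p"
      and CD: "C = (A \<inter> X) \<union> (A' - X)" "D = (B \<inter> Y) \<union> (B' - Y)" using qE[OF C] by blast
    obtain A2 B2 A2' B2' where AB2: "(A2, B2) \<in> p" "(A2', B2') \<in> p"
      and CD2: "C' = (A2 \<inter> X) \<union> (A2' - X)" "D' = (B2 \<inter> Y) \<union> (B2' - Y)" using qE[OF C'] by blast
    have "C \<inter> C' = (A \<inter> A2 \<inter> X) \<union> (A' \<inter> A2' - X)" "D \<inter> D' = (B \<inter> B2 \<inter> Y) \<union> (B' \<inter> B2' - Y)"
      unfolding CD CD2 by blast+
    then show "(C \<inter> C', D \<inter> D') \<in> q"
      using qI[OF partial_isoD(4)[OF p AB(1) AB2(1)] partial_isoD(4)[OF p AB(2) AB2(2)]] by simp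
  qed
  moreover have "countable q" unfolding q_def using p' by blast
  moreover have "(X, Y) \<in> q" using qI[OF partial_isoD(1)[OF p] \<open>({}, {}) \<in> p\<close>] by simp
  ultimately show ?thesis using pq by blast
qed

section \<open>The finite ideal and the antichain ideal as countable unions of closed
  families\<close>

lemma fsigma_ideal_finite:
  "fsigma_ideal {A :: nat set. finite A} (\<lambda>n. {A. finite A \<and> card A \<le> n})"
proof
  fix A B :: "nat set" and n
  show "A \<in> {A. finite A} \<longleftrightarrow> (\<exists>n. A \<in> {A. finite A \<and> card A \<le> n})" by auto
  show "A \<in> {A. finite A \<and> card A \<le> n} \<Longrightarrow> B \<subseteq> A \<Longrightarrow> B \<in> {A. finite A \<and> card A \<le> n}"
    using card_mono[of A B] finite_subset[of B A] by auto
  assume F: "\<And>F. finite F \<Longrightarrow> F \<subseteq> A \<Longrightarrow> F \<in> {A. finite A \<and> card A \<le> n}"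
  have "finite A"
  proof (rule ccontr)
    assume "infinite A"
    then obtain S where "finite S" "card S = Suc n" "S \<subseteq> A" using infinite_arbitrarily_large by blast
    then show False using F[of S] by simp
  qed
  then show "A \<in> {A. finite A \<and> card A \<le> n}" using F[of A] by blast
qed (auto intro: finite_subset)

lemma parallel_prefix: "w \<parallel> t \<Longrightarrow> prefix t w' \<Longrightarrow> w \<parallel> w'"
  unfolding parallel_def using prefix_same_cases[of w w' t] prefix_order.trans[of t w' w] by blast

text \<open>Following nodes above which the antichains are unbounded gives a branch; above each of its nodes
  there is an element off the branch, and suitably chosen such elements form an antichain.\<close>

lemma infinite_antichain_of_large_antichains:
  assumes "\<And>n. \<exists>S\<subseteq>B. finite S \<and> antichain S \<and> n < card S"
  shows "\<exists>S\<subseteq>B. infinite S \<and> antichain S"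
proof -
  define big where "big t \<longleftrightarrow> (\<forall>n. \<exists>S\<subseteq>{w \<in> B. prefix t w}. finite S \<and> antichain S \<and> n < card S)" for t
  have big_Nil: "big []" using assms by (simp add: big_def)
  have sub: "antichain S'" if "antichain S" "S' \<subseteq> S" for S S'
    using that unfolding antichain_def by (rule pairwise_subset)
  \<comment> \<open>An antichain above \<open>t\<close> consists of antichains above its two
    children and possibly \<open>t\<close> itself, so bounds \<open>n1\<close> and \<open>n2\<close>
    would give the bound \<open>n1 + n2 + 1\<close>.\<close>
  have big_step: "\<exists>c. big (t @ [c])" if "big t" for t
  proof (rule ccontr)
    assume "\<nexists>c. big (t @ [c])"
    then have "\<not> big (t @ [Lt])" "\<not> big (t @ [Rt])" by blast+
    then obtain n1 n2 where
      n1: "\<And>S. S \<subseteq> {w \<in> B. prefix (t @ [Lt]) w} \<Longrightarrow> finite S \<Longrightarrow> antichain S \<Longrightarrow> card S \<le> n1" and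
      n2: "\<And>S. S \<subseteq> {w \<in> B. prefix (t @ [Rt]) w} \<Longrightarrow> finite S \<Longrightarrow> antichain S \<Longrightarrow> card S \<le> n2"
      unfolding big_def not_all not_ex not_less by (metis not_less)
    obtain S where S: "S \<subseteq> {w \<in> B. prefix t w}" "finite S" "antichain S" "n1 + n2 + 1 < card S"
      using \<open>big t\<close> unfolding big_def by blast
    define S1 where "S1 = {w \<in> S. prefix (t @ [Lt]) w}"
    define S2 where "S2 = {w \<in> S. prefix (t @ [Rt]) w}"
    have "w \<in> {t} \<union> S1 \<union> S2" if wS: "w \<in> S" for w
    proof -
      have "prefix t w" using S(1) wS by blast
      then obtain z where z: "w = t @ z" by (auto simp: prefix_def)
      show ?thesis
      proof (cases z)
        case Nil
        then show ?thesis using z by simp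
      next
        case (Cons c cs)
        then show ?thesis using wS z by (cases c) (auto simp: S1_def S2_def)
      qed
    qed
    then have "S \<subseteq> {t} \<union> S1 \<union> S2" by blast
    moreover have fin: "finite S1" "finite S2" using S(2) by (simp_all add: S1_def S2_def)
    ultimately have "card S \<le> card ({t} \<union> S1 \<union> S2)" by (intro card_mono) auto
    also have "\<dots> \<le> 1 + card S1 + card S2"
      using card_Un_le[of "{t} \<union> S1" S2] card_Un_le[of "{t}" S1] by simp
    also have "card S1 \<le> n1"
      using S(1) fin sub[OF S(3), of S1] by (intro n1) (auto simp: S1_def)
    also have "card S2 \<le> n2"
      using S(1) fin sub[OF S(3), of S2] by (intro n2) (auto simp: S2_def)
    finally show False using S(4) by simp
  qed
  have "\<exists>t. \<forall>n. big (t n) \<and> (\<exists>c. t (Suc n) = t n @ [c])"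
  proof (rule dependent_nat_choice)
    show "\<exists>x. big x" using big_Nil by blast
    show "\<exists>y. big y \<and> (\<exists>c. y = x @ [c])" if "big x" for x and n :: nat using big_step[OF that] by blast
  qed
  then obtain t where t: "\<And>n. big (t n)" "\<And>n. \<exists>c. t (Suc n) = t n @ [c]" by blast
  have len: "length (t n) = n + length (t 0)" for n
  proof (induction n)
    case (Suc n)
    obtain c where c: "t (Suc n) = t n @ [c]" using t(2)[of n] by blast
    then show ?case using Suc.IH by simp
  qed simp
  have mono: "prefix (t m) (t n)" if "m \<le> n" for m n
    using that
  proof (induction n rule: dec_induct)
    case (step n)
    obtain c where c: "t (Suc n) = t n @ [c]" using t(2)[of n] by blast
    then have "prefix (t n) (t (Suc n))" by simp
    with step.IH show ?case by (rule prefix_order.trans)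
  qed simp
  have off: "\<exists>w. w \<in> B \<and> prefix (t n) w \<and> (\<exists>m. w \<parallel> t m)" for n
  proof -
    obtain S where S: "S \<subseteq> {w \<in> B. prefix (t n) w}" "finite S" "antichain S" "1 < card S"
      using t(1)[of n] unfolding big_def by blast
    then obtain w w' where w: "w \<in> S" "w' \<in> S" "w \<noteq> w'"
      using card_le_Suc0_iff_eq[of S] by (auto simp: not_le[symmetric])
    define m where "m = Suc (length w + length w')"
    have long: "\<not> prefix (t m) w" "\<not> prefix (t m) w'"
      using len[of m] prefix_length_le[of "t m" w] prefix_length_le[of "t m" w'] by (auto simp: m_def)
    have "w \<parallel> w'" using S(3) w unfolding antichain_def pairwise_def by blast
    then have "\<not> (prefix w (t m) \<and> prefix w' (t m))"
      using prefix_same_cases[of w "t m" w'] unfolding parallel_def by blast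
    then have "w \<parallel> t m \<or> w' \<parallel> t m" using long unfolding parallel_def by blast
    then show ?thesis using S(1) w by blast
  qed
  define v where "v n = (SOME w. w \<in> B \<and> prefix (t n) w \<and> (\<exists>m. w \<parallel> t m))" for n
  have v: "v n \<in> B" "prefix (t n) (v n)" "\<exists>m. v n \<parallel> t m" for n
    using someI_ex[OF off[of n]] unfolding v_def by blast+
  define nx where "nx n = (SOME m. v n \<parallel> t m)" for n
  have nx: "v n \<parallel> t (nx n)" for n
    using someI_ex[OF v(3)[of n]] unfolding nx_def .
  have nx_less: "n < nx n" for n
  proof (rule ccontr)
    assume "\<not> n < nx n"
    then have "prefix (t (nx n)) (v n)" using mono[of "nx n" n] v(2)[of n] prefix_order.trans by auto
    then show False using nx[of n] unfolding parallel_def by blast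
  qed
  \<comment> \<open>Jumping from \<open>n\<close> to a node of the branch that is already
    incomparable with \<open>v n\<close> makes all later members incomparable with
    \<open>v n\<close>.\<close>
  define k where "k i = (nx ^^ i) 0" for i
  have kS: "k (Suc i) = nx (k i)" for i by (simp add: k_def)
  have sm: "strict_mono k" unfolding strict_mono_Suc_iff kS using nx_less by blast
  have par: "v (k i) \<parallel> v (k j)" if "i < j" for i j
  proof -
    have "k (Suc i) \<le> k j" using sm that by (simp add: strict_mono_less_eq)
    then have "prefix (t (nx (k i))) (v (k j))"
      using mono[of "k (Suc i)" "k j"] v(2)[of "k j"] prefix_order.trans unfolding kS by blast
    then show ?thesis using nx parallel_prefix by blast
  qed
  have par': "v (k i) \<parallel> v (k j)" if "i \<noteq> j" for i j
    using par[of i j] par[of j i] that by (cases i j rule: linorder_cases) (auto simp: parallel_def)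
  have inj: "inj (\<lambda>i. v (k i))"
  proof (rule injI, rule ccontr)
    fix i j assume "v (k i) = v (k j)" "i \<noteq> j"
    then show False using par'[of i j] by (simp add: parallel_def)
  qed
  have "antichain (range (\<lambda>i. v (k i)))"
    unfolding antichain_def
  proof (rule pairwiseI)
    fix x y assume xy: "x \<in> range (\<lambda>i. v (k i))" "y \<in> range (\<lambda>i. v (k i))" "x \<noteq> y"
    then obtain i j where "x = v (k i)" "y = v (k j)" by blast
    then show "x \<parallel> y" using par'[of i j] xy(3) by auto
  qed
  moreover have "infinite (range (\<lambda>i. v (k i)))" using inj by (simp add: finite_image_iff)
  moreover have "range (\<lambda>i. v (k i)) \<subseteq> B" using v(1) by blast
  ultimately show ?thesis by blast
qed

text \<open>Closedness is immediate, since a violation is a finite antichain. That each member of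
  the ideal has a uniform bound on its antichains is the content of the preceding lemma.\<close>

lemma fsigma_ideal_no_inf_antichain:
  "fsigma_ideal no_inf_antichain (\<lambda>n. {B. \<forall>S\<subseteq>B. finite S \<longrightarrow> antichain S \<longrightarrow> card S \<le> n})"
proof
  fix A B :: "binary_tree set" and n
  show "finite A \<Longrightarrow> A \<in> no_inf_antichain"
    unfolding no_inf_antichain_def using finite_subset by blast
  show "A \<in> no_inf_antichain \<Longrightarrow> B \<in> no_inf_antichain \<Longrightarrow> A \<union> B \<in> no_inf_antichain"
    by (rule no_inf_antichain_Un)
  show "A \<in> no_inf_antichain \<Longrightarrow> B \<subseteq> A \<Longrightarrow> B \<in> no_inf_antichain"
    by (rule no_inf_antichain_subset)
  show "A \<in> {B. \<forall>S\<subseteq>B. finite S \<longrightarrow> antichain S \<longrightarrow> card S \<le> n} \<Longrightarrow> B \<subseteq> A \<Longrightarrow>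
      B \<in> {B. \<forall>S\<subseteq>B. finite S \<longrightarrow> antichain S \<longrightarrow> card S \<le> n}" by blast
  show "(\<And>F. finite F \<Longrightarrow> F \<subseteq> A \<Longrightarrow> F \<in> {B. \<forall>S\<subseteq>B. finite S \<longrightarrow> antichain S \<longrightarrow> card S \<le> n}) \<Longrightarrow>
      A \<in> {B. \<forall>S\<subseteq>B. finite S \<longrightarrow> antichain S \<longrightarrow> card S \<le> n}" by blast
  show "A \<in> no_inf_antichain \<longleftrightarrow> (\<exists>n. A \<in> {B. \<forall>S\<subseteq>B. finite S \<longrightarrow> antichain S \<longrightarrow> card S \<le> n})"
  proof
    assume A: "A \<in> no_inf_antichain"
    show "\<exists>n. A \<in> {B. \<forall>S\<subseteq>B. finite S \<longrightarrow> antichain S \<longrightarrow> card S \<le> n}"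
    proof (rule ccontr)
      assume "\<not> ?thesis"
      then have "\<exists>S\<subseteq>A. finite S \<and> antichain S \<and> n < card S" for n
        by (auto simp: not_le)
      from infinite_antichain_of_large_antichains[OF this] A show False
        unfolding no_inf_antichain_def by blast
    qed
  next
    assume "\<exists>n. A \<in> {B. \<forall>S\<subseteq>B. finite S \<longrightarrow> antichain S \<longrightarrow> card S \<le> n}"
    then obtain n where n: "\<And>S. S \<subseteq> A \<Longrightarrow> finite S \<Longrightarrow> antichain S \<Longrightarrow> card S \<le> n" by blast
    have False if S: "S \<subseteq> A" "infinite S" "antichain S" for S
    proof -
      obtain F where F: "finite F" "card F = Suc n" "F \<subseteq> S" using infinite_arbitrarily_large[OF S(2)] by blast
      have "antichain F" using S(3) F(3) unfolding antichain_def by (rule pairwise_subset)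
      then show False using n[of F] F subset_trans[OF F(3) S(1)] by simp
    qed
    then show "A \<in> no_inf_antichain" unfolding no_inf_antichain_def by blast
  qed
qed

section \<open>The isomorphism under CH\<close>

text \<open>The cardinal order of the reals is a shortest well-order, so a proper initial segment is
  not equipollent to the reals, and CH makes it countable.\<close>

lemma continuum_hypothesis_well_order:
  assumes continuum_hypothesis
  obtains r :: "real rel" where "wf r" "trans r" "\<And>x y. x = y \<or> (x, y) \<in> r \<or> (y, x) \<in> r"
    "\<And>x. countable {y. (y, x) \<in> r}"
proof -
  define r where "r = card_of (UNIV :: real set)"
  have wo: "well_order_on (UNIV :: real set) r"
    using card_of_card_order_on[of "UNIV :: real set"] unfolding r_def card_order_on_def by blast
  have lin: "linear_order_on (UNIV :: real set) r" and wf: "wf (r - Id)"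
    using wo unfolding well_order_on_def by blast+
  have "trans r" "antisym r" "total_on UNIV r"
    using lin unfolding linear_order_on_def partial_order_on_def preorder_on_def by blast+
  then have tr: "trans (r - Id)" by (simp add: trans_diff_Id)
  have tot: "x = y \<or> (x, y) \<in> r - Id \<or> (y, x) \<in> r - Id" for x y
    using \<open>total_on UNIV r\<close> unfolding total_on_def by blast
  have ctbl: "countable {y. (y, x) \<in> r - Id}" for x
  proof -
    have "(card_of (underS r x), r) \<in> ordLess"
      unfolding r_def by (rule card_of_underS[OF card_of_Card_order]) (simp add: Field_card_of)
    then have "\<not> underS r x \<approx> (UNIV :: real set)"
      unfolding r_def eqpoll_iff_card_of_ordIso by (rule not_ordLess_ordIso)
    then have "countable (underS r x)" using assms unfolding continuum_hypothesis_def by blast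
    moreover have "underS r x = {y. (y, x) \<in> r - Id}" unfolding underS_def by blast
    ultimately show ?thesis by simp
  qed
  show thesis by (rule that[OF wf tr tot ctbl])
qed

text \<open>Stage \<open>x\<close> takes care of \<open>f x\<close> on the left and of
  \<open>g x\<close> on the right. The earlier stages form a countable chain because initial
  segments of the well-order are countable, so \<open>F\<close> has to be closed only under unions
  of countable chains.\<close>

lemma continuum_hypothesis_back_and_forth:
  fixes F :: "('a \<times> 'b) set set" and f :: "real \<Rightarrow> 'a" and g :: "real \<Rightarrow> 'b"
  assumes CH: continuum_hypothesis
    and f: "surj f" and g: "surj g"
    and p0: "p0 \<in> F"
    and chain: "\<And>C. C \<subseteq> F \<Longrightarrow> C \<noteq> {} \<Longrightarrow> countable C \<Longrightarrow> (\<And>p q. p \<in> C \<Longrightarrow> q \<in> C \<Longrightarrow> p \<subseteq> q \<or> q \<subseteq> p) \<Longrightarrow> \<Union>C \<in> F"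
    and left: "\<And>p a. p \<in> F \<Longrightarrow> \<exists>q\<in>F. p \<subseteq> q \<and> a \<in> Domain q"
    and right: "\<And>p b. p \<in> F \<Longrightarrow> \<exists>q\<in>F. p \<subseteq> q \<and> b \<in> Range q"
  obtains C where "C \<subseteq> F" "\<And>p q. p \<in> C \<Longrightarrow> q \<in> C \<Longrightarrow> p \<subseteq> q \<or> q \<subseteq> p"
    "Domain (\<Union>C) = UNIV" "Range (\<Union>C) = UNIV"
proof -
  obtain r :: "real rel" where wf: "wf r" and tr: "trans r" and tot: "\<And>x y. x = y \<or> (x, y) \<in> r \<or> (y, x) \<in> r"
    and ctbl: "\<And>x. countable {y. (y, x) \<in> r}"
    by (rule continuum_hypothesis_well_order[OF CH]) (rule that; assumption)
  define ok where "ok P x q \<longleftrightarrow> q \<in> F \<and> P \<subseteq> q \<and> f x \<in> Domain q \<and> g x \<in> Range q" for P x q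
  \<comment> \<open>The recursion chooses blindly; that an extension exists is shown afterwards by
    induction, together with the chain property of the earlier values.\<close>
  define h where "h = wfrec r (\<lambda>h x. SOME q. ok (p0 \<union> (\<Union>y\<in>{y. (y, x) \<in> r}. h y)) x q)"
  define P where "P x = p0 \<union> (\<Union>y\<in>{y. (y, x) \<in> r}. h y)" for x
  have h: "h x = (SOME q. ok (P x) x q)" for x
    unfolding P_def by (subst def_wfrec[OF eq_reflection[OF h_def] wf]) (simp add: cut_apply)
  have ok_ex: "\<exists>q. ok (P x) x q" if PF: "P x \<in> F" for x
  proof -
    obtain q where q: "q \<in> F" "P x \<subseteq> q" "f x \<in> Domain q" using left[OF PF, of "f x"] by blast
    obtain q' where q': "q' \<in> F" "q \<subseteq> q'" "g x \<in> Range q'" using right[OF q(1), of "g x"] by blast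
    have "P x \<subseteq> q'" "f x \<in> Domain q'" using q q' by blast+
    then show ?thesis using q' unfolding ok_def by blast
  qed
  have ok: "ok (P x) x (h x)" for x
    using wf
  proof (induction x rule: wf_induct_rule)
    case (less x)
    \<comment> \<open>\<open>p0\<close> keeps the chain nonempty at the least element of the
      order.\<close>
    define C where "C = insert p0 (h ` {y. (y, x) \<in> r})"
    have sub: "h z \<subseteq> h y" if "(z, y) \<in> r" "(y, x) \<in> r" for z y
    proof -
      have "h z \<subseteq> P y" using that(1) unfolding P_def by blast
      then show ?thesis using less[OF that(2)] unfolding ok_def by blast
    qed
    have p0h: "p0 \<subseteq> h y" if "(y, x) \<in> r" for y
      using less[OF that] unfolding ok_def P_def by blast
    have "\<Union>C \<in> F"
    proof (rule chain)
      show "C \<subseteq> F" using p0 less unfolding C_def ok_def by blast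
      show "C \<noteq> {}" unfolding C_def by blast
      show "countable C" unfolding C_def using ctbl[of x] by simp
      fix p q assume "p \<in> C" "q \<in> C"
      then show "p \<subseteq> q \<or> q \<subseteq> p"
        unfolding C_def
      proof (elim insertE imageE)
        fix y z assume yz: "p = h y" "y \<in> {y. (y, x) \<in> r}" "q = h z" "z \<in> {y. (y, x) \<in> r}"
        then show ?thesis using tot[of y z] sub[of y z] sub[of z y] by blast
      qed (use p0h in blast)+
    qed
    moreover have "\<Union>C = P x" unfolding C_def P_def by simp
    ultimately show ?case using ok_ex[of x] unfolding h[of x] by (simp add: someI_ex)
  qed
  have mono: "h y \<subseteq> h x" if "(y, x) \<in> r" for x y
    using ok[of x] that unfolding ok_def P_def by blast
  show thesis
  proof (rule that[of "range h"])
    show "range h \<subseteq> F" using ok unfolding ok_def by blast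
    show "p \<subseteq> q \<or> q \<subseteq> p" if pq: "p \<in> range h" "q \<in> range h" for p q
    proof -
      obtain x y where "p = h x" "q = h y" using pq by blast
      then show ?thesis using tot[of x y] mono[of x y] mono[of y x] by blast
    qed
    have "a \<in> Domain (\<Union>(range h))" for a
    proof -
      obtain x where "a = f x" using f by blast
      then show ?thesis using ok[of x] unfolding ok_def by blast
    qed
    then show "Domain (\<Union>(range h)) = UNIV" by blast
    have "b \<in> Range (\<Union>(range h))" for b
    proof -
      obtain x where "b = g x" using g by blast
      then show ?thesis using ok[of x] unfolding ok_def by blast
    qed
    then show "Range (\<Union>(range h)) = UNIV" by blast
  qed
qed

lemma partial_iso_trivial:
  assumes "UNIV \<notin> I" "{} \<in> I" "UNIV \<notin> J" "{} \<in> J"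
  shows "partial_iso I J {(UNIV, UNIV), ({}, {})}"
  using assms unfolding partial_iso_def by auto

lemma partial_iso_Union_chain:
  assumes C: "\<And>p. p \<in> C \<Longrightarrow> partial_iso I J p" and "C \<noteq> {}"
    and chain: "\<And>p q. p \<in> C \<Longrightarrow> q \<in> C \<Longrightarrow> p \<subseteq> q \<or> q \<subseteq> p"
  shows "partial_iso I J (\<Union>C)"
  unfolding partial_iso_def
proof (intro conjI allI impI)
  show "(UNIV, UNIV) \<in> \<Union>C" using \<open>C \<noteq> {}\<close> partial_isoD(1)[OF C] by blast
next
  fix A B assume "(A, B) \<in> \<Union>C"
  then obtain p where p: "p \<in> C" "(A, B) \<in> p" by blast
  show "(- A, - B) \<in> \<Union>C" using partial_isoD(2)[OF C[OF p(1)] p(2)] p(1) by blast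
  show "A \<in> I \<longleftrightarrow> B \<in> J" by (rule partial_isoD(3)[OF C[OF p(1)] p(2)])
next
  fix A B A' B' assume AB: "(A, B) \<in> \<Union>C" "(A', B') \<in> \<Union>C"
  obtain p where p: "p \<in> C" "(A, B) \<in> p" using AB(1) by blast
  obtain q where q: "q \<in> C" "(A', B') \<in> q" using AB(2) by blast
  have "\<exists>r\<in>C. (A, B) \<in> r \<and> (A', B') \<in> r"
    using chain[OF p(1) q(1)] p q by blast
  then obtain r where r: "r \<in> C" "(A, B) \<in> r" "(A', B') \<in> r" by blast
  show "(A \<inter> A', B \<inter> B') \<in> \<Union>C" using partial_isoD(4)[OF C[OF r(1)] r(2,3)] r(1) by blast
qed

lemma CH_correspondence:
  fixes I :: "'a set set" and J :: "'b set set" and f :: "real \<Rightarrow> 'a set" and g :: "real \<Rightarrow> 'b set"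
  assumes CH: continuum_hypothesis and "surj f" "surj g"
    and I: "fsigma_ideal I K" "UNIV \<notin> I" and J: "fsigma_ideal J K'" "UNIV \<notin> J"
  shows "\<exists>G. partial_iso I J G \<and> Domain G = UNIV \<and> Range G = UNIV"
proof -
  let ?F = "{p. partial_iso I J p \<and> countable p}"
  obtain C where C: "C \<subseteq> ?F" and chain: "\<And>p q. p \<in> C \<Longrightarrow> q \<in> C \<Longrightarrow> p \<subseteq> q \<or> q \<subseteq> p"
    and D: "Domain (\<Union>C) = UNIV" and R: "Range (\<Union>C) = UNIV"
  proof (rule continuum_hypothesis_back_and_forth[OF CH assms(2,3), of "{(UNIV, UNIV), ({}, {})}" ?F])
    show "{(UNIV, UNIV), ({}, {})} \<in> ?F"
      using partial_iso_trivial[of I J] I(2) J(2) fsigma_ideal.finite_in[OF I(1)] fsigma_ideal.finite_in[OF J(1)] by simp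
    show "\<Union>C \<in> ?F" if C: "C \<subseteq> ?F" "C \<noteq> {}" "countable C" "\<And>p q. p \<in> C \<Longrightarrow> q \<in> C \<Longrightarrow> p \<subseteq> q \<or> q \<subseteq> p" for C
    proof -
      have "partial_iso I J (\<Union>C)" by (rule partial_iso_Union_chain[OF _ C(2,4)]) (use C(1) in blast)
      moreover have "countable (\<Union>C)" using countable_UN[OF C(3), of "\<lambda>p. p"] C(1) by auto
      ultimately show ?thesis by blast
    qed
    show "\<exists>q\<in>?F. p \<subseteq> q \<and> X \<in> Domain q" if "p \<in> ?F" for p X
    proof -
      have p: "partial_iso I J p" "countable p" using that by blast+
      show ?thesis using partial_iso_extend[OF I(1) J(1) p, of X] by blast
    qed
    show "\<exists>q\<in>?F. p \<subseteq> q \<and> X \<in> Range q" if p: "p \<in> ?F" for p X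
    proof -
      have "partial_iso J I (p\<inverse>)" by (rule partial_iso_converse) (use p in blast)
      moreover have "countable (p\<inverse>)"
      proof -
        have "p\<inverse> = prod.swap ` p" by force
        then show ?thesis using p by simp
      qed
      ultimately obtain q where q: "partial_iso J I q" "countable q" "p\<inverse> \<subseteq> q" "X \<in> Domain q"
        using partial_iso_extend[OF J(1) I(1), of "p\<inverse>" X] by blast
      have "q\<inverse> = prod.swap ` q" by force
      then have "q\<inverse> \<in> ?F" using partial_iso_converse[OF q(1)] q(2) by simp
      moreover have "p \<subseteq> q\<inverse>" "X \<in> Range (q\<inverse>)" using q(3,4) by auto
      ultimately show ?thesis by blast
    qed
  qed (rule that; assumption)
  have "partial_iso I J (\<Union>C)"
  proof (rule partial_iso_Union_chain[OF _ _ chain])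
    show "partial_iso I J p" if "p \<in> C" for p using C that by blast
    show "C \<noteq> {}" using D by blast
  qed
  then show ?thesis using D R by blast
qed

section \<open>From the correspondence of sets to isomorphic rings and groups\<close>

lemma surj_real_sets:
  fixes e :: "'a \<Rightarrow> nat"
  assumes "inj e"
  shows "\<exists>f :: real \<Rightarrow> 'a set. surj f"
proof -
  have "inj (\<lambda>A. ternary (e ` A))"
    by (rule injI) (simp add: inj_eq[OF inj_ternary] inj_image_eq_iff[OF assms])
  then have "surj (inv_into UNIV (\<lambda>A. ternary (e ` A)))" by (rule inj_imp_surj_inv)
  then show ?thesis by blast
qed

lemma inj_binary_tree_nat: "inj (\<lambda>w :: binary_tree. to_nat (map (\<lambda>c. c = Lt) w))"
proof (rule injI)
  fix w w' :: binary_tree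
  assume "to_nat (map (\<lambda>c. c = Lt) w) = to_nat (map (\<lambda>c. c = Lt) w')"
  then have "map (\<lambda>c. c = Lt) w = map (\<lambda>c. c = Lt) w'" by simp
  moreover have "inj (\<lambda>c. c = Lt)" by (rule injI) (metis letter.exhaust)
  ultimately show "w = w'" by (simp add: inj_map_eq_map)
qed

lemma pow_mod_fin_eq_iff: "abs_pow_mod_fin A = abs_pow_mod_fin B \<longleftrightarrow> sym_diff A B \<in> {A. finite A}"
  by (simp add: pow_mod_fin.abs_eq_iff eq_fin_def)

lemma pow_mod_antichain_eq_iff:
  "abs_pow_mod_antichain A = abs_pow_mod_antichain B \<longleftrightarrow> sym_diff A B \<in> no_inf_antichain"
  by (simp add: pow_mod_antichain.abs_eq_iff eq_antichain_def)

lemma pow_mod_fin_ex: "\<exists>A. a = abs_pow_mod_fin A"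
  by (rule pow_mod_fin.abs_induct[of _ a]) blast

lemma pow_mod_antichain_ex: "\<exists>A. a = abs_pow_mod_antichain A"
  by (rule pow_mod_antichain.abs_induct[of _ a]) blast

text \<open>\<open>G\<close> is total on both sides and closed under symmetric differences;
  preservation of smallness, applied to a difference, makes the induced map on classes both well
  defined and injective.\<close>

lemma CH_ring_iso:
  assumes continuum_hypothesis
  obtains h :: "pow_mod_fin \<Rightarrow> pow_mod_antichain" where "bij h" "\<And>a b. h (a + b) = h a + h b"
    "\<And>a b. h (a * b) = h a * h b" "h 0 = 0" "h 1 = 1"
proof -
  obtain f :: "real \<Rightarrow> nat set" where f: "surj f" using surj_real_sets[of id] by auto
  obtain g :: "real \<Rightarrow> binary_tree set" where g: "surj g" using surj_real_sets[OF inj_binary_tree_nat] by blast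
  have UNIV_fin: "UNIV \<notin> {A :: nat set. finite A}" by simp
  obtain G where G: "partial_iso {A :: nat set. finite A} no_inf_antichain G"
    and D: "Domain G = UNIV" and R: "Range G = UNIV"
    using CH_correspondence[OF assms f g fsigma_ideal_finite UNIV_fin
        fsigma_ideal_no_inf_antichain UNIV_notin_no_inf_antichain] by blast
  note top = partial_isoD(1)[OF G] and compl = partial_isoD(2)[OF G]
    and ker = partial_isoD(3)[OF G] and int = partial_isoD(4)[OF G]
  have diff: "(sym_diff A A', sym_diff B B') \<in> G" if "(A, B) \<in> G" "(A', B') \<in> G" for A B A' B'
  proof -
    have "(- (- (A \<inter> - A') \<inter> - (A' \<inter> - A)), - (- (B \<inter> - B') \<inter> - (B' \<inter> - B))) \<in> G"
      by (intro compl int that)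
    moreover have "- (- (A \<inter> - A') \<inter> - (A' \<inter> - A)) = sym_diff A A'" "- (- (B \<inter> - B') \<inter> - (B' \<inter> - B)) = sym_diff B B'"
      by blast+
    ultimately show ?thesis by simp
  qed
  have bot: "({}, {}) \<in> G" using compl[OF top] by simp
  have eq_iff: "abs_pow_mod_fin A = abs_pow_mod_fin A' \<longleftrightarrow> abs_pow_mod_antichain B = abs_pow_mod_antichain B'"
    if "(A, B) \<in> G" "(A', B') \<in> G" for A B A' B'
    unfolding pow_mod_fin_eq_iff pow_mod_antichain_eq_iff by (rule ker[OF diff[OF that]])
  define h where "h a = (SOME b. \<exists>A B. (A, B) \<in> G \<and> a = abs_pow_mod_fin A \<and> b = abs_pow_mod_antichain B)" for a
  have h: "h (abs_pow_mod_fin A) = abs_pow_mod_antichain B" if AB: "(A, B) \<in> G" for A B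
    unfolding h_def
  proof (rule some_equality)
    show "\<exists>A' B'. (A', B') \<in> G \<and> abs_pow_mod_fin A = abs_pow_mod_fin A' \<and> abs_pow_mod_antichain B = abs_pow_mod_antichain B'"
      using AB by blast
  next
    fix b assume "\<exists>A' B'. (A', B') \<in> G \<and> abs_pow_mod_fin A = abs_pow_mod_fin A' \<and> b = abs_pow_mod_antichain B'"
    then obtain A' B' where "(A', B') \<in> G" "abs_pow_mod_fin A = abs_pow_mod_fin A'" "b = abs_pow_mod_antichain B'" by blast
    then show "b = abs_pow_mod_antichain B" using eq_iff[OF AB, of A' B'] by simp
  qed
  have rep: "\<exists>A B. (A, B) \<in> G \<and> a = abs_pow_mod_fin A" for a
    using pow_mod_fin_ex[of a] D by blast
  have "inj h"
  proof (rule injI)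
    fix a a' assume eq: "h a = h a'"
    obtain A B where A: "(A, B) \<in> G" "a = abs_pow_mod_fin A" using rep by blast
    obtain A' B' where A': "(A', B') \<in> G" "a' = abs_pow_mod_fin A'" using rep by blast
    show "a = a'" using eq eq_iff[OF A(1) A'(1)] h[OF A(1)] h[OF A'(1)] A(2) A'(2) by simp
  qed
  moreover have "surj h"
  proof -
    have "b \<in> range h" for b
    proof -
      obtain B where B: "b = abs_pow_mod_antichain B" using pow_mod_antichain_ex by blast
      obtain A where "(A, B) \<in> G" using R by blast
      from h[OF this] B show ?thesis by (metis rangeI)
    qed
    then show ?thesis by blast
  qed
  ultimately have "bij h" by (simp add: bij_def)
  moreover have "h (a + a') = h a + h a'" "h (a * a') = h a * h a'" for a a'
  proof -
    obtain A B where A: "(A, B) \<in> G" "a = abs_pow_mod_fin A" using rep by blast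
    obtain A' B' where A': "(A', B') \<in> G" "a' = abs_pow_mod_fin A'" using rep by blast
    show "h (a + a') = h a + h a'"
      using h[OF diff[OF A(1) A'(1)]] h[OF A(1)] h[OF A'(1)] A(2) A'(2)
      by (simp add: plus_pow_mod_fin.abs_eq plus_pow_mod_antichain.abs_eq)
    show "h (a * a') = h a * h a'"
      using h[OF int[OF A(1) A'(1)]] h[OF A(1)] h[OF A'(1)] A(2) A'(2)
      by (simp add: times_pow_mod_fin.abs_eq times_pow_mod_antichain.abs_eq)
  qed
  moreover have "h 0 = 0" using h[OF bot] by (simp add: zero_pow_mod_fin_def zero_pow_mod_antichain_def)
  moreover have "h 1 = 1" using h[OF top] by (simp add: one_pow_mod_fin_def one_pow_mod_antichain_def)
  ultimately show thesis by (rule that)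
qed

lemma UT_iso_of_ring_iso:
  fixes h :: "'a :: comm_ring_1 \<Rightarrow> 'b :: comm_ring_1"
  assumes "bij h" and add: "\<And>a b. h (a + b) = h a + h b" and mult: "\<And>a b. h (a * b) = h a * h b"
    and "h 0 = 0" "h 1 = 1"
  shows "(UT n :: 'a mat monoid) \<cong> (UT n :: 'b mat monoid)"
proof -
  interpret semiring_hom h by unfold_locales (use assms in auto)
  define k where "k = inv_into UNIV h"
  have kh: "k (h a) = a" and hk: "h (k b) = b" for a b
    using \<open>bij h\<close> unfolding k_def bij_def by (simp_all add: surj_f_inv_f)
  have k01: "k 0 = 0" "k 1 = 1" using kh[of 0] kh[of 1] assms(4,5) by simp_all
  have closed: "map_mat h A \<in> carrier (UT n)" if "A \<in> carrier (UT n)" for A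
    using that assms(4,5) by (auto simp: UT_def upper_triangular_def)
  have closed': "map_mat k A \<in> carrier (UT n)" if "A \<in> carrier (UT n)" for A
    using that k01 by (auto simp: UT_def upper_triangular_def)
  have "map_mat h \<in> hom (UT n) (UT n)"
  proof (rule homI)
    fix A B :: "'a mat" assume "A \<in> carrier (UT n)" "B \<in> carrier (UT n)"
    then show "map_mat h (A \<otimes>\<^bsub>UT n\<^esub> B) = map_mat h A \<otimes>\<^bsub>UT n\<^esub> map_mat h B"
      using mat_hom_mult[of A n n B n] by (simp add: UT_def)
  qed (rule closed)
  moreover have "bij_betw (map_mat h) (carrier (UT n)) (carrier (UT n))"
  proof (rule bij_betw_byWitness[of _ "map_mat k"])
    show "\<forall>A\<in>carrier (UT n). map_mat k (map_mat h A) = A" by (auto intro!: eq_matI simp: kh)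
    show "\<forall>A\<in>carrier (UT n). map_mat h (map_mat k A) = A" by (auto intro!: eq_matI simp: hk)
  qed (use closed closed' in blast)+
  ultimately show ?thesis by (auto simp: is_iso_def iso_def)
qed

lemma CH_U1_iso_U2: "continuum_hypothesis \<Longrightarrow> U1 n \<cong> U2 n"
  unfolding U1_def U2_def
  by (erule CH_ring_iso) (rule UT_iso_of_ring_iso)

section \<open>Commutators in unitriangular groups\<close>

text \<open>The commutator of \<open>g\<close> and \<open>h\<close> is the \<open>z\<close> with \<open>g h = z (h g)\<close>; this form needs no inverses.\<close>

definition commutators :: "('a, 'b) monoid_scheme \<Rightarrow> 'a \<Rightarrow> 'a set"
  where "commutators G g = {z \<in> carrier G. \<exists>h\<in>carrier G. g \<otimes>\<^bsub>G\<^esub> h = z \<otimes>\<^bsub>G\<^esub> (h \<otimes>\<^bsub>G\<^esub> g)}"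

definition centre :: "('a, 'b) monoid_scheme \<Rightarrow> 'a set"
  where "centre G = {z \<in> carrier G. \<forall>g\<in>carrier G. z \<otimes>\<^bsub>G\<^esub> g = g \<otimes>\<^bsub>G\<^esub> z}"

text \<open>For a group the condition on \<open>commutators G g\<close> says that \<open>g\<close>
  lies in the second centre.\<close>

definition central_commutators :: "('a, 'b) monoid_scheme \<Rightarrow> 'a set set"
  where "central_commutators G = {commutators G g | g. g \<in> carrier G \<and> commutators G g \<subseteq> centre G}"

lemma iso_props:
  assumes "h \<in> iso G H"
  shows "h ` carrier G = carrier H" "inj_on h (carrier G)"
    "\<And>x y. x \<in> carrier G \<Longrightarrow> y \<in> carrier G \<Longrightarrow> h (x \<otimes>\<^bsub>G\<^esub> y) = h x \<otimes>\<^bsub>H\<^esub> h y"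
    "\<And>x. x \<in> carrier G \<Longrightarrow> h x \<in> carrier H"
  using assms unfolding iso_def hom_def bij_betw_def by auto

lemma iso_image_commutators:
  assumes "group G" and h: "h \<in> iso G H" and g: "g \<in> carrier G"
  shows "h ` commutators G g = commutators H (h g)"
proof -
  interpret group G by fact
  note hp = iso_props[OF h]
  have eq: "g \<otimes>\<^bsub>G\<^esub> x = z \<otimes>\<^bsub>G\<^esub> (x \<otimes>\<^bsub>G\<^esub> g) \<longleftrightarrow> h g \<otimes>\<^bsub>H\<^esub> h x = h z \<otimes>\<^bsub>H\<^esub> (h x \<otimes>\<^bsub>H\<^esub> h g)"
    if "x \<in> carrier G" "z \<in> carrier G" for x z
  proof -
    have "h g \<otimes>\<^bsub>H\<^esub> h x = h (g \<otimes>\<^bsub>G\<^esub> x)" "h z \<otimes>\<^bsub>H\<^esub> (h x \<otimes>\<^bsub>H\<^esub> h g) = h (z \<otimes>\<^bsub>G\<^esub> (x \<otimes>\<^bsub>G\<^esub> g))"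
      using that g by (simp_all add: hp(3))
    then show ?thesis using inj_on_eq_iff[OF hp(2)] that g by simp
  qed
  show ?thesis
  proof (intro equalityI subsetI)
    fix w assume "w \<in> h ` commutators G g"
    then obtain z x where "w = h z" "z \<in> carrier G" "x \<in> carrier G" "g \<otimes>\<^bsub>G\<^esub> x = z \<otimes>\<^bsub>G\<^esub> (x \<otimes>\<^bsub>G\<^esub> g)"
      unfolding commutators_def by blast
    then show "w \<in> commutators H (h g)" using eq[of x z] hp(4) unfolding commutators_def by blast
  next
    fix w assume "w \<in> commutators H (h g)"
    then obtain y where w: "w \<in> carrier H" and y: "y \<in> carrier H" "h g \<otimes>\<^bsub>H\<^esub> y = w \<otimes>\<^bsub>H\<^esub> (y \<otimes>\<^bsub>H\<^esub> h g)"
      unfolding commutators_def by blast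
    obtain x where x: "x \<in> carrier G" "y = h x" using y(1) hp(1) by blast
    obtain z where z: "z \<in> carrier G" "w = h z" using w hp(1) by blast
    have "z \<in> commutators G g" using eq[OF x(1) z(1)] x z y(2) unfolding commutators_def by blast
    then show "w \<in> h ` commutators G g" using z(2) by blast
  qed
qed

lemma iso_image_centre:
  assumes "group G" and h: "h \<in> iso G H"
  shows "h ` centre G = centre H"
proof -
  interpret group G by fact
  note hp = iso_props[OF h]
  have eq: "z \<otimes>\<^bsub>G\<^esub> x = x \<otimes>\<^bsub>G\<^esub> z \<longleftrightarrow> h z \<otimes>\<^bsub>H\<^esub> h x = h x \<otimes>\<^bsub>H\<^esub> h z"
    if "x \<in> carrier G" "z \<in> carrier G" for x z
    using that inj_on_eq_iff[OF hp(2), of "z \<otimes>\<^bsub>G\<^esub> x" "x \<otimes>\<^bsub>G\<^esub> z"] by (simp add: hp(3))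
  have "h z \<in> centre H \<longleftrightarrow> z \<in> centre G" if z: "z \<in> carrier G" for z
  proof -
    have "(\<forall>g\<in>carrier H. h z \<otimes>\<^bsub>H\<^esub> g = g \<otimes>\<^bsub>H\<^esub> h z) \<longleftrightarrow> (\<forall>x\<in>carrier G. h z \<otimes>\<^bsub>H\<^esub> h x = h x \<otimes>\<^bsub>H\<^esub> h z)"
      unfolding hp(1)[symmetric] by simp
    then show ?thesis using eq z hp(4) unfolding centre_def by simp
  qed
  moreover have "centre G \<subseteq> carrier G" "centre H \<subseteq> h ` carrier G" unfolding hp(1) by (auto simp: centre_def)
  ultimately show ?thesis by blast
qed

lemma image_subset_iff_inj_on:
  assumes "inj_on f C" "A \<subseteq> C" "B \<subseteq> C"
  shows "f ` A \<subseteq> f ` B \<longleftrightarrow> A \<subseteq> B"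
proof
  assume sub: "f ` A \<subseteq> f ` B"
  show "A \<subseteq> B"
  proof
    fix a assume a: "a \<in> A"
    then obtain b where "b \<in> B" "f a = f b" using sub by blast
    then show "a \<in> B" using inj_onD[OF assms(1), of a b] a assms(2,3) by blast
  qed
qed (rule image_mono)

text \<open>The notions are expressed by multiplication alone, so an isomorphism transports them,
  and with them the order by inclusion, from which the ring multiplication is recovered.\<close>

lemma iso_central_commutators:
  assumes "group G" and h: "h \<in> iso G H"
  shows "bij_betw ((`) h) (central_commutators G) (central_commutators H)"
    and "\<And>X Y. X \<in> central_commutators G \<Longrightarrow> Y \<in> central_commutators G \<Longrightarrow> h ` X \<subseteq> h ` Y \<longleftrightarrow> X \<subseteq> Y"
proof -
  note hp = iso_props[OF h]
  have sub: "X \<subseteq> carrier G" if "X \<in> central_commutators G" for X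
    using that unfolding central_commutators_def commutators_def by blast
  show le: "h ` X \<subseteq> h ` Y \<longleftrightarrow> X \<subseteq> Y" if "X \<in> central_commutators G" "Y \<in> central_commutators G" for X Y
    using image_subset_iff_inj_on[OF hp(2) sub[OF that(1)] sub[OF that(2)]] .
  have cen: "commutators H (h g) \<subseteq> centre H \<longleftrightarrow> commutators G g \<subseteq> centre G" if g: "g \<in> carrier G" for g
  proof -
    have "commutators G g \<subseteq> carrier G" "centre G \<subseteq> carrier G" by (auto simp: commutators_def centre_def)
    from image_subset_iff_inj_on[OF hp(2) this] show ?thesis
      unfolding iso_image_commutators[OF assms g] iso_image_centre[OF assms] .
  qed
  have "(`) h ` central_commutators G = central_commutators H"
  proof (intro equalityI subsetI)
    fix X assume "X \<in> (`) h ` central_commutators G"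
    then obtain g where g: "X = h ` commutators G g" "g \<in> carrier G" "commutators G g \<subseteq> centre G"
      unfolding central_commutators_def by blast
    have "X = commutators H (h g)" using g(1) iso_image_commutators[OF assms g(2)] by simp
    then show "X \<in> central_commutators H"
      using g(3) cen[OF g(2)] hp(4)[OF g(2)] unfolding central_commutators_def by blast
  next
    fix X assume "X \<in> central_commutators H"
    then obtain y where y: "X = commutators H y" "y \<in> carrier H" "commutators H y \<subseteq> centre H"
      unfolding central_commutators_def by blast
    obtain g where g: "g \<in> carrier G" "y = h g" using y(2) hp(1) by blast
    have "commutators G g \<in> central_commutators G"
      using cen[OF g(1)] g y(3) unfolding central_commutators_def by blast
    moreover have "X = h ` commutators G g" using y(1) g(2) iso_image_commutators[OF assms g(1)] by simp
    ultimately show "X \<in> (`) h ` central_commutators G" by blast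
  qed
  moreover have "inj_on ((`) h) (central_commutators G)"
  proof (rule inj_onI)
    fix X Y assume XY: "X \<in> central_commutators G" "Y \<in> central_commutators G" "h ` X = h ` Y"
    then show "X = Y" using le[OF XY(1,2)] le[OF XY(2,1)] by simp
  qed
  ultimately show "bij_betw ((`) h) (central_commutators G) (central_commutators H)"
    by (simp add: bij_betw_def)
qed

section \<open>Matrix computations: centre and second centre\<close>

lemma UT_iff:
  "A \<in> carrier (UT n) \<longleftrightarrow> A \<in> carrier_mat n n \<and> (\<forall>i<n. \<forall>j<i. A $$ (i, j) = 0) \<and> (\<forall>i<n. A $$ (i, i) = 1)"
  by (auto simp: UT_def upper_triangular_def)

lemma UT_mult: "A \<otimes>\<^bsub>UT n\<^esub> B = A * B"
  by (simp add: UT_def)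

text \<open>Sums instead of case distinctions in the description of row \<open>i\<close> let
  \<open>p\<close> and \<open>q\<close> coincide with each other or with \<open>i\<close>; a spare
  slot gets coefficient 0.\<close>

lemma sparse_row_mult:
  fixes A B :: "'a :: comm_ring_1 mat"
  assumes "A \<in> carrier_mat n n" "B \<in> carrier_mat n n" "i < n" "j < n" "p < n" "q < n"
    and "\<And>k. k < n \<Longrightarrow> A $$ (i, k) = (if k = i then 1 else 0) + (if k = p then x else 0) + (if k = q then y else 0)"
  shows "(A * B) $$ (i, j) = B $$ (i, j) + x * B $$ (p, j) + y * B $$ (q, j)"
proof -
  have "(A * B) $$ (i, j) = (\<Sum>k = 0..<n. A $$ (i, k) * B $$ (k, j))"
    using assms(1-4) by (simp add: scalar_prod_def)
  also have "\<dots> = (\<Sum>k = 0..<n. (if k = i then B $$ (k, j) else 0) + (if k = p then x * B $$ (k, j) else 0)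
      + (if k = q then y * B $$ (k, j) else 0))"
    using assms(7) by (intro sum.cong) (auto simp: algebra_simps)
  also have "\<dots> = B $$ (i, j) + x * B $$ (p, j) + y * B $$ (q, j)"
    using assms(3-6) by (simp add: sum.distrib)
  finally show ?thesis .
qed

lemma sparse_col_mult:
  fixes A B :: "'a :: comm_ring_1 mat"
  assumes "A \<in> carrier_mat n n" "B \<in> carrier_mat n n" "i < n" "j < n" "p < n" "q < n"
    and "\<And>k. k < n \<Longrightarrow> A $$ (k, j) = (if k = j then 1 else 0) + (if k = p then x else 0) + (if k = q then y else 0)"
  shows "(B * A) $$ (i, j) = B $$ (i, j) + B $$ (i, p) * x + B $$ (i, q) * y"
proof -
  have "(B * A) $$ (i, j) = (\<Sum>k = 0..<n. B $$ (i, k) * A $$ (k, j))"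
    using assms(1-4) by (simp add: scalar_prod_def)
  also have "\<dots> = (\<Sum>k = 0..<n. (if k = j then B $$ (i, k) else 0) + (if k = p then B $$ (i, k) * x else 0)
      + (if k = q then B $$ (i, k) * y else 0))"
    using assms(7) by (intro sum.cong) (auto simp: algebra_simps)
  also have "\<dots> = B $$ (i, j) + B $$ (i, p) * x + B $$ (i, q) * y"
    using assms(3-6) by (simp add: sum.distrib)
  finally show ?thesis .
qed

definition corner :: "nat \<Rightarrow> 'a \<Rightarrow> 'a :: comm_ring_1 mat"
  where "corner n s = mat n n (\<lambda>(i, j). if i = j then 1 else if i = 0 \<and> j = n - 1 then s else 0)"

definition transvection :: "nat \<Rightarrow> nat \<Rightarrow> 'a :: comm_ring_1 mat"
  where "transvection n m = mat n n (\<lambda>(i, j). if i = j then 1 else if i = m \<and> j = Suc m then 1 else 0)"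

lemma corner_in_UT: "corner n s \<in> carrier (UT n)"
  unfolding UT_iff corner_def by auto

lemma transvection_in_UT: "transvection n m \<in> carrier (UT n)"
  unfolding UT_iff transvection_def by auto

lemma corner_inj: "2 \<le> n \<Longrightarrow> corner n s = corner n t \<Longrightarrow> s = t"
  by (drule arg_cong[of _ _ "\<lambda>A. A $$ (0, n - 1)"]) (simp add: corner_def)

text \<open>The last row and the first column of a unitriangular matrix are unit vectors, so a
  corner matrix acts in the same way from both sides. Hence it is central.\<close>

lemma corner_mult:
  assumes A: "A \<in> carrier (UT n)" and n: "2 \<le> n" and ij: "i < n" "j < n"
  shows "(corner n s * A) $$ (i, j) = A $$ (i, j) + (if i = 0 \<and> j = n - 1 then s else 0)"
    and "(A * corner n s) $$ (i, j) = A $$ (i, j) + (if i = 0 \<and> j = n - 1 then s else 0)"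
proof -
  have c: "corner n s \<in> carrier_mat n n" "A \<in> carrier_mat n n" using A by (auto simp: corner_def UT_iff)
  have last: "A $$ (n - 1, j) = (if j = n - 1 then 1 else 0)" using A ij n by (auto simp: UT_iff)
  have first: "A $$ (i, 0) = (if i = 0 then 1 else 0)" using A ij n by (auto simp: UT_iff)
  have "(corner n s * A) $$ (i, j) = A $$ (i, j) + (if i = 0 then s else 0) * A $$ (n - 1, j) + 0 * A $$ (0, j)"
    using c ij n by (intro sparse_row_mult) (auto simp: corner_def)
  then show "(corner n s * A) $$ (i, j) = A $$ (i, j) + (if i = 0 \<and> j = n - 1 then s else 0)"
    using last by simp
  have "(A * corner n s) $$ (i, j) = A $$ (i, j) + A $$ (i, 0) * (if j = n - 1 then s else 0) + A $$ (i, 0) * 0"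
    using c ij n by (intro sparse_col_mult) (auto simp: corner_def)
  then show "(A * corner n s) $$ (i, j) = A $$ (i, j) + (if i = 0 \<and> j = n - 1 then s else 0)"
    using first by simp
qed

lemma transvection_mult:
  assumes A: "A \<in> carrier (UT n)" and m: "Suc m < n" and ij: "i < n" "j < n"
  shows "(transvection n m * A) $$ (i, j) = A $$ (i, j) + (if i = m then A $$ (Suc m, j) else 0)"
    and "(A * transvection n m) $$ (i, j) = A $$ (i, j) + (if j = Suc m then A $$ (i, m) else 0)"
proof -
  have c: "transvection n m \<in> carrier_mat n n" "A \<in> carrier_mat n n" using A by (auto simp: transvection_def UT_iff)
  have "(transvection n m * A) $$ (i, j) = A $$ (i, j) + (if i = m then 1 else 0) * A $$ (Suc m, j) + 0 * A $$ (0, j)"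
    using c ij m by (intro sparse_row_mult) (auto simp: transvection_def)
  then show "(transvection n m * A) $$ (i, j) = A $$ (i, j) + (if i = m then A $$ (Suc m, j) else 0)" by simp
  have "(A * transvection n m) $$ (i, j) = A $$ (i, j) + A $$ (i, m) * (if j = Suc m then 1 else 0) + A $$ (i, 0) * 0"
    using c ij m by (intro sparse_col_mult) (auto simp: transvection_def)
  then show "(A * transvection n m) $$ (i, j) = A $$ (i, j) + (if j = Suc m then A $$ (i, m) else 0)" by simp
qed

lemma corner_in_centre: "2 \<le> n \<Longrightarrow> corner n s \<in> centre (UT n)"
  unfolding centre_def UT_mult mem_Collect_eq
proof (intro conjI ballI)
  fix A :: "'a mat" assume n: "2 \<le> n" and A: "A \<in> carrier (UT n)"
  have "A \<in> carrier_mat n n" using A by (simp add: UT_iff)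
  moreover have "(corner n s * A) $$ (i, j) = (A * corner n s) $$ (i, j)" if "i < n" "j < n" for i j
    by (simp only: corner_mult[OF A n that])
  ultimately show "corner n s * A = A * corner n s"
    by (intro eq_matI) (auto simp: corner_def)
qed (rule corner_in_UT)

text \<open>Only the relations with the transvections \<open>1 + E\<^bsub>m,m+1\<^esub>\<close> are needed here and for the second centre.\<close>

lemma centre_UT_corner:
  assumes z: "z \<in> centre (UT n)" and n: "2 \<le> n"
  shows "\<exists>s. z = corner n s"
proof -
  have zU: "z \<in> carrier (UT n)" using z by (simp add: centre_def)
  have comm: "(if b = Suc m then z $$ (a, m) else 0) = (if a = m then z $$ (Suc m, b) else 0)"
    if "Suc m < n" "a < n" "b < n" for m a b
  proof -
    have "z * transvection n m = transvection n m * z"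
      using z transvection_in_UT unfolding centre_def UT_mult by blast
    then have "(z * transvection n m) $$ (a, b) = (transvection n m * z) $$ (a, b)" by simp
    then show ?thesis unfolding transvection_mult[OF zU that] by simp
  qed
  \<comment> \<open>The transvection at a - 1 adds row a > 0 to the row above, the one at b adds
    column b < n - 1 to the next column; commuting forces the added entries to vanish.\<close>
  have zero: "z $$ (a, b) = 0" if "a < b" "b < n" "\<not> (a = 0 \<and> b = n - 1)" for a b
  proof (cases "b = n - 1")
    case True
    then have "a \<noteq> 0" using that(3) by simp
    then obtain a' where "a = Suc a'" using not0_implies_Suc by blast
    then show ?thesis using comm[of a' a' b] that by simp
  next
    case False
    then show ?thesis using comm[of b a "Suc b"] that by simp
  qed
  have "z = corner n (z $$ (0, n - 1))"
  proof (rule eq_matI)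
    fix i j assume "i < dim_row (corner n (z $$ (0, n - 1)))" "j < dim_col (corner n (z $$ (0, n - 1)))"
    then show "z $$ (i, j) = corner n (z $$ (0, n - 1)) $$ (i, j)"
      using zU zero[of i j] by (cases i j rule: linorder_cases) (auto simp: corner_def UT_iff)
  qed (use zU in \<open>auto simp: corner_def UT_iff\<close>)
  then show ?thesis ..
qed

text \<open>The general element of the second centre: off the diagonal only the corner and its two
  neighbours may be nonzero. For n = 3 this is the whole group.\<close>

definition second_corner :: "nat \<Rightarrow> 'a \<Rightarrow> 'a \<Rightarrow> 'a \<Rightarrow> 'a :: comm_ring_1 mat"
  where "second_corner n c d e = mat n n (\<lambda>(i, j). if i = j then 1 else if i = 0 \<and> j = n - 2 then c
    else if i = 1 \<and> j = n - 1 then d else if i = 0 \<and> j = n - 1 then e else 0)"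

lemma second_corner_in_UT: "3 \<le> n \<Longrightarrow> second_corner n c d e \<in> carrier (UT n)"
  unfolding UT_iff second_corner_def by auto

lemma second_corner_row:
  assumes n: "3 \<le> n" and ik: "i < n" "k < n"
  shows "second_corner n c d e $$ (i, k) = (if k = i then 1 else 0) + (if k = n - 2 then if i = 0 then c else 0 else 0)
    + (if k = n - 1 then if i = 0 then e else if i = 1 then d else 0 else 0)"
proof -
  obtain p q where pq: "p = n - 2" "q = n - 1" by blast
  then have ne: "p \<noteq> q" "p \<noteq> 0" "q \<noteq> 0" "q \<noteq> 1" using n by auto
  have "second_corner n c d e $$ (i, k) = (if i = k then 1 else if i = 0 \<and> k = n - 2 then c
    else if i = 1 \<and> k = n - 1 then d else if i = 0 \<and> k = n - 1 then e else 0)"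
    using ik by (simp add: second_corner_def)
  also have "\<dots> = (if k = i then 1 else 0) + (if k = n - 2 then if i = 0 then c else 0 else 0)
    + (if k = n - 1 then if i = 0 then e else if i = 1 then d else 0 else 0)"
    unfolding pq[symmetric] using ne by auto
  finally show ?thesis .
qed

lemma second_corner_col:
  assumes n: "3 \<le> n" and kj: "k < n" "j < n"
  shows "second_corner n c d e $$ (k, j) = (if k = j then 1 else 0)
    + (if k = 0 then if j = n - 2 then c else if j = n - 1 then e else 0 else 0)
    + (if k = 1 then if j = n - 1 then d else 0 else 0)"
proof -
  obtain p q where pq: "p = n - 2" "q = n - 1" by blast
  then have ne: "p \<noteq> q" "p \<noteq> 0" "q \<noteq> 0" "q \<noteq> 1" using n by auto
  have "second_corner n c d e $$ (k, j) = (if k = j then 1 else if k = 0 \<and> j = n - 2 then c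
    else if k = 1 \<and> j = n - 1 then d else if k = 0 \<and> j = n - 1 then e else 0)"
    using kj by (simp add: second_corner_def)
  also have "\<dots> = (if k = j then 1 else 0)
    + (if k = 0 then if j = n - 2 then c else if j = n - 1 then e else 0 else 0)
    + (if k = 1 then if j = n - 1 then d else 0 else 0)"
    unfolding pq[symmetric] using ne by auto
  finally show ?thesis .
qed

text \<open>The two products differ only in the corner: there one gains \<open>c\<close> times the
  last superdiagonal entry of \<open>h\<close>, the other \<open>d\<close> times the first, while
  both gain \<open>e\<close>.\<close>

lemma second_corner_commutator:
  assumes h: "h \<in> carrier (UT n)" and n: "3 \<le> n"
  shows "second_corner n c d e * h = corner n (c * h $$ (n - 2, n - 1) - d * h $$ (0, 1)) * (h * second_corner n c d e)"
proof -
  let ?g = "second_corner n c d e" and ?s = "c * h $$ (n - 2, n - 1) - d * h $$ (0, 1)"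
  have gU: "?g \<in> carrier (UT n)" by (rule second_corner_in_UT[OF n])
  have hg: "h * ?g \<in> carrier (UT n)" by (rule UT_mult_closed[OF h gU])
  have c: "?g \<in> carrier_mat n n" "h \<in> carrier_mat n n" using gU h by (auto simp: UT_iff)
  have up: "h $$ (i, j) = (if i = j then 1 else 0)" if "j \<le> i" "i < n" for i j
    using that h by (auto simp: UT_iff)
  have entry: "(?g * h) $$ (i, j) = (corner n ?s * (h * ?g)) $$ (i, j)" if ij: "i < n" "j < n" for i j
  proof -
    have 1: "(?g * h) $$ (i, j) = h $$ (i, j) + (if i = 0 then c else 0) * h $$ (n - 2, j)
        + (if i = 0 then e else if i = 1 then d else 0) * h $$ (n - 1, j)"
      by (rule sparse_row_mult[OF c ij _ _ second_corner_row[OF n ij(1)]]) (use n in auto)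
    have 2: "(h * ?g) $$ (i, j) = h $$ (i, j) + h $$ (i, 0) * (if j = n - 2 then c else if j = n - 1 then e else 0)
        + h $$ (i, 1) * (if j = n - 1 then d else 0)"
      by (rule sparse_col_mult[OF c ij _ _ second_corner_col[OF n _ ij(2)]]) (use n in auto)
    have 3: "(corner n ?s * (h * ?g)) $$ (i, j) = (h * ?g) $$ (i, j) + (if i = 0 \<and> j = n - 1 then ?s else 0)"
      using corner_mult(1)[OF hg _ ij] n by simp
    have r1: "h $$ (n - 1, j) = (if j = n - 1 then 1 else 0)" using up[of j "n - 1"] ij by auto
    have r2: "h $$ (n - 2, j) = (if j = n - 2 then 1 else if j = n - 1 then h $$ (n - 2, n - 1) else 0)"
    proof (cases "j = n - 1")
      case False
      then show ?thesis using up[of j "n - 2"] ij by auto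
    qed (use n in auto)
    have c0: "h $$ (i, 0) = (if i = 0 then 1 else 0)" using up[of 0 i] ij by auto
    have c1: "h $$ (i, 1) = (if i = 1 then 1 else if i = 0 then h $$ (0, 1) else 0)"
    proof (cases "i = 0")
      case False
      then show ?thesis using up[of 1 i] ij by auto
    qed auto
    obtain p q where pq: "p = n - 2" "q = n - 1" by blast
    then have ne: "p \<noteq> q" using n by simp
    obtain u v w where uv: "u = h $$ (n - 2, n - 1)" "v = h $$ (0, 1)" "w = h $$ (i, j)" by blast
    show ?thesis unfolding 1 3 2 r1 r2 c0 c1 unfolding uv[symmetric] unfolding pq[symmetric] using ne
      by (cases "j = p"; cases "j = q"; cases "i = 0"; cases "i = 1") (simp_all add: algebra_simps)
  qed
  have "corner n ?s \<in> carrier_mat n n" "h * ?g \<in> carrier_mat n n" using c by (auto simp: corner_def)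
  then have "corner n ?s * (h * ?g) \<in> carrier_mat n n" by (rule mult_carrier_mat)
  moreover have "?g * h \<in> carrier_mat n n" using c by (rule mult_carrier_mat)
  ultimately show ?thesis using entry by (intro eq_matI) (simp_all only: carrier_matD)
qed

text \<open>As n is at least 3, the first and the last superdiagonal entry of \<open>h\<close> are
  different positions and can be prescribed independently. So the commutators fill the ideal
  generated by \<open>c\<close> and \<open>d\<close>.\<close>

lemma commutators_second_corner:
  assumes n: "3 \<le> n"
  shows "commutators (UT n) (second_corner n c d e) = {corner n (c * x - d * y) | x y. True}"
proof (intro equalityI subsetI)
  let ?g = "second_corner n c d e"
  fix z assume "z \<in> commutators (UT n) ?g"
  then obtain h where z: "z \<in> carrier (UT n)" and h: "h \<in> carrier (UT n)" and eq: "?g * h = z * (h * ?g)"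
    unfolding commutators_def UT_mult by blast
  let ?s = "c * h $$ (n - 2, n - 1) - d * h $$ (0, 1)"
  have "z * (h * ?g) = corner n ?s * (h * ?g)" using second_corner_commutator[OF h n, of c d e] eq by simp
  moreover have "h * ?g \<in> carrier (UT n)" by (rule UT_mult_closed[OF h second_corner_in_UT[OF n]])
  ultimately have "z = corner n ?s"
    using group.right_cancel[OF group_UT[of n], of "h * ?g" z "corner n ?s"] z corner_in_UT[of n ?s] by (simp add: UT_mult)
  then show "z \<in> {corner n (c * x - d * y) | x y. True}" by blast
next
  let ?g = "second_corner n c d e"
  fix z assume "z \<in> {corner n (c * x - d * y) | x y. True}"
  then obtain x y where z: "z = corner n (c * x - d * y)" by blast
  define h where "h = mat n n (\<lambda>(i, j). if i = j then 1 else if i = n - 2 \<and> j = n - 1 then x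
    else if i = 0 \<and> j = 1 then y else 0)"
  have h: "h \<in> carrier (UT n)" using n by (auto simp: UT_iff h_def)
  have "h $$ (n - 2, n - 1) = x" "h $$ (0, 1) = y" using n by (auto simp: h_def)
  then have "?g * h = z * (h * ?g)" using second_corner_commutator[OF h n, of c d e] z by simp
  then show "z \<in> commutators (UT n) ?g"
    using h corner_in_UT unfolding commutators_def UT_mult z by blast
qed

text \<open>The commutators with transvections are corner matrices, so the relations used for the
  centre hold at every position except the corner; this leaves the corner and its two neighbours
  undetermined.\<close>

lemma second_centre_UT:
  assumes g: "g \<in> carrier (UT n)" and com: "commutators (UT n) g \<subseteq> centre (UT n)" and n: "3 \<le> n"
  shows "\<exists>c d e. g = second_corner n c d e"
proof -
  interpret group "UT n :: 'a mat monoid" by (rule group_UT)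
  have comm: "(if b = Suc m then g $$ (a, m) else 0) = (if a = m then g $$ (Suc m, b) else 0)"
    if m: "Suc m < n" "a < n" "b < n" and ab: "\<not> (a = 0 \<and> b = n - 1)" for m a b
  proof -
    let ?t = "transvection n m :: 'a mat"
    have t: "?t \<in> carrier (UT n)" by (rule transvection_in_UT)
    define z where "z = (g \<otimes>\<^bsub>UT n\<^esub> ?t) \<otimes>\<^bsub>UT n\<^esub> inv\<^bsub>UT n\<^esub> (?t \<otimes>\<^bsub>UT n\<^esub> g)"
    have zc: "z \<in> carrier (UT n)" using g t by (simp add: z_def)
    have gt: "g \<otimes>\<^bsub>UT n\<^esub> ?t = z \<otimes>\<^bsub>UT n\<^esub> (?t \<otimes>\<^bsub>UT n\<^esub> g)" using g t by (simp add: z_def m_assoc)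
    then have "z \<in> centre (UT n)" using com zc t unfolding commutators_def by blast
    then obtain s where s: "z = corner n s" using centre_UT_corner[of z n] n by auto
    have tg: "?t * g \<in> carrier (UT n)" by (rule UT_mult_closed[OF t g])
    have "(g * ?t) $$ (a, b) = (corner n s * (?t * g)) $$ (a, b)" using gt by (simp add: UT_mult s)
    also have "\<dots> = (?t * g) $$ (a, b)" using corner_mult(1)[OF tg _ m(2,3), of s] n ab by auto
    finally show ?thesis unfolding transvection_mult[OF g m] by simp
  qed
  have zero: "g $$ (a, b) = 0"
    if "a < b" "b < n" "\<not> (a = 0 \<and> b = n - 2)" "\<not> (a = 1 \<and> b = n - 1)" "\<not> (a = 0 \<and> b = n - 1)" for a b
  proof (cases "b = n - 1")
    case True
    then have "a \<noteq> 0" using that(5) by simp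
    then obtain a' where "a = Suc a'" using not0_implies_Suc by blast
    then show ?thesis using comm[of a' a' b] that True by auto
  next
    case False
    then have "Suc b < n" using that(2) by arith
    moreover have "\<not> (a = 0 \<and> Suc b = n - 1)" using that(3) by arith
    ultimately show ?thesis using comm[of b a "Suc b"] that(1,2) by simp
  qed
  have "g = second_corner n (g $$ (0, n - 2)) (g $$ (1, n - 1)) (g $$ (0, n - 1))" (is "g = ?r")
  proof (rule eq_matI)
    fix i j assume "i < dim_row ?r" "j < dim_col ?r"
    then show "g $$ (i, j) = ?r $$ (i, j)"
      using g zero[of i j] n by (cases i j rule: linorder_cases) (auto simp: second_corner_def UT_iff)
  qed (use g in \<open>auto simp: second_corner_def UT_iff\<close>)
  then show ?thesis by blast
qed

section \<open>Principal ideals in the corner and the Boolean order\<close>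

definition corner_ideal :: "nat \<Rightarrow> 'a \<Rightarrow> 'a :: comm_ring_1 mat set"
  where "corner_ideal n c = {corner n (r * c) | r. True}"

text \<open>In a ring of idempotents the ideal generated by \<open>c\<close> and \<open>d\<close> is
  principal, with generator \<open>c + d - c * d\<close>, the join of the Boolean algebra.\<close>

lemma central_commutators_UT:
  fixes n :: nat
  assumes n: "3 \<le> n" and idem: "\<And>a :: 'a :: comm_ring_1. a * a = a"
  shows "central_commutators (UT n :: 'a mat monoid) = range (corner_ideal n)"
proof (intro equalityI subsetI)
  fix X assume "X \<in> central_commutators (UT n :: 'a mat monoid)"
  then obtain g :: "'a mat" where g: "X = commutators (UT n) g" "g \<in> carrier (UT n)" "commutators (UT n) g \<subseteq> centre (UT n)"
    unfolding central_commutators_def by blast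
  obtain c d e where "g = second_corner n c d e" using second_centre_UT[OF g(2,3) n] by blast
  then have X: "X = {corner n (c * x - d * y) | x y. True}" using g(1) commutators_second_corner[OF n, of c d e] by simp
  define u where "u = c + d - c * d"
  have cu: "c * u = c" and du: "d * u = d"
    using idem[of c] idem[of d] unfolding u_def
    by (simp_all add: distrib_left right_diff_distrib mult.left_commute flip: mult.assoc)
  have "corner n (c * x - d * y) \<in> corner_ideal n u" for x y
  proof -
    have "(c * x - d * y) * u = (c * u) * x - (d * u) * y" by (simp add: algebra_simps)
    then have "c * x - d * y = (c * x - d * y) * u" by (simp add: cu du)
    from arg_cong[OF this, of "corner n"] show ?thesis unfolding corner_ideal_def by blast
  qed
  moreover have "corner n (r * u) \<in> X" for r
  proof -
    have "r * u = c * r - d * (c * r - r)" unfolding u_def by (simp add: algebra_simps)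
    from arg_cong[OF this, of "corner n"] show ?thesis unfolding X by blast
  qed
  ultimately have "X = corner_ideal n u" unfolding X corner_ideal_def by blast
  then show "X \<in> range (corner_ideal n)" by blast
next
  fix X :: "'a mat set" assume "X \<in> range (corner_ideal n)"
  then obtain c where X: "X = corner_ideal n c" by blast
  have "commutators (UT n) (second_corner n c 0 0) = X"
    unfolding commutators_second_corner[OF n] X corner_ideal_def by (auto simp: mult.commute)
  moreover have "X \<subseteq> centre (UT n)" unfolding X corner_ideal_def using corner_in_centre[of n] n by auto
  ultimately show "X \<in> central_commutators (UT n)"
    using second_corner_in_UT[OF n, of c 0 0] unfolding central_commutators_def by blast
qed

lemma corner_ideal_subset_iff:
  fixes c d :: "'a :: comm_ring_1"
  assumes n: "2 \<le> n" and idem: "\<And>a :: 'a. a * a = a"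
  shows "corner_ideal n c \<subseteq> corner_ideal n d \<longleftrightarrow> c * d = c"
proof
  assume "corner_ideal n c \<subseteq> corner_ideal n d"
  moreover have "corner n (1 * c) \<in> corner_ideal n c" unfolding corner_ideal_def by blast
  ultimately obtain r where "corner n (1 * c) = corner n (r * d)" unfolding corner_ideal_def by blast
  then have "c = r * d" using corner_inj[OF n] by fastforce
  then show "c * d = c" by (simp add: mult.assoc idem)
next
  assume cd: "c * d = c"
  show "corner_ideal n c \<subseteq> corner_ideal n d"
  proof
    fix z assume "z \<in> corner_ideal n c"
    then obtain r where "z = corner n (r * c)" unfolding corner_ideal_def by blast
    then have "z = corner n ((r * c) * d)" by (simp add: mult.assoc cd)
    then show "z \<in> corner_ideal n d" unfolding corner_ideal_def by blast
  qed
qed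

lemma idempotent_absorb:
  fixes x y :: "'a :: comm_ring_1"
  assumes "\<And>a :: 'a. a * a = a"
  shows "(x * y) * x = x * y" "(x * y) * y = x * y"
proof -
  have "(x * y) * x = (x * x) * y" by (simp only: mult.assoc mult.commute[of y x])
  then show "(x * y) * x = x * y" by (simp only: assms)
  show "(x * y) * y = x * y" by (simp only: mult.assoc assms)
qed

text \<open>Inclusion of corner ideals is the Boolean order, so \<open>\<theta>\<close> is an order
  isomorphism. Products are meets, which the order determines; surjectivity supplies a preimage of
  \<open>\<theta> a * \<theta> b\<close> to compare with \<open>a * b\<close>.\<close>

lemma UT_iso_multiplicative:
  assumes n: "3 \<le> n" and ia: "\<And>a :: 'a :: comm_ring_1. a * a = a" and ib: "\<And>b :: 'b :: comm_ring_1. b * b = b"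
    and iso: "(UT n :: 'a :: comm_ring_1 mat monoid) \<cong> (UT n :: 'b :: comm_ring_1 mat monoid)"
  obtains \<theta> :: "'a :: comm_ring_1 \<Rightarrow> 'b :: comm_ring_1" where "inj \<theta>" "\<And>a b. \<theta> (a * b) = \<theta> a * \<theta> b"
proof -
  obtain h where h: "h \<in> iso (UT n :: 'a mat monoid) (UT n :: 'b mat monoid)" using iso by (auto simp: is_iso_def)
  note cc = iso_central_commutators[OF group_UT h]
  have A: "corner_ideal n a \<in> central_commutators (UT n)" for a :: 'a
    unfolding central_commutators_UT[OF n ia] by (rule rangeI)
  have bij: "bij_betw ((`) h) (range (corner_ideal n)) (range (corner_ideal n))"
    using cc(1) unfolding central_commutators_UT[OF n ia] central_commutators_UT[OF n ib] .
  have n2: "2 \<le> n" using n by simp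
  have "\<exists>b. h ` corner_ideal n a = corner_ideal n b" for a
  proof -
    have "h ` corner_ideal n a \<in> range (corner_ideal n)" by (rule bij_betwE[OF bij, rule_format]) (rule rangeI)
    then show ?thesis by (elim rangeE) (rule exI)
  qed
  then have "\<exists>\<theta>. \<forall>a. h ` corner_ideal n a = corner_ideal n (\<theta> a)" by (intro choice allI)
  then obtain \<theta> where \<theta>: "\<And>a. h ` corner_ideal n a = corner_ideal n (\<theta> a)" by (elim exE) (rule that, erule spec)
  have le: "\<theta> a * \<theta> b = \<theta> a \<longleftrightarrow> a * b = a" for a b
    using cc(2)[OF A A, of a b] unfolding \<theta> corner_ideal_subset_iff[OF n2 ia] corner_ideal_subset_iff[OF n2 ib] .
  have inj: "a = b" if "\<theta> a = \<theta> b" for a b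
  proof -
    have "a * b = a" "b * a = b" using le[of a b] le[of b a] that by (simp_all add: ib)
    then show ?thesis by (simp add: mult.commute)
  qed
  have surj: "\<exists>a. \<theta> a = b" for b
  proof -
    have "corner_ideal n b \<in> (`) h ` range (corner_ideal n)" using bij_betw_imp_surj_on[OF bij] by simp
    then obtain a where "corner_ideal n b = h ` corner_ideal n a" by (elim imageE rangeE) simp
    then have "corner_ideal n b = corner_ideal n (\<theta> a)" unfolding \<theta> .
    then have "b * \<theta> a = b" "\<theta> a * b = \<theta> a"
      using corner_ideal_subset_iff[OF n2 ib, of b "\<theta> a"] corner_ideal_subset_iff[OF n2 ib, of "\<theta> a" b] by simp_all
    then have "\<theta> a = b" by (simp add: mult.commute)
    then show ?thesis ..
  qed
  have "\<theta> (a * b) = \<theta> a * \<theta> b" for a b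
  proof -
    obtain m where m: "\<theta> m = \<theta> a * \<theta> b" using surj by blast
    note ab = idempotent_absorb[OF ia, of a b]
    have "\<theta> m * \<theta> a = \<theta> m" "\<theta> m * \<theta> b = \<theta> m" unfolding m by (rule idempotent_absorb[OF ib])+
    then have "m * a = m" "m * b = m" unfolding le .
    then have "m * (a * b) = m" by (simp flip: mult.assoc)
    then have 1: "\<theta> m * \<theta> (a * b) = \<theta> m" unfolding le .
    have "\<theta> (a * b) * \<theta> a = \<theta> (a * b)" "\<theta> (a * b) * \<theta> b = \<theta> (a * b)" using ab unfolding le .
    then have "\<theta> (a * b) * \<theta> m = \<theta> (a * b)" unfolding m by (simp flip: mult.assoc)
    then show ?thesis using 1 m by (simp add: mult.commute)
  qed
  moreover have "inj \<theta>" by (rule injI) (rule inj)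
  ultimately show thesis using that[of \<theta>] by simp
qed

section \<open>Fusion\<close>

text \<open>Triangles rather than squares: the copies along two branches that first differ at p
  share exactly the nodes with i + k at most p, so agreement up to p decides agreement on all common
  nodes.\<close>

definition triangle :: "nat \<Rightarrow> (nat \<times> nat) set"
  where "triangle j = {p. fst p + snd p \<le> j}"

lemma finite_triangle: "finite (triangle j)"
proof -
  have "triangle j \<subseteq> {..j} \<times> {..j}" by (auto simp: triangle_def)
  then show ?thesis by (rule finite_subset) auto
qed

lemma triangle_mono: "i \<le> j \<Longrightarrow> triangle i \<subseteq> triangle j"
  by (auto simp: triangle_def)

definition eq_upto :: "nat \<Rightarrow> (nat \<times> nat) set \<Rightarrow> (nat \<times> nat) set \<Rightarrow> bool"
  where "eq_upto j a b \<longleftrightarrow> a \<inter> triangle j = b \<inter> triangle j"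

lemma eq_upto_refl [simp]: "eq_upto j a a" by (simp add: eq_upto_def)
lemma eq_upto_sym: "eq_upto j a b \<Longrightarrow> eq_upto j b a" by (simp add: eq_upto_def)
lemma eq_upto_trans: "eq_upto j a b \<Longrightarrow> eq_upto j b c \<Longrightarrow> eq_upto j a c" by (simp add: eq_upto_def)
lemma eq_upto_mono: "eq_upto j a b \<Longrightarrow> i \<le> j \<Longrightarrow> eq_upto i a b"
  unfolding eq_upto_def using triangle_mono[of i j] by blast

lemma eq_upto_sym_diff_cong: "eq_upto j a b \<Longrightarrow> eq_upto j (sym_diff a s) (sym_diff b s)"
  unfolding eq_upto_def by blast

text \<open>A pair \<open>(a, j)\<close> stands for the basic clopen set of all \<open>a'\<close> with \<open>eq_upto j a' a\<close>, and a
  \<open>dense_mono\<close> property is a dense open set of such conditions. Properties of pairs rather than of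
  points allow the fusion below to control at which stage a condition is decided.\<close>

definition dense_mono :: "((nat \<times> nat) set \<Rightarrow> nat \<Rightarrow> bool) \<Rightarrow> bool"
  where "dense_mono D \<longleftrightarrow>
    (\<forall>a j a' j'. D a j \<longrightarrow> eq_upto j a' a \<longrightarrow> j \<le> j' \<longrightarrow> D a' j') \<and>
    (\<forall>a j. \<exists>a' j'. eq_upto j a' a \<and> j \<le> j' \<and> D a' j')"

lemma dense_monoD1: "dense_mono D \<Longrightarrow> D a j \<Longrightarrow> eq_upto j a' a \<Longrightarrow> j \<le> j' \<Longrightarrow> D a' j'"
  unfolding dense_mono_def by blast

lemma dense_monoD2: "dense_mono D \<Longrightarrow> \<exists>a' j'. eq_upto j a' a \<and> j \<le> j' \<and> D a' j'"
  unfolding dense_mono_def by blast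

lemma dense_mono_conj:
  assumes "dense_mono D" "dense_mono E"
  shows "dense_mono (\<lambda>a j. D a j \<and> E a j)"
  unfolding dense_mono_def
proof (intro conjI allI impI)
  fix a j a' j' assume "D a j \<and> E a j" "eq_upto j a' a" "j \<le> j'"
  then show "D a' j'" "E a' j'" using dense_monoD1 assms by blast+
next
  fix a j
  obtain a1 j1 where 1: "eq_upto j a1 a" "j \<le> j1" "D a1 j1" using dense_monoD2[OF assms(1)] by blast
  obtain a2 j2 where 2: "eq_upto j1 a2 a1" "j1 \<le> j2" "E a2 j2" using dense_monoD2[OF assms(2)] by blast
  have "eq_upto j a2 a" using 1 2 eq_upto_mono eq_upto_trans by blast
  moreover have "D a2 j2" using dense_monoD1[OF assms(1)] 1 2 by blast
  ultimately show "\<exists>a' j'. eq_upto j a' a \<and> j \<le> j' \<and> D a' j' \<and> E a' j'"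
    using 1 2 by (meson le_trans)
qed

lemma dense_mono_Ball:
  assumes "finite S" "\<And>s. s \<in> S \<Longrightarrow> dense_mono (D s)"
  shows "dense_mono (\<lambda>a j. \<forall>s\<in>S. D s a j)"
  using assms
proof (induction S)
  case empty
  then show ?case by (auto simp: dense_mono_def intro: eq_upto_refl)
next
  case (insert s S)
  then have "dense_mono (\<lambda>a j. D s a j \<and> (\<forall>s\<in>S. D s a j))" by (intro dense_mono_conj) auto
  then show ?case by simp
qed

text \<open>If no point of the basic set lies in \<open>U\<close>, the condition already decides
  against \<open>U\<close>; otherwise openness gives an extension inside \<open>U\<close>.\<close>

lemma dense_mono_decide:
  "dense_mono (\<lambda>a j. (\<forall>a'. eq_upto j a' a \<longrightarrow> U a') \<or> (\<forall>a'. eq_upto j a' a \<longrightarrow> \<not> U a'))"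
  if open': "\<And>a. U a \<Longrightarrow> \<exists>j. \<forall>a'. eq_upto j a' a \<longrightarrow> U a'"
  unfolding dense_mono_def
proof (intro conjI allI impI)
  fix a j a' j'
  assume *: "(\<forall>a'. eq_upto j a' a \<longrightarrow> U a') \<or> (\<forall>a'. eq_upto j a' a \<longrightarrow> \<not> U a')" "eq_upto j a' a" "j \<le> j'"
  have "eq_upto j a'' a" if "eq_upto j' a'' a'" for a'' using that * eq_upto_mono eq_upto_trans by blast
  then show "(\<forall>a''. eq_upto j' a'' a' \<longrightarrow> U a'') \<or> (\<forall>a''. eq_upto j' a'' a' \<longrightarrow> \<not> U a'')" using * by blast
next
  fix a j
  show "\<exists>a' j'. eq_upto j a' a \<and> j \<le> j' \<and> ((\<forall>a''. eq_upto j' a'' a' \<longrightarrow> U a'') \<or> (\<forall>a''. eq_upto j' a'' a' \<longrightarrow> \<not> U a''))"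
  proof (cases "\<exists>a'. eq_upto j a' a \<and> U a'")
    case True
    then obtain a' i where a': "eq_upto j a' a" "\<forall>a''. eq_upto i a'' a' \<longrightarrow> U a''" using open' by blast
    then have "\<forall>a''. eq_upto (max i j) a'' a' \<longrightarrow> U a''" using eq_upto_mono[of "max i j"] by (meson max.cobounded1)
    then show ?thesis using a' by (meson max.cobounded2)
  next
    case False
    then show ?thesis using eq_upto_refl by blast
  qed
qed

text \<open>Toggling by a fixed \<open>s\<close> respects \<open>eq_upto\<close>, so a condition can
  be moved by \<open>s\<close>, extended into \<open>D\<close> and moved back; monotonicity of
  \<open>D\<close> keeps what was achieved for the other sets.\<close>

lemma dense_mono_all_toggles:
  assumes D: "dense_mono D" and "finite F"
  shows "\<exists>a' j'. eq_upto j a' a \<and> j \<le> j' \<and> (\<forall>s\<in>F. D (sym_diff a' s) j')"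
  using \<open>finite F\<close>
proof (induction F)
  case empty
  then show ?case using eq_upto_refl by blast
next
  case (insert s F)
  then obtain a1 j1 where 1: "eq_upto j a1 a" "j \<le> j1" "\<forall>s\<in>F. D (sym_diff a1 s) j1" by blast
  obtain b j2 where b: "eq_upto j1 b (sym_diff a1 s)" "j1 \<le> j2" "D b j2" using dense_monoD2[OF D] by blast
  define a2 where "a2 = sym_diff b s"
  have ba: "sym_diff a2 s = b" unfolding a2_def by blast
  have e: "eq_upto j1 a2 a1"
  proof -
    have "sym_diff (sym_diff a1 s) s = a1" by blast
    then show ?thesis using eq_upto_sym_diff_cong[OF b(1), of s] by (simp add: a2_def)
  qed
  have "D (sym_diff a2 s') j2" if "s' \<in> F" for s'
    using dense_monoD1[OF D _ eq_upto_sym_diff_cong[OF e] b(2)] 1 that by blast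
  moreover have "eq_upto j a2 a" using e 1 eq_upto_mono eq_upto_trans by blast
  ultimately show ?case using b ba 1 by (metis insert_iff le_trans)
qed

text \<open>The result is a perfect set of generic points indexed by \<open>Z\<close>, where
  membership of i in \<open>Z\<close> toggles one point of column i. Each stage treats all
  combinations of the finitely many earlier toggles at once, and the next point is placed outside
  the current triangle, so it cannot disturb what has been decided.\<close>

lemma fusion:
  assumes D: "\<And>i. dense_mono (D i)"
  obtains a :: "(nat \<times> nat) set" and t :: "nat \<Rightarrow> nat \<times> nat" and d :: "nat \<Rightarrow> nat"
  where "strict_mono d" "\<And>i. fst (t i) = i" "\<And>i. t i \<notin> triangle (d i)"
    "\<And>Z i. D i (sym_diff a (t ` Z)) (d i)"
proof -
  define P where "P = (\<lambda>i (a, d :: nat, T). finite T \<and> (\<forall>s\<in>Pow T. D i (sym_diff a s) d))"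
  define Q where "Q = (\<lambda>i (a, d :: nat, T) (a', d', T').
     d < d' \<and> eq_upto d a' a \<and> T' = insert (i, Suc d) T \<and> T' \<subseteq> triangle d')"
  have "\<exists>f. \<forall>n. P n (f n) \<and> Q n (f n) (f (Suc n))"
  proof (rule dependent_nat_choice)
    show "\<exists>x. P 0 x"
    proof -
      obtain a' j' where "D 0 a' j'" using dense_monoD2[OF D[of 0]] by blast
      then have "P 0 (a', j', {})" by (simp add: P_def)
      then show ?thesis by blast
    qed
  next
    fix x n assume "P n x"
    moreover obtain a d T where x: "x = (a, d, T)" by (cases x) auto
    ultimately have fT: "finite T" by (simp add: P_def)
    define T' where "T' = insert (n, Suc d) T"
    have fT': "finite T'" using fT by (simp add: T'_def)
    define e where "e = Suc d + Max (insert 0 ((\<lambda>p. fst p + snd p) ` T'))"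
    have Te: "T' \<subseteq> triangle e"
    proof
      fix p assume "p \<in> T'"
      then have "fst p + snd p \<le> Max (insert 0 ((\<lambda>p. fst p + snd p) ` T'))" using fT' by (intro Max_ge) auto
      then show "p \<in> triangle e" by (simp add: triangle_def e_def)
    qed
    obtain a' d' where "eq_upto e a' a" "e \<le> d'" "\<forall>s\<in>Pow T'. D (Suc n) (sym_diff a' s) d'"
      using dense_mono_all_toggles[OF D, of "Pow T'"] fT' by blast
    then have "P (Suc n) (a', d', T') \<and> Q n x (a', d', T')"
      using Te triangle_mono[of e d'] fT' eq_upto_mono[of e a' a d] unfolding P_def Q_def x T'_def by (auto simp: e_def)
    then show "\<exists>y. P (Suc n) y \<and> Q n x y" by blast
  qed
  then obtain f where f: "\<And>n. P n (f n)" "\<And>n. Q n (f n) (f (Suc n))" by blast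
  define aa where "aa i = fst (f i)" for i
  define d where "d i = fst (snd (f i))" for i
  define T where "T i = snd (snd (f i))" for i
  define t where "t i = (i, Suc (d i))" for i
  have fi: "f i = (aa i, d i, T i)" for i by (simp add: aa_def d_def T_def)
  have DD: "s \<subseteq> T i \<Longrightarrow> D i (sym_diff (aa i) s) (d i)" for s i
    using f(1)[of i] unfolding fi P_def by auto
  have dS: "d i < d (Suc i)" and aS: "eq_upto (d i) (aa (Suc i)) (aa i)" and TS: "T (Suc i) = insert (t i) (T i)" for i
    using f(2)[of i] unfolding fi Q_def t_def by auto
  have sm: "strict_mono d" using dS by (simp add: strict_mono_Suc_iff)
  have am: "i \<le> j \<Longrightarrow> eq_upto (d i) (aa j) (aa i)" for i j
  proof (induction j rule: dec_induct)
    case (step n)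
    then show ?case using aS[of n] eq_upto_mono[of "d n" _ _ "d i"] sm eq_upto_trans
      by (meson less_or_eq_imp_le strict_mono_less_eq)
  qed simp
  define a where "a = {p. \<exists>i. p \<in> triangle (d i) \<and> p \<in> aa i}"
  have aa: "eq_upto (d i) a (aa i)" for i
  proof -
    have "p \<in> aa i" if "p \<in> triangle (d i)" "p \<in> triangle (d k)" "p \<in> aa k" for p k
      using am[of i k] am[of k i] that unfolding eq_upto_def by (cases "i \<le> k") auto
    then show ?thesis unfolding eq_upto_def a_def by auto
  qed
  have tT: "k < i \<Longrightarrow> t k \<in> T i" for i k
  proof (induction i)
    case (Suc i)
    then show ?case using TS[of i] by (cases "k = i") auto
  qed simp
  have tn: "t j \<notin> triangle (d i)" if "i \<le> j" for i j
  proof -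
    have "d i \<le> d j" using sm that by (simp add: strict_mono_less_eq)
    then show ?thesis by (auto simp: t_def triangle_def)
  qed
  have "D i (sym_diff a (t ` Z)) (d i)" for Z i
  proof (rule dense_monoD1[OF D])
    show "D i (sym_diff (aa i) (t ` (Z \<inter> {..<i}))) (d i)" using tT by (intro DD) auto
    \<comment> \<open>In the i-th triangle only toggles with index below i are visible, and all
      their combinations were treated at stage i.\<close>
    have "t ` Z \<inter> triangle (d i) = t ` (Z \<inter> {..<i}) \<inter> triangle (d i)" using tn by (auto intro!: imageI) (metis not_le)
    then show "eq_upto (d i) (sym_diff a (t ` Z)) (sym_diff (aa i) (t ` (Z \<inter> {..<i})))"
      using aa[of i] unfolding eq_upto_def by blast
  qed simp
  then show thesis using that[of d t a] sm tn by (auto simp: t_def)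
qed

section \<open>Two generic points in one piece with the same value\<close>

lemma uncountable_nat_sets: "uncountable (UNIV :: nat set set)"
proof
  assume "countable (UNIV :: nat set set)"
  then obtain f :: "nat set \<Rightarrow> nat" where "inj f" by (auto simp: countable_def)
  then have "surj (inv_into UNIV f)" by (rule inj_imp_surj_inv)
  then show False using Cantors_theorem[of "UNIV :: nat set"] by auto
qed

lemma countable_finite_sym_diff: "countable {Z' :: nat set. finite (sym_diff Z Z')}"
proof -
  have "{Z'. finite (sym_diff Z Z')} \<subseteq> sym_diff Z ` {F. finite F}"
  proof
    fix Z' assume "Z' \<in> {Z'. finite (sym_diff Z Z')}"
    moreover have "Z' = sym_diff Z (sym_diff Z Z')" by blast
    ultimately show "Z' \<in> sym_diff Z ` {F. finite F}" by blast
  qed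
  moreover have "countable {F :: nat set. finite F}" by (rule countable_Collect_finite)
  ultimately show ?thesis by (meson countable_image countable_subset)
qed

text \<open>A class modulo finite sets is countable, and a piece number with an initial segment
  gives countably many labels, too few for the uncountable power set. Agreement below the piece
  number lets the later walk between the two points start at that column.\<close>

lemma same_piece_infinite_sym_diff:
  fixes f :: "nat set \<Rightarrow> nat"
  shows "\<exists>Z Z'. f Z = f Z' \<and> Z \<inter> {..<f Z} = Z' \<inter> {..<f Z} \<and> infinite (sym_diff Z Z')"
proof (rule ccontr)
  assume neg: "\<not> ?thesis"
  have *: "finite (sym_diff Z Z')" if "f Z = f Z'" "Z \<inter> {..<f Z} = Z' \<inter> {..<f Z}" for Z Z'
    using neg that by metis
  define C where "C m s = {Z. f Z = m \<and> Z \<inter> {..<m} = s}" for m s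
  have "countable (C m s)" for m s
  proof (cases "C m s = {}")
    case False
    then obtain Z where "Z \<in> C m s" by blast
    then have "C m s \<subseteq> {Z'. finite (sym_diff Z Z')}" using * by (auto simp: C_def)
    then show ?thesis using countable_finite_sym_diff by (rule countable_subset)
  qed simp
  moreover have "countable {F :: nat set. finite F}" by (rule countable_Collect_finite)
  ultimately have "countable (\<Union>m. \<Union>s\<in>{F. finite F}. C m s)" by (intro countable_UN) auto
  moreover have "Z \<in> (\<Union>m. \<Union>s\<in>{F. finite F}. C m s)" for Z
    by (auto simp: C_def)
  ultimately show False using uncountable_nat_sets by (metis (no_types, lifting) UNIV_eq_I)
qed

text \<open>\<open>V n m a k v\<close> reads: on the \<open>m\<close>-th piece of the \<open>n\<close>-th cover, the columns of \<open>a\<close> from \<open>n\<close> on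
  determine \<open>\<phi> a \<inter> {..<k}\<close> to be \<open>v\<close>. Nothing is assumed about the pieces themselves, so a point
  and its modifications may lie in different pieces. This is met by a perfect set of generic points
  \<open>aZ Z\<close>: uncountably many of them share a piece, and two of these are joined by single
  modifications that do not change the value.\<close>

lemma countably_piecewise_continuous_collision:
  fixes S :: "nat \<Rightarrow> nat \<Rightarrow> (nat \<times> nat) set \<Rightarrow> bool"
    and V :: "nat \<Rightarrow> nat \<Rightarrow> (nat \<times> nat) set \<Rightarrow> nat \<Rightarrow> nat set \<Rightarrow> bool"
    and \<phi> :: "(nat \<times> nat) set \<Rightarrow> nat set"
  assumes V_open: "\<And>n m a k v. V n m a k v \<Longrightarrow> \<exists>j. \<forall>a'. eq_upto j a' a \<longrightarrow> V n m a' k v"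
    and V_inv: "\<And>n m a a' k v. (\<And>p. n \<le> fst p \<Longrightarrow> p \<in> a \<longleftrightarrow> p \<in> a') \<Longrightarrow> V n m a k v \<Longrightarrow> V n m a' k v"
    and V_val: "\<And>n m a k v. S n m a \<Longrightarrow> V n m a k v \<Longrightarrow> v = \<phi> a \<inter> {..<k}"
    and V_dense: "\<And>n m k. dense_mono (\<lambda>a j. \<forall>a'. eq_upto j a' a \<longrightarrow> S n m a' \<longrightarrow> (\<exists>v. V n m a' k v))"
    and S_cover: "\<And>n a. \<exists>m. S n m a"
  shows "\<exists>a b. \<phi> a = \<phi> b \<and> infinite (fst ` sym_diff a b)"
proof -
  define U where "U n m k a \<longleftrightarrow> (\<exists>v. V n m a k v)" for n m k a
  \<comment> \<open>Not \<open>N\<close> means that values of every length occur densely near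
    \<open>a\<close>; \<open>C\<close> is a conflict between piece \<open>m\<close> for n = 0 and
    piece \<open>m'\<close> for \<open>n\<close>. Under \<open>Gd\<close> neither occurs anywhere in
    the neighbourhood, so at its generic points both pieces have values and these agree.\<close>
  define N where "N n m a \<longleftrightarrow> (\<exists>k j. \<forall>a'. eq_upto j a' a \<longrightarrow> \<not> U n m k a')" for n m a
  define C where "C n m m' a \<longleftrightarrow> (\<exists>k v v'. V 0 m a k v \<and> V n m' a k v' \<and> v \<noteq> v')" for n m m' a
  define Gd where "Gd n m m' a j \<longleftrightarrow> (\<forall>a'. eq_upto j a' a \<longrightarrow> \<not> C n m m' a' \<and> \<not> N 0 m a' \<and> \<not> N n m' a')"
    for n m m' a j
  define dec where "dec X a j \<longleftrightarrow> (\<forall>a'. eq_upto j a' a \<longrightarrow> X a') \<or> (\<forall>a'. eq_upto j a' a \<longrightarrow> \<not> X a')"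
    for X :: "(nat \<times> nat) set \<Rightarrow> bool" and a j
  define A where "A n m k a j \<longleftrightarrow> (\<forall>a'. eq_upto j a' a \<longrightarrow> S n m a' \<longrightarrow> U n m k a')" for n m k a j
  \<comment> \<open>There are infinitely many candidates \<open>m'\<close>, so the existence of a
    good one is made a single question: either one is good already or no extension makes one good.
    It can then be settled before column i is toggled.\<close>
  define B where "B n m a j \<longleftrightarrow> (\<exists>m'. Gd n m m' a j) \<or>
      (\<forall>a' j'. eq_upto j a' a \<longrightarrow> j \<le> j' \<longrightarrow> (\<forall>m'. \<not> Gd n m m' a' j'))" for n m a j

  have U_open: "\<exists>j. \<forall>a'. eq_upto j a' a \<longrightarrow> U n m k a'" if U: "U n m k a" for n m k a
  proof -
    obtain v where "V n m a k v" using U unfolding U_def by blast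
    from V_open[OF this] show ?thesis unfolding U_def by blast
  qed
  have N_open: "\<exists>j. \<forall>a'. eq_upto j a' a \<longrightarrow> N n m a'" if N: "N n m a" for n m a
  proof -
    obtain k j where j: "\<forall>a'. eq_upto j a' a \<longrightarrow> \<not> U n m k a'" using N unfolding N_def by blast
    have "N n m a'" if "eq_upto j a' a" for a'
      using j eq_upto_trans[OF _ that] unfolding N_def by blast
    then show ?thesis by blast
  qed
  have C_open: "\<exists>j. \<forall>a'. eq_upto j a' a \<longrightarrow> C n m m' a'" if C: "C n m m' a" for n m m' a
  proof -
    obtain k v v' where v: "V 0 m a k v" "V n m' a k v'" "v \<noteq> v'" using C unfolding C_def by blast
    obtain i where i: "\<forall>a'. eq_upto i a' a \<longrightarrow> V 0 m a' k v" using V_open[OF v(1)] by blast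
    obtain j where j: "\<forall>a'. eq_upto j a' a \<longrightarrow> V n m' a' k v'" using V_open[OF v(2)] by blast
    have "C n m m' a'" if "eq_upto (max i j) a' a" for a'
    proof -
      have "eq_upto i a' a" "eq_upto j a' a" using that by (auto elim: eq_upto_mono)
      then show ?thesis using i j v(3) unfolding C_def by blast
    qed
    then show ?thesis by blast
  qed
  have Gd_mono: "Gd n m m' a' j'" if "Gd n m m' a j" "eq_upto j a' a" "j \<le> j'" for n m m' a j a' j'
    using that eq_upto_mono eq_upto_trans unfolding Gd_def by blast

  have dU: "dense_mono (dec (U n m k))" for n m k
    unfolding dec_def by (rule dense_mono_decide) (rule U_open)
  have dN: "dense_mono (dec (N n m))" for n m
    unfolding dec_def by (rule dense_mono_decide) (rule N_open)
  have dC: "dense_mono (dec (C n m m'))" for n m m'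
    unfolding dec_def by (rule dense_mono_decide) (rule C_open)
  have dA: "dense_mono (A n m k)" for n m k
    using V_dense unfolding A_def U_def .
  have dB: "dense_mono (B n m)" for n m
    unfolding dense_mono_def
  proof (intro conjI allI impI)
    fix a j a' j' assume B: "B n m a j" and a': "eq_upto j a' a" "j \<le> j'"
    show "B n m a' j'"
    proof (cases "\<exists>m'. Gd n m m' a j")
      case True
      then show ?thesis using Gd_mono a' unfolding B_def by blast
    next
      case False
      have "\<not> Gd n m m' a'' j''" if "eq_upto j' a'' a'" "j' \<le> j''" for m' a'' j''
      proof -
        have "eq_upto j a'' a" using that a' eq_upto_mono eq_upto_trans by blast
        then show ?thesis using B False that a' unfolding B_def by auto
      qed
      then show ?thesis unfolding B_def by blast
    qed
  next
    fix a j
    show "\<exists>a' j'. eq_upto j a' a \<and> j \<le> j' \<and> B n m a' j'"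
    proof (cases "\<exists>a' j' m'. eq_upto j a' a \<and> j \<le> j' \<and> Gd n m m' a' j'")
      case True
      then show ?thesis unfolding B_def by blast
    next
      case False
      then have "B n m a j" unfolding B_def by blast
      then show ?thesis using eq_upto_refl by blast
    qed
  qed

  define E where "E = (\<lambda>(n, m, m', k) a j.
     (dec (U n m k) a j \<and> dec (N n m) a j) \<and> (dec (C n m m') a j \<and> A n m k a j) \<and> B n m a j)"
  have dE: "dense_mono (E s)" for s
    unfolding E_def using dU dN dC dA dB by (cases s) (simp add: dense_mono_conj)
  \<comment> \<open>\<open>Suc i\<close> admits n = i + 1 at stage i: pieces blind to column i must
    be settled within the triangle that \<open>t i\<close> avoids.\<close>
  define I where "I i = {..Suc i} \<times> {..i} \<times> {..i} \<times> {..i :: nat}" for i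
  have "dense_mono (\<lambda>a j. \<forall>s\<in>I i. E s a j)" for i
    using dE by (intro dense_mono_Ball) (auto simp: I_def)
  then obtain a t d where d: "strict_mono d" and t: "\<And>i. fst (t i) = i"
    and td: "\<And>i. t i \<notin> triangle (d i)"
    and gen: "\<And>Z i. \<forall>s\<in>I i. E s (sym_diff a (t ` Z)) (d i)"
    by (rule fusion[of "\<lambda>i a j. \<forall>s\<in>I i. E s a j"]) (rule that; assumption)
  define aZ where "aZ Z = sym_diff a (t ` Z)" for Z
  have genE: "E (n, m, m', k) (aZ Z) (d (max (max n m) (max m' k)))" for n m m' k Z
    using gen[of "max (max n m) (max m' k)" Z] by (auto simp: aZ_def I_def)
  have gB: "B (Suc i) m (aZ Z) (d i)" if "m \<le> i" for i m Z
    using gen[of i Z] that by (auto simp: aZ_def I_def E_def)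
  have gU: "\<exists>j. dec (U n m k) (aZ Z) j" and gN: "\<exists>j. dec (N n m) (aZ Z) j"
    and gC: "\<exists>j. dec (C n m m') (aZ Z) j" and gA: "\<exists>j. A n m k (aZ Z) j" for n m m' k Z
    using genE[of n m m' k Z] unfolding E_def prod.case by blast+

  have U_gen: "U n m k (aZ Z)" if "\<not> N n m (aZ Z)" for n m k Z
    using gU[of n m k Z] that unfolding dec_def N_def by auto
  \<comment> \<open>On pieces containing the point the values are correct, so \<open>m\<close> and
    \<open>m'\<close> do not conflict there; genericity spreads this to a neighbourhood.\<close>
  have Gd_gen: "\<exists>m' j. Gd n m m' (aZ Z) j" if S: "S 0 m (aZ Z)" for n m Z
  proof -
    obtain m' where S': "S n m' (aZ Z)" using S_cover by blast
    have UU: "U 0 m k (aZ Z)" "U n m' k (aZ Z)" for k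
      using gA[of 0 m k Z] gA[of n m' k Z] S S' unfolding A_def by auto
    have N': "\<not> N 0 m (aZ Z)" "\<not> N n m' (aZ Z)" using UU eq_upto_refl unfolding N_def by blast+
    have C': "\<not> C n m m' (aZ Z)" using V_val S S' unfolding C_def by blast
    have ev: "\<exists>j. \<forall>a'. eq_upto j a' (aZ Z) \<longrightarrow> \<not> X a'" if "\<exists>j. dec X (aZ Z) j" "\<not> X (aZ Z)" for X
      using that eq_upto_refl unfolding dec_def by blast
    obtain j1 where j1: "\<forall>a'. eq_upto j1 a' (aZ Z) \<longrightarrow> \<not> N 0 m a'" using ev[OF gN N'(1)] by blast
    obtain j2 where j2: "\<forall>a'. eq_upto j2 a' (aZ Z) \<longrightarrow> \<not> N n m' a'" using ev[OF gN N'(2)] by blast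
    obtain j3 where j3: "\<forall>a'. eq_upto j3 a' (aZ Z) \<longrightarrow> \<not> C n m m' a'" using ev[OF gC C'] by blast
    have "Gd n m m' (aZ Z) (max j1 (max j2 j3))"
      unfolding Gd_def
    proof (intro allI impI)
      fix a' assume "eq_upto (max j1 (max j2 j3)) a' (aZ Z)"
      then have "eq_upto j1 a' (aZ Z)" "eq_upto j2 a' (aZ Z)" "eq_upto j3 a' (aZ Z)" by (auto elim: eq_upto_mono)
      then show "\<not> C n m m' a' \<and> \<not> N 0 m a' \<and> \<not> N n m' a'" using j1 j2 j3 by blast
    qed
    then show ?thesis by blast
  qed

  define f where "f Z = (SOME m. S 0 m (aZ Z))" for Z
  have f: "S 0 (f Z) (aZ Z)" for Z unfolding f_def using S_cover by (rule someI_ex)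
  obtain Z Z' where "f Z = f Z'" and eqZ: "Z \<inter> {..<f Z} = Z' \<inter> {..<f Z}" and inf: "infinite (sym_diff Z Z')"
    using same_piece_infinite_sym_diff[of f] by blast
  define m where "m = f Z"
  have SZ: "S 0 m (aZ Z)" "S 0 m (aZ Z')" using f[of Z] f[of Z'] \<open>f Z = f Z'\<close> by (auto simp: m_def)

  \<comment> \<open>A walk from \<open>Z\<close>, which is \<open>R m\<close> because the two sets
    agree below \<open>m\<close>, towards \<open>Z'\<close>. Consecutive members differ at most in
    the number \<open>r\<close>, hence their points at most in column \<open>r\<close>.\<close>
  define R where "R r = (Z' \<inter> {..<r}) \<union> (Z \<inter> {r..})" for r
  have near: "eq_upto (d i) (aZ (R r)) (aZ Z')" if "i \<le> r" for i r
  proof -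
    have j: "j < i" if "t j \<in> triangle (d i)" for j
    proof (rule ccontr)
      assume "\<not> j < i"
      then have "d i \<le> d j" using d by (simp add: strict_mono_less_eq)
      then show False using td[of j] triangle_mono that by blast
    qed
    have "t ` R r \<inter> triangle (d i) = t ` Z' \<inter> triangle (d i)"
      using that by (fastforce simp: R_def dest: j)
    then show ?thesis unfolding eq_upto_def aZ_def by blast
  qed
  \<comment> \<open>\<open>Gd\<close> at a finer condition refutes the negative alternative of
    \<open>B\<close>, so some partner already works on the triangle of \<open>d i\<close>.\<close>
  have stage: "\<exists>m'. Gd (Suc i) m m' (aZ Z') (d i)" if "m \<le> i" for i
  proof -
    obtain m' j where "Gd (Suc i) m m' (aZ Z') j" using Gd_gen SZ by blast
    then have "Gd (Suc i) m m' (aZ Z') (max j (d i))" by (rule Gd_mono) auto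
    then show ?thesis using gB[OF that, of Z'] unfolding B_def by (meson eq_upto_refl max.cobounded2)
  qed
  have uniq: "v = w" if r: "m \<le> r" and V: "V 0 m (aZ (R r)) k v" "V 0 m (aZ (R r)) k w" for r k v w
  proof -
    obtain m' where G: "Gd (Suc r) m m' (aZ Z') (d r)" using stage r by blast
    then have "U (Suc r) m' k (aZ (R r))" using near[of r r] U_gen unfolding Gd_def by blast
    then show ?thesis using V G near[of r r] unfolding Gd_def C_def U_def by blast
  qed
  \<comment> \<open>The value passes from \<open>m\<close> to the partner \<open>m'\<close>, which
    cannot see the change in column \<open>r\<close>, and from there back to
    \<open>m\<close>.\<close>
  have V_step: "V 0 m (aZ (R (Suc r))) k v" if r: "m \<le> r" and V: "V 0 m (aZ (R r)) k v" for r k v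
  proof -
    obtain m' where G: "Gd (Suc r) m m' (aZ Z') (d r)" using stage r by blast
    have c: "eq_upto (d r) (aZ (R r)) (aZ Z')" "eq_upto (d r) (aZ (R (Suc r))) (aZ Z')" using near by auto
    have "V (Suc r) m' (aZ (R r)) k v"
      using G c(1) U_gen[of "Suc r" m' "R r" k] V unfolding Gd_def C_def U_def by blast
    then have "V (Suc r) m' (aZ (R (Suc r))) k v"
    proof (rule V_inv[rotated])
      fix p :: "nat \<times> nat" assume p: "Suc r \<le> fst p"
      have "p \<in> t ` R r \<longleftrightarrow> p \<in> t ` R (Suc r)"
      proof -
        have "insert r (R r) = insert r (R (Suc r))" by (auto simp: R_def)
        then have "insert (t r) (t ` R r) = insert (t r) (t ` R (Suc r))" by (metis image_insert)
        moreover have "p \<noteq> t r" using t[of r] p by auto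
        ultimately show ?thesis by blast
      qed
      then show "p \<in> aZ (R r) \<longleftrightarrow> p \<in> aZ (R (Suc r))" unfolding aZ_def by blast
    qed
    moreover have "U 0 m k (aZ (R (Suc r)))" using G c(2) U_gen unfolding Gd_def by blast
    ultimately show ?thesis using G c(2) unfolding Gd_def C_def U_def by blast
  qed
  have Vk: "V 0 m (aZ Y) k (\<phi> (aZ Y) \<inter> {..<k})" if Y: "S 0 m (aZ Y)" for Y k
  proof -
    obtain j where "A 0 m k (aZ Y) j" using gA[of 0 m k Y] by blast
    then obtain v where v: "V 0 m (aZ Y) k v" using Y eq_upto_refl[of j "aZ Y"] unfolding A_def U_def by blast
    then show ?thesis using V_val[OF Y v] by simp
  qed
  have "\<phi> (aZ Z) \<inter> {..<k} = \<phi> (aZ Z') \<inter> {..<k}" for k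
  proof -
    \<comment> \<open>By openness \<open>aZ (R r)\<close> has the value of \<open>aZ Z'\<close> for
      late \<open>r\<close>; the walk gives it the value of \<open>aZ Z\<close>, and values there
      are unique.\<close>
    obtain j where j: "\<forall>a'. eq_upto j a' (aZ Z') \<longrightarrow> V 0 m a' k (\<phi> (aZ Z') \<inter> {..<k})"
      using V_open[OF Vk[OF SZ(2), of k]] by blast
    define r where "r = max m j"
    have "j \<le> d r" using strict_mono_imp_increasing[OF d, of r] by (simp add: r_def)
    then have "eq_upto j (aZ (R r)) (aZ Z')" using near[of r r] by (auto elim: eq_upto_mono)
    then have "V 0 m (aZ (R r)) k (\<phi> (aZ Z') \<inter> {..<k})" using j by simp
    moreover have "V 0 m (aZ (R r')) k (\<phi> (aZ Z) \<inter> {..<k})" if "m \<le> r'" for r'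
      using that
    proof (induction r' rule: dec_induct)
      case base
      have "Z \<inter> {..<m} \<union> Z \<inter> {m..} = Z" by auto
      then have "R m = Z" using eqZ by (simp add: R_def m_def)
      then show ?case using Vk[OF SZ(1), of k] by (rule ssubst)
    next
      case (step n)
      then show ?case using V_step[of n k] by blast
    qed
    moreover have "m \<le> r" by (simp add: r_def)
    ultimately show ?thesis using uniq by blast
  qed
  then have "x \<in> \<phi> (aZ Z) \<inter> {..<Suc x} \<longleftrightarrow> x \<in> \<phi> (aZ Z') \<inter> {..<Suc x}" for x by simp
  then have "\<phi> (aZ Z) = \<phi> (aZ Z')" by auto
  moreover have "sym_diff Z Z' \<subseteq> fst ` sym_diff (aZ Z) (aZ Z')"
  proof
    fix i assume i: "i \<in> sym_diff Z Z'"
    have "t x = t y \<longleftrightarrow> x = y" for x y using t by metis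
    then have "t i \<in> sym_diff (aZ Z) (aZ Z')" using i unfolding aZ_def by auto
    then show "i \<in> fst ` sym_diff (aZ Z) (aZ Z')" using t[of i] by force
  qed
  ultimately show ?thesis using inf finite_subset by blast
qed

section \<open>Open colourings\<close>

text \<open>The axiom for any set of objects coded by subsets of the naturals, with openness
  expressed by initial segments of codes. It transfers because the inverse of the ternary coding is
  continuous on its range.\<close>

lemma open_coloring_axiom_coded:
  fixes code :: "'a \<Rightarrow> nat set" and R :: "'a \<Rightarrow> 'a \<Rightarrow> bool"
  assumes OCA: open_coloring_axiom
    and inj: "inj code"
    and irrefl: "\<And>u. \<not> R u u"
    and sym: "\<And>u v. R u v \<Longrightarrow> R v u"
    and R_open: "\<And>u v. R u v \<Longrightarrow> \<exists>N. \<forall>u' v'. code u' \<inter> {..<N} = code u \<inter> {..<N} \<longrightarrow>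
       code v' \<inter> {..<N} = code v \<inter> {..<N} \<longrightarrow> R u' v'"
  shows "(\<exists>Y. uncountable Y \<and> (\<forall>u\<in>Y. \<forall>v\<in>Y. u \<noteq> v \<longrightarrow> R u v)) \<or>
    (\<exists>H :: nat \<Rightarrow> 'a set. (\<forall>u. \<exists>m. u \<in> H m) \<and> (\<forall>m. \<forall>u\<in>H m. \<forall>v\<in>H m. \<not> R u v))"
proof -
  define E where "E u = ternary (code u)" for u
  have injE: "E u = E v \<longleftrightarrow> u = v" for u v
    by (simp add: E_def inj_eq[OF inj_ternary] inj_eq[OF inj])
  define X where "X = range E"
  define K0 where "K0 = {{E u, E v} | u v. R u v}"
  define K1 where "K1 = [X]\<^bsup>2\<^esup> - K0"
  have K0_iff: "{E u, E v} \<in> K0 \<longleftrightarrow> R u v" for u v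
  proof
    assume "{E u, E v} \<in> K0"
    then obtain u' v' where "R u' v'" "{E u, E v} = {E u', E v'}" unfolding K0_def by blast
    then show "R u v" using sym[of u' v'] by (auto simp: doubleton_eq_iff injE)
  next
    assume "R u v"
    then show "{E u, E v} \<in> K0" unfolding K0_def by blast
  qed
  have K0X: "K0 \<subseteq> [X]\<^bsup>2\<^esup>"
  proof
    fix e assume "e \<in> K0"
    then obtain u v where uv: "R u v" "e = {E u, E v}" unfolding K0_def by blast
    then have "E u \<noteq> E v" using irrefl[of u] by (auto simp: injE)
    then show "e \<in> [X]\<^bsup>2\<^esup>" using uv(2) unfolding nsets_2_eq X_def by blast
  qed
  have K: "[X]\<^bsup>2\<^esup> = K0 \<union> K1" using K0X by (auto simp: K1_def)
  have in_X: "x \<in> X" "y \<in> X" if "{x, y} \<in> K0" for x y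
  proof -
    have "{x, y} \<subseteq> X" using K0X that unfolding nsets_def by blast
    then show "x \<in> X" "y \<in> X" by auto
  qed
  have "openin (top_of_set (X \<times> X)) {(x, y). {x, y} \<in> K0}"
    unfolding openin_euclidean_subtopology_iff
  proof (intro conjI ballI)
    show "{(x, y). {x, y} \<in> K0} \<subseteq> X \<times> X"
    proof
      fix p assume "p \<in> {(x, y). {x, y} \<in> K0}"
      then obtain x y where "p = (x, y)" "{x, y} \<in> K0" by blast
      then show "p \<in> X \<times> X" using in_X[of x y] by simp
    qed
  next
    fix p assume "p \<in> {(x, y). {x, y} \<in> K0}"
    then obtain x y where xy: "p = (x, y)" "{x, y} \<in> K0" by blast
    then obtain u v where "x = E u" "y = E v" using in_X[OF xy(2)] unfolding X_def by auto
    then have p: "p = (E u, E v)" and R: "R u v" using xy K0_iff[of u v] by simp_all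
    obtain N where N: "\<And>u' v'. code u' \<inter> {..<N} = code u \<inter> {..<N} \<Longrightarrow>
       code v' \<inter> {..<N} = code v \<inter> {..<N} \<Longrightarrow> R u' v'" using R_open[OF R] by blast
    have near: "code w' \<inter> {..<N} = code w \<inter> {..<N}" if "dist (E w') (E w) < (1 / 3) ^ N / 2" for w w'
    proof (rule ccontr)
      assume "code w' \<inter> {..<N} \<noteq> code w \<inter> {..<N}"
      from ternary_diff_ge[OF this] that show False by (simp add: E_def dist_real_def)
    qed
    have "q \<in> {(x, y). {x, y} \<in> K0}" if q: "q \<in> X \<times> X" "dist q p < (1 / 3) ^ N / 2" for q
    proof -
      obtain u' v' where q': "q = (E u', E v')" using q unfolding X_def by auto
      have "dist (E u') (E u) < (1 / 3) ^ N / 2" "dist (E v') (E v) < (1 / 3) ^ N / 2"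
        using q(2) dist_fst_le[of q p] dist_snd_le[of q p] unfolding p q' by auto
      then have "R u' v'" by (intro N near)
      then show ?thesis using K0_iff[of u' v'] q' by simp
    qed
    then show "\<exists>e>0. \<forall>x'\<in>X \<times> X. dist x' p < e \<longrightarrow> x' \<in> {(x, y). {x, y} \<in> K0}"
      by (intro exI[of _ "(1 / 3) ^ N / 2"]) simp
  qed
  with K have "(\<exists>Y\<subseteq>X. uncountable Y \<and> [Y]\<^bsup>2\<^esup> \<subseteq> K0) \<or>
       (\<exists>H :: nat \<Rightarrow> real set. X = (\<Union>n. H n) \<and> (\<forall>n. [H n]\<^bsup>2\<^esup> \<subseteq> K1))"
    using OCA[unfolded open_coloring_axiom_def, THEN spec, THEN spec, THEN spec, of X K0 K1] by simp
  then show ?thesis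
  proof (elim disjE exE conjE)
    fix Y assume Y: "Y \<subseteq> X" "uncountable Y" "[Y]\<^bsup>2\<^esup> \<subseteq> K0"
    have "uncountable (E -` Y)"
    proof
      assume "countable (E -` Y)"
      then have "countable (E ` (E -` Y))" by (rule countable_image)
      moreover have "E ` (E -` Y) = Y" using Y(1) unfolding X_def by blast
      ultimately show False using Y(2) by simp
    qed
    moreover have "\<forall>u\<in>E -` Y. \<forall>v\<in>E -` Y. u \<noteq> v \<longrightarrow> R u v"
    proof (intro ballI impI)
      fix u v assume that: "u \<in> E -` Y" "v \<in> E -` Y" "u \<noteq> v"
      have "{E u, E v} \<in> [Y]\<^bsup>2\<^esup>" using that by (simp add: nsets_def injE)
      then show "R u v" using Y(3) K0_iff[of u v] by blast
    qed
    ultimately show ?thesis by blast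
  next
    fix H :: "nat \<Rightarrow> real set" assume H: "X = (\<Union>n. H n)" "\<forall>n. [H n]\<^bsup>2\<^esup> \<subseteq> K1"
    have "\<exists>m. u \<in> E -` H m" for u using H(1) unfolding X_def by blast
    moreover have "\<not> R u v" if "u \<in> E -` H m" "v \<in> E -` H m" for u v m
    proof (cases "u = v")
      case False
      then have "{E u, E v} \<in> [H m]\<^bsup>2\<^esup>" using that by (simp add: nsets_def injE)
      then have "{E u, E v} \<in> K1" using H(2) by blast
      then show ?thesis using K0_iff[of u v] unfolding K1_def by blast
    qed (simp add: irrefl)
    ultimately have "(\<forall>u. \<exists>m. u \<in> E -` H m) \<and> (\<forall>m. \<forall>u\<in>E -` H m. \<forall>v\<in>E -` H m. \<not> R u v)" by simp
    then show ?thesis by (intro disjI2 exI[of _ "\<lambda>m. E -` H m"])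
  qed
qed

lemma uncountable_pigeonhole:
  assumes "uncountable Y" "countable C" "f ` Y \<subseteq> C"
  obtains u v where "u \<in> Y" "v \<in> Y" "u \<noteq> v" "f u = f v"
proof -
  have "\<not> inj_on f Y"
    using assms countable_image_inj_on countable_subset by blast
  then show thesis using that unfolding inj_on_def by blast
qed

text \<open>\<open>agree n x y a b\<close> says that the copies of \<open>a\<close> along \<open>x\<close> and of \<open>b\<close> along \<open>y\<close> coincide on the common
  nodes, except possibly in the first \<open>n\<close> columns.\<close>

definition agree :: "nat \<Rightarrow> nat set \<Rightarrow> nat set \<Rightarrow> (nat \<times> nat) set \<Rightarrow> (nat \<times> nat) set \<Rightarrow> bool"
  where "agree n x y a b \<longleftrightarrow>
    (\<forall>i k. n \<le> i \<longrightarrow> x \<inter> {..<i + k} = y \<inter> {..<i + k} \<longrightarrow> ((i, k) \<in> a \<longleftrightarrow> (i, k) \<in> b))"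

lemma agree_sym: "agree n x y a b \<Longrightarrow> agree n y x b a"
  unfolding agree_def by metis

lemma initial_eqD: "x \<inter> {..<N} = y \<inter> {..<N} \<Longrightarrow> p \<in> sym_diff x y \<Longrightarrow> N \<le> (p :: nat)"
proof (rule ccontr)
  assume e: "x \<inter> {..<N} = y \<inter> {..<N}" and p: "p \<in> sym_diff x y"
  assume "\<not> N \<le> p"
  then have "p \<in> x \<inter> {..<N} \<longleftrightarrow> p \<in> x" "p \<in> y \<inter> {..<N} \<longleftrightarrow> p \<in> y" by simp_all
  then have "p \<in> x \<longleftrightarrow> p \<in> y" using e by blast
  then show False using p by blast
qed

lemma agree_eq_upto:
  assumes "p \<in> sym_diff x y" "eq_upto p a b"
  shows "agree n x y a b"
  unfolding agree_def
proof (intro allI impI)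
  fix i k assume "x \<inter> {..<i + k} = y \<inter> {..<i + k}"
  from initial_eqD[OF this assms(1)] have "(i, k) \<in> triangle p" by (simp add: triangle_def)
  then show "(i, k) \<in> a \<longleftrightarrow> (i, k) \<in> b" using assms(2) unfolding eq_upto_def by blast
qed

lemma agree_eq_upto_left:
  assumes "p \<in> sym_diff x y" "eq_upto p a' a" "agree n x y a b"
  shows "agree n x y a' b"
  unfolding agree_def
proof (intro allI impI)
  fix i k assume n: "n \<le> i" and e: "x \<inter> {..<i + k} = y \<inter> {..<i + k}"
  from initial_eqD[OF e assms(1)] have "(i, k) \<in> triangle p" by (simp add: triangle_def)
  then have "(i, k) \<in> a' \<longleftrightarrow> (i, k) \<in> a" using assms(2) unfolding eq_upto_def by blast
  also have "\<dots> \<longleftrightarrow> (i, k) \<in> b" using assms(3) n e unfolding agree_def by simp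
  finally show "(i, k) \<in> a' \<longleftrightarrow> (i, k) \<in> b" .
qed

lemma agree_columns_cong:
  assumes "\<And>p. n \<le> fst p \<Longrightarrow> p \<in> a \<longleftrightarrow> p \<in> a'" "agree n x y a b"
  shows "agree n x y a' b"
  unfolding agree_def
proof (intro allI impI)
  fix i k assume n: "n \<le> i" and "x \<inter> {..<i + k} = y \<inter> {..<i + k}"
  then have "(i, k) \<in> a \<longleftrightarrow> (i, k) \<in> b" using assms(2) unfolding agree_def by simp
  then show "(i, k) \<in> a' \<longleftrightarrow> (i, k) \<in> b" using assms(1)[of "(i, k)"] n by simp
qed

text \<open>Four sets, since the colouring depends on the branch, the set, \<open>G x\<close> and
  \<open>\<phi> x a\<close>; putting all of them into the code makes it open without any continuity
  of \<open>\<phi>\<close>.\<close>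

definition interleave :: "nat set \<Rightarrow> nat set \<Rightarrow> nat set \<Rightarrow> nat set \<Rightarrow> nat set"
  where "interleave a b c d = {i. i div 4 \<in> (if i mod 4 = 0 then a else if i mod 4 = 1 then b else if i mod 4 = 2 then c else d)}"

lemma interleave_iff:
  "4 * i \<in> interleave a b c d \<longleftrightarrow> i \<in> a" "4 * i + 1 \<in> interleave a b c d \<longleftrightarrow> i \<in> b"
  "4 * i + 2 \<in> interleave a b c d \<longleftrightarrow> i \<in> c" "4 * i + 3 \<in> interleave a b c d \<longleftrightarrow> i \<in> d"
proof -
  have dm: "(4 * i) div 4 = i" "(4 * i) mod 4 = 0" "(4 * i + 1) div 4 = i" "(4 * i + 1) mod 4 = 1"
    "(4 * i + 2) div 4 = i" "(4 * i + 2) mod 4 = 2" "(4 * i + 3) div 4 = i" "(4 * i + 3) mod 4 = 3" for i :: nat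
    by presburger+
  show "4 * i \<in> interleave a b c d \<longleftrightarrow> i \<in> a" "4 * i + 1 \<in> interleave a b c d \<longleftrightarrow> i \<in> b"
    "4 * i + 2 \<in> interleave a b c d \<longleftrightarrow> i \<in> c" "4 * i + 3 \<in> interleave a b c d \<longleftrightarrow> i \<in> d"
    unfolding interleave_def mem_Collect_eq dm by simp_all
qed

lemma interleave_initial:
  assumes "interleave a b c d \<inter> {..<4 * M} = interleave a' b' c' d' \<inter> {..<4 * M}" "i < M"
  shows "i \<in> a \<longleftrightarrow> i \<in> a'" "i \<in> b \<longleftrightarrow> i \<in> b'" "i \<in> c \<longleftrightarrow> i \<in> c'" "i \<in> d \<longleftrightarrow> i \<in> d'"
proof -
  have *: "j \<in> interleave a b c d \<longleftrightarrow> j \<in> interleave a' b' c' d'" if "j < 4 * M" for j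
  proof -
    have "j \<in> interleave a b c d \<inter> {..<4 * M} \<longleftrightarrow> j \<in> interleave a' b' c' d' \<inter> {..<4 * M}"
      by (simp only: assms(1))
    then show ?thesis using that by simp
  qed
  have "4 * i < 4 * M" "4 * i + 1 < 4 * M" "4 * i + 2 < 4 * M" "4 * i + 3 < 4 * M" using assms(2) by simp_all
  note this[THEN *, unfolded interleave_iff]
  then show "i \<in> a \<longleftrightarrow> i \<in> a'" "i \<in> b \<longleftrightarrow> i \<in> b'" "i \<in> c \<longleftrightarrow> i \<in> c'" "i \<in> d \<longleftrightarrow> i \<in> d'" .
qed

text \<open>\<open>R n\<close> marks pairs that fit together from column n on while their values
  clash on the common part of \<open>G x\<close> and \<open>G y\<close>. On an uncountable
  homogeneous set the glued \<open>d\<close> predicts all values up to finite errors, and two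
  members with the same finite data do not clash. So there are countably many clash-free pieces,
  whose members compute each other's values.\<close>

lemma OCA_no_gluing_reduction:
  fixes \<phi> :: "nat set \<Rightarrow> (nat \<times> nat) set \<Rightarrow> nat set" and G :: "nat set \<Rightarrow> nat set"
  assumes OCA: open_coloring_axiom
    and sub: "\<And>x a. \<phi> x a \<subseteq> G x"
    and inj: "\<And>x a b. \<phi> x a = \<phi> x b \<Longrightarrow> finite (fst ` sym_diff a b)"
    and glue: "\<And>n Y. (\<And>x a y b. (x, a) \<in> Y \<Longrightarrow> (y, b) \<in> Y \<Longrightarrow> (x, a) \<noteq> (y, b) \<Longrightarrow> x \<noteq> y \<and> agree n x y a b) \<Longrightarrow>
       \<exists>d. \<forall>(x, a)\<in>Y. finite (sym_diff (\<phi> x a) (d \<inter> G x))"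
  shows False
proof -
  define code where "code = (\<lambda>(x, a). interleave x (prod_encode ` a) (G x) (\<phi> x a))"
  define R where "R n = (\<lambda>(x, a) (y, b). x \<noteq> y \<and> agree n x y a b \<and> \<phi> x a \<inter> G y \<noteq> \<phi> y b \<inter> G x)" for n
  have code_eqD: "i \<in> x \<longleftrightarrow> i \<in> x'" "i \<in> prod_encode ` a \<longleftrightarrow> i \<in> prod_encode ` a'"
      "i \<in> G x \<longleftrightarrow> i \<in> G x'" "i \<in> \<phi> x a \<longleftrightarrow> i \<in> \<phi> x' a'"
    if "code (x, a) \<inter> {..<4 * M} = code (x', a') \<inter> {..<4 * M}" "i < M" for x a x' a' M i
    using interleave_initial[of x "prod_encode ` a" "G x" "\<phi> x a" M x' "prod_encode ` a'" "G x'" "\<phi> x' a'" i] that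
    by (simp_all add: code_def)
  have inj_code: "inj code"
  proof (rule injI)
    fix u v assume uv: "code u = code v"
    obtain x a y b where [simp]: "u = (x, a)" "v = (y, b)" by fastforce
    have "code (x, a) \<inter> {..<4 * Suc i} = code (y, b) \<inter> {..<4 * Suc i}" for i using uv by simp
    from code_eqD[OF this lessI] have "x = y" "prod_encode ` a = prod_encode ` b" by blast+
    then show "u = v" by (simp add: inj_image_eq_iff[OF inj_prod_encode])
  qed
  have R_irrefl: "\<not> R n u u" for n u by (cases u) (simp add: R_def)
  have R_sym: "R n v u" if "R n u v" for n u v
    using that agree_sym unfolding R_def by (cases u; cases v) auto
  have R_open: "\<exists>N. \<forall>u' v'. code u' \<inter> {..<N} = code u \<inter> {..<N} \<longrightarrow>
       code v' \<inter> {..<N} = code v \<inter> {..<N} \<longrightarrow> R n u' v'" if uv: "R n u v" for n u v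
  proof -
    obtain x a y b where u: "u = (x, a)" and v: "v = (y, b)" by fastforce
    have R: "x \<noteq> y" "agree n x y a b" "\<phi> x a \<inter> G y \<noteq> \<phi> y b \<inter> G x" using uv by (auto simp: R_def u v)
    obtain p where p: "p \<in> sym_diff x y" using R(1) by blast
    obtain q where q: "q \<in> sym_diff (\<phi> x a \<inter> G y) (\<phi> y b \<inter> G x)" using R(3) by blast
    \<comment> \<open>\<open>p\<close> witnesses different branches, \<open>q\<close> different
      values, and the triangle contains the indices of all common nodes; the code below
      \<open>4 * M\<close> shows each of the four sets below \<open>M\<close>.\<close>
    define M where "M = Suc (Max (insert p (insert q (prod_encode ` triangle p))))"
    have M: "i < M" if "i \<in> insert p (insert q (prod_encode ` triangle p))" for i
      using that finite_triangle[of p] unfolding M_def less_Suc_eq_le by (intro Max_ge) auto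
    have "R n u' v'" if u': "code u' \<inter> {..<4 * M} = code u \<inter> {..<4 * M}"
      and v': "code v' \<inter> {..<4 * M} = code v \<inter> {..<4 * M}" for u' v'
    proof -
      obtain x' a' y' b' where e: "u' = (x', a')" "v' = (y', b')" by fastforce
      note x' = code_eqD[OF u'[unfolded u e(1)]]
      note y' = code_eqD[OF v'[unfolded v e(2)]]
      have p': "p \<in> sym_diff x' y'" using p x'(1)[OF M, of p] y'(1)[OF M, of p] by simp
      have q': "q \<in> sym_diff (\<phi> x' a' \<inter> G y') (\<phi> y' b' \<inter> G x')"
        using q x'(3,4)[OF M, of q] y'(3,4)[OF M, of q] by simp
      have "(i, k) \<in> a' \<longleftrightarrow> (i, k) \<in> b'" if ni: "n \<le> i" and ik: "x' \<inter> {..<i + k} = y' \<inter> {..<i + k}" for i k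
      proof -
        have le: "i + k \<le> p" using ik p' by (rule initial_eqD)
        then have M': "prod_encode (i, k) < M" by (intro M) (simp add: triangle_def)
        have lt: "j < M" if "j < i + k" for j using that le M[of p] by simp
        have "x \<inter> {..<i + k} = x' \<inter> {..<i + k}" "y \<inter> {..<i + k} = y' \<inter> {..<i + k}"
          using x'(1)[OF lt] y'(1)[OF lt] by auto
        then have "(i, k) \<in> a \<longleftrightarrow> (i, k) \<in> b" using R(2) ni ik unfolding agree_def by simp
        moreover have "(i, k) \<in> a' \<longleftrightarrow> (i, k) \<in> a" "(i, k) \<in> b' \<longleftrightarrow> (i, k) \<in> b"
          using x'(2)[OF M'] y'(2)[OF M'] by (simp_all add: inj_image_mem_iff[OF inj_prod_encode])
        ultimately show ?thesis by simp
      qed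
      then have "agree n x' y' a' b'" unfolding agree_def by blast
      moreover have "x' \<noteq> y'" "\<phi> x' a' \<inter> G y' \<noteq> \<phi> y' b' \<inter> G x'" using p' q' by auto
      ultimately show ?thesis by (simp add: R_def e)
    qed
    then show ?thesis by blast
  qed

  have no_uncountable: False if Y: "uncountable Y" "\<forall>u\<in>Y. \<forall>v\<in>Y. u \<noteq> v \<longrightarrow> R n u v" for n Y
  proof -
    have "x \<noteq> y \<and> agree n x y a b" if "(x, a) \<in> Y" "(y, b) \<in> Y" "(x, a) \<noteq> (y, b)" for x a y b
    proof -
      have "R n (x, a) (y, b)" using Y(2) that by blast
      then show ?thesis by (simp add: R_def)
    qed
    from glue[of Y n, OF this]
    obtain D where D: "\<forall>(x, a)\<in>Y. finite (sym_diff (\<phi> x a) (D \<inter> G x))" by blast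
    have "\<exists>e. \<forall>i\<in>sym_diff (\<phi> x a) (D \<inter> G x). i < e" if "(x, a) \<in> Y" for x a
      using D that finite_nat_set_iff_bounded[of "sym_diff (\<phi> x a) (D \<inter> G x)"] by blast
    then have "\<forall>u\<in>Y. \<exists>e. \<forall>i\<in>sym_diff (\<phi> (fst u) (snd u)) (D \<inter> G (fst u)). i < e" by auto
    then obtain e where e: "\<forall>u\<in>Y. \<forall>i\<in>sym_diff (\<phi> (fst u) (snd u)) (D \<inter> G (fst u)). i < e u"
      by (rule bchoice[THEN exE])
    \<comment> \<open>Below the error bound the value and \<open>G\<close> are recorded; above it
      the values are read off from \<open>D\<close>.\<close>
    define f where "f u = (e u, \<phi> (fst u) (snd u) \<inter> {..<e u}, G (fst u) \<inter> {..<e u})" for u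
    have "countable (UNIV \<times> {F :: nat set. finite F} \<times> {F :: nat set. finite F} :: (nat \<times> nat set \<times> nat set) set)"
      by (intro countable_SIGMA countable_Collect_finite) auto
    moreover have "f ` Y \<subseteq> UNIV \<times> {F. finite F} \<times> {F. finite F}" by (auto simp: f_def)
    ultimately obtain u v where uv: "u \<in> Y" "v \<in> Y" "u \<noteq> v" "f u = f v"
      using uncountable_pigeonhole[OF Y(1)] by metis
    obtain x a y b where xy: "u = (x, a)" "v = (y, b)" by fastforce
    define k where "k = e u"
    have fu: "f u = (k, \<phi> x a \<inter> {..<k}, G x \<inter> {..<k})" by (simp only: f_def k_def xy fst_conv snd_conv)
    have fv: "f v = (e v, \<phi> y b \<inter> {..<e v}, G y \<inter> {..<e v})" by (simp only: f_def xy fst_conv snd_conv)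
    have "k = e v \<and> \<phi> x a \<inter> {..<k} = \<phi> y b \<inter> {..<e v} \<and> G x \<inter> {..<k} = G y \<inter> {..<e v}"
      using uv(4) unfolding fu fv prod.inject .
    then have ev: "k = e v" and tr': "\<phi> x a \<inter> {..<k} = \<phi> y b \<inter> {..<e v}" "G x \<inter> {..<k} = G y \<inter> {..<e v}"
      by blast+
    note tr = tr'[folded ev]
    have eu: "\<forall>i\<in>sym_diff (\<phi> x a) (D \<inter> G x). i < k"
      using bspec[OF e uv(1)] unfolding k_def xy fst_conv snd_conv .
    have ev': "\<forall>i\<in>sym_diff (\<phi> y b) (D \<inter> G y). i < k"
      using bspec[OF e uv(2)] unfolding ev unfolding xy fst_conv snd_conv .
    have "i \<in> \<phi> x a \<inter> G y \<longleftrightarrow> i \<in> \<phi> y b \<inter> G x" for i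
    proof (cases "i < k")
      case True
      have "i \<in> \<phi> x a \<inter> {..<k} \<longleftrightarrow> i \<in> \<phi> y b \<inter> {..<k}" "i \<in> G x \<inter> {..<k} \<longleftrightarrow> i \<in> G y \<inter> {..<k}"
        by (simp_all only: tr)
      then have "i \<in> \<phi> x a \<longleftrightarrow> i \<in> \<phi> y b" "i \<in> G x \<longleftrightarrow> i \<in> G y" using True by simp_all
      then show ?thesis using sub[of x a] sub[of y b] by blast
    next
      case False
      then have "i \<notin> sym_diff (\<phi> x a) (D \<inter> G x)" "i \<notin> sym_diff (\<phi> y b) (D \<inter> G y)" using eu ev' by auto
      then show ?thesis by auto
    qed
    then have "\<phi> x a \<inter> G y = \<phi> y b \<inter> G x" by (rule Set.set_eqI)
    moreover have "R n (x, a) (y, b)" using Y(2) uv by (auto simp: xy)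
    ultimately show False by (simp add: R_def)
  qed
  have "\<exists>H. (\<forall>u. \<exists>m :: nat. u \<in> H m) \<and> (\<forall>m. \<forall>u\<in>H m. \<forall>v\<in>H m. \<not> R n u v)" for n
  proof -
    have "(\<exists>Y. uncountable Y \<and> (\<forall>u\<in>Y. \<forall>v\<in>Y. u \<noteq> v \<longrightarrow> R n u v)) \<or>
       (\<exists>H :: nat \<Rightarrow> _ set. (\<forall>u. \<exists>m. u \<in> H m) \<and> (\<forall>m. \<forall>u\<in>H m. \<forall>v\<in>H m. \<not> R n u v))"
      by (rule open_coloring_axiom_coded[OF OCA inj_code, of "R n"]) (fact R_irrefl R_sym R_open)+
    then show ?thesis using no_uncountable[of _ n] by blast
  qed
  then have "\<forall>n. \<exists>H. (\<forall>u. \<exists>m :: nat. u \<in> H m) \<and> (\<forall>m. \<forall>u\<in>H m. \<forall>v\<in>H m. \<not> R n u v)" by simp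
  then obtain H where H: "\<forall>n. (\<forall>u. \<exists>m :: nat. u \<in> H n m) \<and> (\<forall>m. \<forall>u\<in>H n m. \<forall>v\<in>H n m. \<not> R n u v)"
    by (rule choice[THEN exE])
  have H_cover: "\<exists>m. u \<in> H n m" for n u using H by blast
  have H_homog: "\<phi> x a \<inter> G y = \<phi> y b \<inter> G x"
    if "(x, a) \<in> H n m" "(y, b) \<in> H n m" "x \<noteq> y" "agree n x y a b" for x a y b n m
  proof -
    have "\<not> R n (x, a) (y, b)" using H that by blast
    then show ?thesis using that by (simp add: R_def)
  qed

  \<comment> \<open>The value at \<open>a\<close> is read off from another member of the piece. As
    \<open>y \<noteq> x\<close>, only finitely many nodes are common, which makes \<open>V\<close>
    open in \<open>a\<close>; equality of \<open>G\<close> below \<open>k\<close> lets the common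
    part give the whole value below \<open>k\<close>.\<close>
  define V where "V x n m a k v \<longleftrightarrow> (\<exists>y b. (y, b) \<in> H n m \<and> y \<noteq> x \<and> agree n x y a b \<and>
      G y \<inter> {..<k} = G x \<inter> {..<k} \<and> v = \<phi> y b \<inter> G x \<inter> {..<k})" for x n m a k v
  define Q where "Q x n m k a \<longleftrightarrow> (x, a) \<in> H n m \<and> \<not> (\<exists>v. V x n m a k v)" for x n m k a
  \<comment> \<open>Here a finite set is a limit of members of a piece that have no partner. Finite
    sets are dense and leave countably many labels, so among uncountably many bad branches two would
    share a label and provide partners for each other.\<close>
  define bad where "bad = {x. \<exists>n m k a. finite a \<and> (\<forall>j. \<exists>a'. eq_upto j a' a \<and> Q x n m k a')}"
  have bad: "x \<in> bad" if "finite a" "\<forall>j. \<exists>a'. eq_upto j a' a \<and> Q x n m k a'" for x n m k a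
    using that unfolding bad_def by blast
  have "countable bad"
  proof (rule ccontr)
    assume unc: "uncountable bad"
    have "\<forall>x\<in>bad. \<exists>z. case z of (n, m, k, a) \<Rightarrow> finite a \<and> (\<forall>j. \<exists>a'. eq_upto j a' a \<and> Q x n m k a')"
      by (auto simp: bad_def)
    then obtain z where z: "\<forall>x\<in>bad. case z x of (n, m, k, a) \<Rightarrow> finite a \<and> (\<forall>j. \<exists>a'. eq_upto j a' a \<and> Q x n m k a')"
      by (rule bchoice[THEN exE])
    define f where "f x = (z x, G x \<inter> {..<fst (snd (snd (z x)))})" for x
    let ?C = "(UNIV \<times> UNIV \<times> UNIV \<times> {F. finite F}) \<times> {F. finite F} ::
      ((nat \<times> nat \<times> nat \<times> (nat \<times> nat) set) \<times> nat set) set"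
    have "countable ?C" by (intro countable_SIGMA countable_Collect_finite) auto
    moreover have "f ` bad \<subseteq> ?C" using z by (auto simp: f_def)
    ultimately obtain x y where xy: "x \<in> bad" "y \<in> bad" "x \<noteq> y" "f x = f y"
      using uncountable_pigeonhole[OF unc] by metis
    obtain n m k a0 where zx: "z x = (n, m, k, a0)" by (cases "z x") auto
    have fx: "f x = ((n, m, k, a0), G x \<inter> {..<k})" by (simp only: f_def zx fst_conv snd_conv)
    have "(z y, G y \<inter> {..<fst (snd (snd (z y)))}) = ((n, m, k, a0), G x \<inter> {..<k})"
      using xy(4) unfolding fx f_def[of y] by (rule sym)
    then have zy: "z y = (n, m, k, a0)" and "G y \<inter> {..<fst (snd (snd (z y)))} = G x \<inter> {..<k}"
      unfolding prod.inject by blast+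
    then have Gk: "G y \<inter> {..<k} = G x \<inter> {..<k}" by (simp only: zy fst_conv snd_conv)
    obtain p where p: "p \<in> sym_diff x y" using xy(3) by blast
    obtain a where a: "eq_upto p a a0" "Q x n m k a" using bspec[OF z xy(1)] unfolding zx prod.case by blast
    obtain b where b: "eq_upto p b a0" "Q y n m k b" using bspec[OF z xy(2)] unfolding zy prod.case by blast
    have "agree n x y a b" by (rule agree_eq_upto[OF p eq_upto_trans[OF a(1) eq_upto_sym[OF b(1)]]])
    moreover have "(y, b) \<in> H n m" using b(2) unfolding Q_def by blast
    ultimately have "V x n m a k (\<phi> y b \<inter> G x \<inter> {..<k})" using xy(3) Gk unfolding V_def by blast
    then show False using a(2) unfolding Q_def by blast
  qed
  then obtain x where x: "x \<notin> bad" using uncountable_nat_sets by (metis UNIV_I countable_subset subsetI)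
  have "\<exists>a b. \<phi> x a = \<phi> x b \<and> infinite (fst ` sym_diff a b)"
  proof (rule countably_piecewise_continuous_collision[of "V x" "\<lambda>n m a. (x, a) \<in> H n m"])
    fix n m a k v assume "V x n m a k v"
    then obtain y b where yb: "(y, b) \<in> H n m" "y \<noteq> x" "agree n x y a b"
      "G y \<inter> {..<k} = G x \<inter> {..<k}" "v = \<phi> y b \<inter> G x \<inter> {..<k}" unfolding V_def by blast
    obtain p where p: "p \<in> sym_diff x y" using yb(2) by blast
    have "V x n m a' k v" if "eq_upto p a' a" for a'
      using agree_eq_upto_left[OF p that yb(3)] yb unfolding V_def by blast
    then show "\<exists>j. \<forall>a'. eq_upto j a' a \<longrightarrow> V x n m a' k v" by blast
  next
    fix n m a a' k v assume aa': "\<And>p. n \<le> fst p \<Longrightarrow> p \<in> a \<longleftrightarrow> p \<in> a'" and V: "V x n m a k v"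
    have "agree n x y a' b" if "agree n x y a b" for y b by (rule agree_columns_cong[OF aa' that])
    then show "V x n m a' k v" using V unfolding V_def by blast
  next
    fix n m a k v assume a: "(x, a) \<in> H n m" and "V x n m a k v"
    then obtain y b where yb: "(y, b) \<in> H n m" "y \<noteq> x" "agree n x y a b"
      "G y \<inter> {..<k} = G x \<inter> {..<k}" "v = \<phi> y b \<inter> G x \<inter> {..<k}" unfolding V_def by blast
    have "\<phi> x a \<inter> G y = \<phi> y b \<inter> G x" using H_homog[OF a yb(1)] yb by blast
    then have "v = \<phi> x a \<inter> (G y \<inter> {..<k})" using yb(5) by auto
    also have "\<dots> = \<phi> x a \<inter> {..<k}" using sub[of x a] unfolding yb(4) by blast
    finally show "v = \<phi> x a \<inter> {..<k}" .
  next
    fix n m k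
    show "dense_mono (\<lambda>a j. \<forall>a'. eq_upto j a' a \<longrightarrow> (x, a') \<in> H n m \<longrightarrow> (\<exists>v. V x n m a' k v))"
      unfolding dense_mono_def
    proof (intro conjI allI impI)
      fix a j a' j' a''
      assume V: "\<forall>a'. eq_upto j a' a \<longrightarrow> (x, a') \<in> H n m \<longrightarrow> (\<exists>v. V x n m a' k v)"
        and e: "eq_upto j a' a" "j \<le> j'" "eq_upto j' a'' a'" and a'': "(x, a'') \<in> H n m"
      have "eq_upto j a'' a" using eq_upto_trans[OF eq_upto_mono[OF e(3,2)] e(1)] .
      then show "\<exists>v. V x n m a'' k v" using V a'' by simp
    next
      fix a j
      have "finite (a \<inter> triangle j)" using finite_triangle by simp
      then have "\<not> (\<forall>i. \<exists>a'. eq_upto i a' (a \<inter> triangle j) \<and> Q x n m k a')" using x bad by blast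
      then obtain i where i: "\<And>a'. eq_upto i a' (a \<inter> triangle j) \<Longrightarrow> \<not> Q x n m k a'" by blast
      have "eq_upto j (a \<inter> triangle j) a" unfolding eq_upto_def by blast
      moreover have "\<exists>v. V x n m a' k v" if "eq_upto (max i j) a' (a \<inter> triangle j)" "(x, a') \<in> H n m" for a'
        using i[OF eq_upto_mono[OF that(1)]] that(2) unfolding Q_def by simp
      ultimately show "\<exists>a' j'. eq_upto j a' a \<and> j \<le> j' \<and>
         (\<forall>a''. eq_upto j' a'' a' \<longrightarrow> (x, a'') \<in> H n m \<longrightarrow> (\<exists>v. V x n m a'' k v))"
        by (meson max.cobounded2)
    qed
  qed (rule H_cover)
  then show False using inj by blast
qed

section \<open>No multiplicative injection under OCA\<close>

text \<open>The \<open>i\<close>-th column is the copy of the branch \<open>x\<close> above \<open>l\<^sup>i r\<close>, without its first \<open>i\<close> nodes; the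
  truncation makes the copies of different branches almost disjoint.\<close>

definition node :: "nat set \<Rightarrow> nat \<Rightarrow> nat \<Rightarrow> binary_tree"
  where "node x i k = replicate i Lt @ Rt # map (\<lambda>j. if j \<in> x then Lt else Rt) [0..<i + k]"

definition column :: "binary_tree \<Rightarrow> nat"
  where "column w = length (takeWhile (\<lambda>c. c = Lt) w)"

lemma column_node [simp]: "column (node x i k) = i"
  by (simp add: column_def node_def takeWhile_append)

lemma node_eq_iff: "node x i k = node y i' k' \<longleftrightarrow> i = i' \<and> k = k' \<and> x \<inter> {..<i + k} = y \<inter> {..<i + k}"
proof
  assume eq: "node x i k = node y i' k'"
  from arg_cong[OF eq, of column] have i: "i = i'" by simp
  from arg_cong[OF eq, of length] have k: "k = k'" using i by (simp add: node_def)
  have "map (\<lambda>j. if j \<in> x then Lt else Rt) [0..<i + k] = map (\<lambda>j. if j \<in> y then Lt else Rt) [0..<i + k]"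
    using eq i k by (simp add: node_def)
  then have "(if j \<in> x then Lt else Rt) = (if j \<in> y then Lt else Rt)" if "j < i + k" for j
    using that unfolding map_eq_conv by simp
  then have "j \<in> x \<longleftrightarrow> j \<in> y" if "j < i + k" for j using that by (metis letter.distinct(1))
  then show "i = i' \<and> k = k' \<and> x \<inter> {..<i + k} = y \<inter> {..<i + k}" using i k by auto
next
  assume *: "i = i' \<and> k = k' \<and> x \<inter> {..<i + k} = y \<inter> {..<i + k}"
  have "j \<in> x \<longleftrightarrow> j \<in> y" if "j < i + k" for j
  proof -
    have "x \<inter> {..<i + k} = y \<inter> {..<i + k}" using * by blast
    then have "j \<in> x \<inter> {..<i + k} \<longleftrightarrow> j \<in> y \<inter> {..<i + k}" by blast
    then show ?thesis using that by simp
  qed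
  then have "map (\<lambda>j. if j \<in> x then Lt else Rt) [0..<i + k] = map (\<lambda>j. if j \<in> y then Lt else Rt) [0..<i + k]"
    unfolding map_eq_conv by simp
  then show "node x i k = node y i' k'" using * by (simp add: node_def)
qed

lemma column_prefix_node:
  assumes "prefix (node x i k) w"
  shows "column w = i"
proof -
  obtain z where "w = node x i k @ z" using assms by (auto simp: prefix_def)
  then show ?thesis by (simp add: column_def node_def takeWhile_append)
qed

lemma node_parallel: "i \<noteq> i' \<Longrightarrow> node x i k \<parallel> node y i' k'"
  unfolding parallel_def using column_prefix_node[of x i k "node y i' k'"] column_prefix_node[of y i' k' "node x i k"] by auto

lemma node_chain: "k \<le> k' \<Longrightarrow> prefix (node x i k) (node x i k')"
proof -
  assume "k \<le> k'"
  then have "[0..<i + k'] = [0..<i + k] @ [i + k..<i + k']" using upt_add_eq_append[of 0 "i + k" "k' - k"] by simp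
  then show ?thesis by (simp add: node_def)
qed

definition copy :: "nat set \<Rightarrow> (nat \<times> nat) set \<Rightarrow> binary_tree set"
  where "copy x a = (\<lambda>(i, k). node x i k) ` a"

lemma copy_iff [simp]: "node x i k \<in> copy x a \<longleftrightarrow> (i, k) \<in> a"
  unfolding copy_def by (auto simp: node_eq_iff)

text \<open>Each column of the copy is a chain and nodes of different columns are incomparable, so
  an antichain is a choice of at most one node per column.\<close>

lemma copy_in_no_inf_antichain_iff: "copy x a \<in> no_inf_antichain \<longleftrightarrow> finite (fst ` a)"
proof
  assume fin: "finite (fst ` a)"
  have "finite S" if S: "S \<subseteq> copy x a" "antichain S" for S
  proof (rule finite_imageD)
    have "column ` S \<subseteq> fst ` a" using S(1) unfolding copy_def by force
    then show "finite (column ` S)" using fin by (rule finite_subset)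
    show "inj_on column S"
    proof (rule inj_onI)
      fix w w' assume w: "w \<in> S" "w' \<in> S" "column w = column w'"
      obtain i k where ik: "w = node x i k" using w(1) S(1) unfolding copy_def by auto
      obtain i' k' where ik': "w' = node x i' k'" using w(2) S(1) unfolding copy_def by auto
      have "i' = i" using w(3) unfolding ik ik' by simp
      then have "\<not> w \<parallel> w'" using node_chain[of k k' x i] node_chain[of k' k x i] unfolding ik ik' parallel_def by (cases "k \<le> k'") auto
      then show "w = w'" using S(2) w(1,2) unfolding antichain_def pairwise_def by blast
    qed
  qed
  then show "copy x a \<in> no_inf_antichain" unfolding no_inf_antichain_def by blast
next
  assume A: "copy x a \<in> no_inf_antichain"
  show "finite (fst ` a)"
  proof (rule ccontr)
    assume inf: "infinite (fst ` a)"
    define k where "k i = (SOME k. (i, k) \<in> a)" for i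
    have k: "(i, k i) \<in> a" if "i \<in> fst ` a" for i
    proof -
      have "\<exists>k. (i, k) \<in> a" using that by force
      then show ?thesis unfolding k_def by (rule someI_ex)
    qed
    define S where "S = (\<lambda>i. node x i (k i)) ` fst ` a"
    have "S \<subseteq> copy x a" unfolding S_def by (rule image_subsetI) (simp only: copy_iff k)
    moreover have "antichain S"
      unfolding antichain_def S_def
    proof (rule pairwiseI)
      fix u v assume "u \<in> (\<lambda>i. node x i (k i)) ` fst ` a" "v \<in> (\<lambda>i. node x i (k i)) ` fst ` a" and ne: "u \<noteq> v"
      then obtain i j where u: "u = node x i (k i)" and v: "v = node x j (k j)" by auto
      have "i \<noteq> j" using ne unfolding u v by auto
      then show "u \<parallel> v" unfolding u v by (rule node_parallel)
    qed
    moreover have "infinite S"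
    proof
      assume "finite S"
      then have "finite (column ` S)" by simp
      moreover have "column ` S = fst ` a" unfolding S_def image_image by simp
      ultimately show False using inf by simp
    qed
    ultimately show False using A unfolding no_inf_antichain_def by blast
  qed
qed

lemma copy_sym_diff: "sym_diff (copy x a) (copy x b) = copy x (sym_diff a b)"
  unfolding copy_def by (auto simp: node_eq_iff)

lemma pow_mod_fin_idem: "(a :: pow_mod_fin) * a = a"
proof -
  obtain A where "a = abs_pow_mod_fin A" using pow_mod_fin_ex by blast
  then show ?thesis by (simp add: times_pow_mod_fin.abs_eq)
qed

lemma pow_mod_antichain_idem: "(a :: pow_mod_antichain) * a = a"
proof -
  obtain A where "a = abs_pow_mod_antichain A" using pow_mod_antichain_ex by blast
  then show ?thesis by (simp add: times_pow_mod_antichain.abs_eq)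
qed

text \<open>A lifting \<open>\<Phi>\<close> by representatives need not respect inclusions; cutting
  with \<open>G x\<close> repairs this at the price of a finite change. Multiplicativity turns
  \<open>D \<inter> copy x UNIV\<close>, which recovers \<open>a\<close> up to finitely many
  columns, into \<open>\<Phi> D \<inter> G x\<close>, so one set predicts all
  \<open>\<phi> x a\<close>.\<close>

lemma OCA_no_multiplicative_injection:
  fixes \<theta> :: "pow_mod_antichain \<Rightarrow> pow_mod_fin"
  assumes OCA: open_coloring_axiom and inj: "inj \<theta>" and mult: "\<And>a b. \<theta> (a * b) = \<theta> a * \<theta> b"
  shows False
proof -
  define \<Phi> where "\<Phi> A = rep_pow_mod_fin (\<theta> (abs_pow_mod_antichain A))" for A
  have abs_\<Phi>: "abs_pow_mod_fin (\<Phi> A) = \<theta> (abs_pow_mod_antichain A)" for A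
    unfolding \<Phi>_def by (rule Quotient_abs_rep[OF Quotient_pow_mod_fin])
  have int_\<Phi>: "abs_pow_mod_fin (\<Phi> A \<inter> \<Phi> B) = \<theta> (abs_pow_mod_antichain (A \<inter> B))" for A B
    by (simp add: abs_\<Phi> mult flip: times_pow_mod_fin.abs_eq times_pow_mod_antichain.abs_eq)
  define G where "G x = \<Phi> (copy x UNIV)" for x
  define \<phi> where "\<phi> x a = \<Phi> (copy x a) \<inter> G x" for x a
  have abs_\<phi>: "abs_pow_mod_fin (\<phi> x a) = \<theta> (abs_pow_mod_antichain (copy x a))" for x a
  proof -
    have "copy x a \<inter> copy x UNIV = copy x a" by (auto simp: copy_def)
    then show ?thesis unfolding \<phi>_def G_def int_\<Phi> by simp
  qed
  show False
  proof (rule OCA_no_gluing_reduction[OF OCA, of \<phi> G])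
    show "\<phi> x a \<subseteq> G x" for x a by (simp add: \<phi>_def)
  next
    fix x a b assume "\<phi> x a = \<phi> x b"
    then have "\<theta> (abs_pow_mod_antichain (copy x a)) = \<theta> (abs_pow_mod_antichain (copy x b))"
      using abs_\<phi>[of x a] abs_\<phi>[of x b] by simp
    then have "abs_pow_mod_antichain (copy x a) = abs_pow_mod_antichain (copy x b)" by (rule injD[OF inj])
    then show "finite (fst ` sym_diff a b)"
      unfolding pow_mod_antichain_eq_iff copy_sym_diff copy_in_no_inf_antichain_iff .
  next
    fix n and Y :: "(nat set \<times> (nat \<times> nat) set) set"
    assume Y: "\<And>x a y b. (x, a) \<in> Y \<Longrightarrow> (y, b) \<in> Y \<Longrightarrow> (x, a) \<noteq> (y, b) \<Longrightarrow> x \<noteq> y \<and> agree n x y a b"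
    define N where "N = {p :: nat \<times> nat. n \<le> fst p}"
    \<comment> \<open>Agreement from column n on ensures that the other copies contribute no further
      nodes to the copy along \<open>x\<close>.\<close>
    define D where "D = (\<Union>(x, a)\<in>Y. copy x (a \<inter> N))"
    have "finite (sym_diff (\<phi> x a) (\<Phi> D \<inter> G x))" if xa: "(x, a) \<in> Y" for x a
    proof -
      have "D \<inter> copy x UNIV \<subseteq> copy x (a \<inter> N)"
      proof
        fix w assume w: "w \<in> D \<inter> copy x UNIV"
        then obtain y b i k where yb: "(y, b) \<in> Y" and ik: "(i, k) \<in> b" "n \<le> i" and wy: "w = node y i k"
          unfolding D_def N_def by (auto simp: copy_def)
        obtain i' k' where wx: "w = node x i' k'" using w by (auto simp: copy_def)
        have e: "i' = i" "k' = k" "x \<inter> {..<i + k} = y \<inter> {..<i + k}"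
          using wx unfolding wy node_eq_iff by auto
        have "(i, k) \<in> a"
        proof (cases "(x, a) = (y, b)")
          case False
          then have "agree n x y a b" using Y[OF xa yb] by blast
          then show ?thesis using ik e(3) unfolding agree_def by blast
        qed (use ik in simp)
        then show "w \<in> copy x (a \<inter> N)" unfolding wx e using ik(2) by (simp add: N_def)
      qed
      moreover have "copy x (a \<inter> N) \<subseteq> D \<inter> copy x UNIV" using xa unfolding D_def by (auto simp: copy_def)
      ultimately have "D \<inter> copy x UNIV = copy x (a \<inter> N)" by (rule subset_antisym)
      then have "abs_pow_mod_fin (\<Phi> D \<inter> G x) = \<theta> (abs_pow_mod_antichain (copy x (a \<inter> N)))"
        unfolding G_def int_\<Phi> by simp
      also have "abs_pow_mod_antichain (copy x (a \<inter> N)) = abs_pow_mod_antichain (copy x a)"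
      proof -
        have "fst ` sym_diff (a \<inter> N) a \<subseteq> {..<n}" by (auto simp: N_def)
        then have "finite (fst ` sym_diff (a \<inter> N) a)" by (rule finite_subset) simp
        then show ?thesis unfolding pow_mod_antichain_eq_iff copy_sym_diff copy_in_no_inf_antichain_iff .
      qed
      finally have "abs_pow_mod_fin (\<phi> x a) = abs_pow_mod_fin (\<Phi> D \<inter> G x)" unfolding abs_\<phi> by (rule sym)
      then show ?thesis unfolding pow_mod_fin_eq_iff by simp
    qed
    then show "\<exists>d. \<forall>(x, a)\<in>Y. finite (sym_diff (\<phi> x a) (d \<inter> G x))" by (intro exI[of _ "\<Phi> D"]) auto
  qed
qed

lemma OCA_U1_not_iso_U2:
  assumes open_coloring_axiom "3 \<le> n"
  shows "\<not> U1 n \<cong> U2 n"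
proof
  assume "U1 n \<cong> U2 n"
  \<comment> \<open>The injection has to start from the antichain quotient, hence the inverse
    isomorphism.\<close>
  then have "(UT n :: pow_mod_antichain mat monoid) \<cong> (UT n :: pow_mod_fin mat monoid)"
    unfolding U1_def U2_def by (rule group.iso_sym[OF group_UT])
  from UT_iso_multiplicative[OF assms(2) pow_mod_antichain_idem pow_mod_fin_idem this]
  obtain \<theta> :: "pow_mod_antichain \<Rightarrow> pow_mod_fin" where "inj \<theta>" "\<And>a b. \<theta> (a * b) = \<theta> a * \<theta> b" by blast
  then show False by (rule OCA_no_multiplicative_injection[OF assms(1)])
qed

theorem theorem6p5:
  shows "(continuum_hypothesis \<longrightarrow> (\<forall>n\<ge>3. U1 n \<cong> U2 n))
       \<and> (open_coloring_axiom \<longrightarrow> (\<forall>n\<ge>3. \<not> U1 n \<cong> U2 n))"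
  using CH_U1_iso_U2 OCA_U1_not_iso_U2 by blast

end
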